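(* The classification of triples $(a,b,d)$ defining codimension $1$ subball quotients $\mathcal{S}_\pi$ with property $G$ is identical to the classification of pseudo-discriminants with image a hypersurface. Precisely: let $a\ge b$ and $N$ be positive integers with $a\mid N$ and $b\mid N$, and put $d_1=N/a\le d_2=N/b$. Then the pseudo-discriminant $\Delta:\mathbb{WP}(d_1,d_2)\to\mathbb{P}^N$, $[A,B]\mapsto[A^a+B^b]$, has image a hypersurface (of codimension $1$) if and only if $(a,b,N)$ is one of the triples $(a,b,d)$ in the classification of $\mathcal{S}_\pi$ with property $G$, namely $(3,2,12),(4,2,8),(6,2,6),(3,3,6),(4,4,4)$.
   Context: **Pseudo-discriminant.** With $V=\mathbb{C}^2$, $\mathbb{WP}(d_1,d_2)$ is the quotient of $(Sym^{d_1}(V)\oplus Sym^{d_2}(V))\setminus\{0\}$ by $\mathbb{C}^*$ acting by $\lambda\cdot(A,B)=(\lambda^{d_1}A,\lambda^{d_2}B)$, and $\Delta$ maps $[A,B]$ to $[A^a+B^b]\in\mathbb{P}(Sym^N(V))=\mathbb{P}^N$ (where $A^a+B^b\ne0$). "Image a hypersurface" means the closure of the image has codimension 1. **Classification of $\mathcal{S}_\pi$ with property $G$.** Let $T=\{0,1,\infty\}$, and let $\pi:\mathbb{P}^1\to\mathbb{P}^1$ have degree $d$. $(\pi,T)$ has property $G$ if for each $t\in T$ all points of $\pi^{-1}(t)$ have the same ramification index $r_t$. Let $l_T\to\mathbb{P}^1\setminus T$ be the rank-1 local system with monodromies $e^{2\pi i\nu_t}$, where $\nu_t\in(0,1)\cap\mathbb{Q}$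 and $\sum\nu_t=1$. One requires that $\pi$ have property $G$ with $r_0=a$, $r_1=b$; that $\pi^*l_T$ (monodromy data $\mu$: $r_t\nu_t$ at points over $t$) have nontrivial monodromy exactly at the points of $S=\pi^{-1}(\infty)$; that the non-integral $\mu_i$ (normalized to $(0,1)$) sum to 2 and satisfy the Deligne–Mostow integrality condition $\Sigma INT$ (for some subset $S_1$ of indices of equal weight, whenever $s\ne t$ and $\mu_s+\mu_t<1$, $(1-\mu_s-\mu_t)^{-1}$ is in $\frac12\mathbb{Z}$ if $s,t\in S_1$ and in $\mathbb{Z}$ otherwise); and that the relevant cyclotomic ring is $\mathbb{Z}[\sqrt{-1}]$ or $\mathbb{Z}[e^{2\pi i/3}]$. The resulting triples $(a,b,d)$, with $\nu=(\frac1a,\frac1b,\frac2d)$, are the five listed. For them the configurations $\pi^{-1}(\infty)$, as $\pi$ varies with fixed ramification over $T$, sweep out a locus $\mathcal{S}_\pi$ whose closure is a codimension 1 subball quotient of the ball quotient $DM(d,(\frac2d)^d)$ (the moduli space of GIT-stable unordered $d$-tuples of points on $\mathbb{P}^1$ of weight $\frac2d$). *)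

theory Defs
  imports
    "HOL-Analysis.Analysis"
    "HOL-Computational_Algebra.Polynomial"
    "HOL-Library.Extended_Nat"
begin

subsection \<open>Binary forms\<close>

text \<open>
  A binary form \<open>\<Sum>i\<le>d. c\<^sub>i x^i y^(d-i)\<close> of degree \<open>d\<close>, i.e. an element of \<open>Sym^d(V)\<close> for
  \<open>V = \<complex>\<^sup>2\<close>, is encoded by its dehomogenisation \<open>\<Sum>i\<le>d. c\<^sub>i X^i\<close>, a polynomial of degree at
  most \<open>d\<close>.  Products and powers of forms become products and powers of polynomials, the
  degrees being tracked separately.
\<close>

definition Sym :: "nat \<Rightarrow> complex poly set" where
  "Sym d = {F. degree F \<le> d}"

text \<open>The form \<open>F(\<alpha> x + \<beta> y, \<gamma> x + \<delta> y)\<close>.\<close>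

definition subst_form ::
  "nat \<Rightarrow> complex \<Rightarrow> complex \<Rightarrow> complex \<Rightarrow> complex \<Rightarrow> complex poly \<Rightarrow> complex poly" where
  "subst_form d \<alpha> \<beta> \<gamma> \<delta> F =
     (\<Sum>i\<le>d. smult (coeff F i) ([:\<beta>, \<alpha>:] ^ i * [:\<delta>, \<gamma>:] ^ (d - i)))"

text \<open>
  Points of \<open>\<P>\<^sup>1\<close>: \<open>Some z\<close> is \<open>[z:1]\<close> and \<open>None\<close> is the point at infinity \<open>[1:0]\<close>.
\<close>

type_synonym P1 = "complex option"

text \<open>
  Order of vanishing at a point of \<open>\<P>\<^sup>1\<close> of a nonzero form of degree \<open>d\<close>.  At infinity the
  local coordinate is \<open>y/x\<close>.
\<close>

fun form_order :: "nat \<Rightarrow> complex poly \<Rightarrow> P1 \<Rightarrow> nat" where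
  "form_order d F (Some z) = order z F"
| "form_order d F None = d - degree F"

subsection \<open>Projective spaces of forms and the Zariski topology\<close>

definition proj_rel :: "nat \<Rightarrow> (complex poly \<times> complex poly) set" where
  "proj_rel n = {(F, G). F \<in> Sym n - {0} \<and> (\<exists>c. c \<noteq> 0 \<and> G = smult c F)}"

definition proj_space :: "nat \<Rightarrow> complex poly set set" where
  "proj_space n = (Sym n - {0}) // proj_rel n"

definition homogeneous_poly :: "nat \<Rightarrow> nat \<Rightarrow> ((nat \<Rightarrow> complex) \<Rightarrow> complex) \<Rightarrow> bool" where
  "homogeneous_poly n k f \<longleftrightarrow>
     (\<exists>(M :: (nat \<Rightarrow> nat) set) c. finite M \<and> (\<forall>m\<in>M. (\<Sum>i\<le>n. m i) = k) \<and>
        f = (\<lambda>x. \<Sum>m\<in>M. c m * (\<Prod>i\<le>n. x i ^ m i)))"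

definition zariski :: "nat \<Rightarrow> complex poly set topology" where
  "zariski n = topology_generated_by
     {{x \<in> proj_space n. \<forall>F\<in>x. f (coeff F) \<noteq> 0} | f k. homogeneous_poly n k f}"

definition irreducible_in :: "'a topology \<Rightarrow> 'a set \<Rightarrow> bool" where
  "irreducible_in X Z \<longleftrightarrow> Z \<noteq> {} \<and> Z \<subseteq> topspace X \<and>
     (\<forall>C D. closedin X C \<and> closedin X D \<and> Z \<subseteq> C \<union> D \<longrightarrow> Z \<subseteq> C \<or> Z \<subseteq> D)"

text \<open>Krull codimension of a closed subset.\<close>

definition codim_in :: "'a topology \<Rightarrow> 'a set \<Rightarrow> enat" where
  "codim_in X Y =
     (INF Z \<in> {Z. closedin X Z \<and> irreducible_in X Z \<and> Z \<subseteq> Y}.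
        SUP n \<in> {n. \<exists>C. C 0 = Z \<and> (\<forall>i\<le>n. closedin X (C i) \<and> irreducible_in X (C i)) \<and>
                       (\<forall>i<n. C i \<subset> C (Suc i))}. enat n)"

subsection \<open>Pseudo-discriminants\<close>

definition wp_rel :: "nat \<Rightarrow> nat \<Rightarrow>
    ((complex poly \<times> complex poly) \<times> (complex poly \<times> complex poly)) set" where
  "wp_rel d1 d2 = {((A, B), (A', B')). (A, B) \<in> Sym d1 \<times> Sym d2 - {(0, 0)} \<and>
     (\<exists>c. c \<noteq> 0 \<and> A' = smult (c ^ d1) A \<and> B' = smult (c ^ d2) B)}"

definition WP :: "nat \<Rightarrow> nat \<Rightarrow> (complex poly \<times> complex poly) set set" where
  "WP d1 d2 = (Sym d1 \<times> Sym d2 - {(0, 0)}) // wp_rel d1 d2"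

definition pseudo_disc_domain :: "nat \<Rightarrow> nat \<Rightarrow> nat \<Rightarrow> (complex poly \<times> complex poly) set set" where
  "pseudo_disc_domain a b N =
     {X \<in> WP (N div a) (N div b). \<forall>(A, B)\<in>X. A ^ a + B ^ b \<noteq> 0}"

definition pseudo_disc :: "nat \<Rightarrow> nat \<Rightarrow> nat \<Rightarrow> (complex poly \<times> complex poly) set \<Rightarrow> complex poly set"
  where "pseudo_disc a b N X = (\<Union>(A, B)\<in>X. proj_rel N `` {A ^ a + B ^ b})"

definition pseudo_disc_hypersurface :: "nat \<Rightarrow> nat \<Rightarrow> nat \<Rightarrow> bool" where
  "pseudo_disc_hypersurface a b N \<longleftrightarrow>
     codim_in (zariski N) (zariski N closure_of (pseudo_disc a b N ` pseudo_disc_domain a b N)) = 1"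

subsection \<open>The moduli space of stable unordered \<open>d\<close>-tuples of weight \<open>2/d\<close>\<close>

text \<open>
  An unordered \<open>d\<close>-tuple of points of \<open>\<P>\<^sup>1\<close> is the divisor of a nonzero form of degree \<open>d\<close>,
  well-defined up to scaling.  It is stable if the total weight at every point is below 1.
\<close>

definition stable :: "nat \<Rightarrow> complex poly set set" where
  "stable d = {x \<in> proj_space d. \<forall>F\<in>x. \<forall>p. real (form_order d F p) * (2 / real d) < 1}"

definition orbit :: "nat \<Rightarrow> complex poly set \<Rightarrow> complex poly set set" where
  "orbit d x = {proj_rel d `` {subst_form d \<alpha> \<beta> \<gamma> \<delta> F} | \<alpha> \<beta> \<gamma> \<delta> F.
                  F \<in> x \<and> \<alpha> * \<delta> - \<beta> * \<gamma> \<noteq> 0}"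

text \<open>
  The geometric quotient of the stable locus by \<open>PGL\<^sub>2\<close>; its Zariski topology is the
  quotient topology.
\<close>

definition DM :: "nat \<Rightarrow> complex poly set set topology" where
  "DM d = topology (\<lambda>U. U \<subseteq> orbit d ` stable d \<and>
     openin (subtopology (zariski d) (stable d)) {x \<in> stable d. orbit d x \<in> U})"

lemma istopology_DM:
  "istopology (\<lambda>U. U \<subseteq> orbit d ` stable d \<and>
     openin (subtopology (zariski d) (stable d)) {x \<in> stable d. orbit d x \<in> U})"
proof -
  have 1: "{x \<in> stable d. orbit d x \<in> S \<inter> T} =
      {x \<in> stable d. orbit d x \<in> S} \<inter> {x \<in> stable d. orbit d x \<in> T}" for S T
    by auto
  have 2: "{x \<in> stable d. orbit d x \<in> \<Union>K} = (\<Union>U\<in>K. {x \<in> stable d. orbit d x \<in> U})" for K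
    by auto
  show ?thesis
    unfolding istopology_def 1 2 by (auto intro!: openin_Int openin_Union)
qed

subsection \<open>Maps \<open>\<P>\<^sup>1 \<rightarrow> \<P>\<^sup>1\<close> with property \<open>G\<close>\<close>

text \<open>Two forms of degree \<open>d\<close> without common zero define a map \<open>[P:Q]\<close> of degree \<open>d\<close>.\<close>

definition degree_map :: "nat \<Rightarrow> complex poly \<Rightarrow> complex poly \<Rightarrow> bool" where
  "degree_map d P Q \<longleftrightarrow> d > 0 \<and> coprime P Q \<and> max (degree P) (degree Q) = d"

fun rat_map :: "nat \<Rightarrow> complex poly \<Rightarrow> complex poly \<Rightarrow> P1 \<Rightarrow> P1" where
  "rat_map d P Q (Some z) = (if poly Q z = 0 then None else Some (poly P z / poly Q z))"
| "rat_map d P Q None = (if coeff Q d = 0 then None else Some (coeff P d / coeff Q d))"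

text \<open>The form whose divisor is the scheme-theoretic fibre of \<open>[P:Q]\<close> over a point.\<close>

fun fibre_form :: "complex poly \<Rightarrow> complex poly \<Rightarrow> P1 \<Rightarrow> complex poly" where
  "fibre_form P Q (Some t) = P - smult t Q"
| "fibre_form P Q None = Q"

definition ram_index :: "nat \<Rightarrow> complex poly \<Rightarrow> complex poly \<Rightarrow> P1 \<Rightarrow> nat" where
  "ram_index d P Q p = form_order d (fibre_form P Q (rat_map d P Q p)) p"

definition branch_pts :: "P1 set" where
  "branch_pts = {Some 0, Some 1, None}"

definition property_G :: "nat \<Rightarrow> complex poly \<Rightarrow> complex poly \<Rightarrow> (P1 \<Rightarrow> nat) \<Rightarrow> bool" where
  "property_G d P Q r \<longleftrightarrow> degree_map d P Q \<and>
     (\<forall>p. rat_map d P Q p \<in> branch_pts \<longrightarrow> ram_index d P Q p = r (rat_map d P Q p))"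

text \<open>
  The configurations \<open>\<pi>\<^sup>-\<^sup>1(\<infinity>)\<close>, as points of the moduli space, where \<open>\<pi>\<close> ranges over all maps
  of degree \<open>d\<close> with ramification index \<open>r t\<close> at every point over \<open>t \<in> {0, 1, \<infinity>}\<close>.
\<close>

definition S_locus :: "nat \<Rightarrow> (P1 \<Rightarrow> nat) \<Rightarrow> complex poly set set set" where
  "S_locus d r = {orbit d (proj_rel d `` {Q}) | P Q. property_G d P Q r} \<inter> topspace (DM d)"

subsection \<open>The classification of codimension 1 loci with property \<open>G\<close>\<close>

definition SigmaINT :: "'i set \<Rightarrow> ('i \<Rightarrow> real) \<Rightarrow> bool" where
  "SigmaINT S \<mu> \<longleftrightarrow> (\<exists>S1 \<subseteq> S. (\<forall>s\<in>S1. \<forall>t\<in>S1. \<mu> s = \<mu> t) \<and>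
     (\<forall>s\<in>S. \<forall>t\<in>S. s \<noteq> t \<and> \<mu> s + \<mu> t < 1 \<longrightarrow>
        (if s \<in> S1 \<and> t \<in> S1 then 2 * inverse (1 - \<mu> s - \<mu> t) \<in> \<int>
         else inverse (1 - \<mu> s - \<mu> t) \<in> \<int>)))"

definition subring_generated :: "complex set \<Rightarrow> complex set" where
  "subring_generated Z = (\<lambda>R. 1 \<in> R \<and> (\<forall>x\<in>R. \<forall>y\<in>R. x - y \<in> R \<and> x * y \<in> R)) hull Z"

text \<open>
  \<open>\<nu> t\<close> are the exponents of the rank-1 local system on the
  complement of \<open>{0, 1, \<infinity>}\<close>, with monodromy \<open>exp (2 \<pi> \<i> \<nu> t)\<close> at \<open>t\<close>.  A small loop around a point \<open>p\<close> of
  ramification index \<open>e\<close> maps to the \<open>e\<close>-th power of a loop around the image of \<open>p\<close>, so the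
  pullback has monodromy \<open>exp (2 \<pi> \<i> e \<nu> t)\<close> there.  That every point of \<open>S\<close> has weight
  \<open>2/d\<close> says that \<open>S\<close> is a configuration of the kind parametrised by \<open>DM d\<close>; as the weights
  sum to 2, it then consists of \<open>d\<close> distinct points.
\<close>

definition G_data ::
  "nat \<Rightarrow> complex poly \<Rightarrow> complex poly \<Rightarrow> (P1 \<Rightarrow> nat) \<Rightarrow> (P1 \<Rightarrow> real) \<Rightarrow> bool" where
  "G_data d P Q r \<nu> \<longleftrightarrow>
     (let \<pi> = rat_map d P Q;
          S = {p. \<pi> p = None};
          \<mu> = (\<lambda>p. frac (real (ram_index d P Q p) * \<nu> (\<pi> p)))
      in property_G d P Q r \<and>
         (\<forall>t\<in>branch_pts. \<nu> t \<in> \<rat> \<and> 0 < \<nu> t \<and> \<nu> t < 1) \<and> (\<Sum>t\<in>branch_pts. \<nu> t) = 1 \<and>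
         {p. \<pi> p \<in> branch_pts \<and> cis (2 * pi * \<nu> (\<pi> p)) ^ ram_index d P Q p \<noteq> 1} = S \<and>
         (\<forall>p\<in>S. \<mu> p = 2 / real d) \<and> (\<Sum>p\<in>S. \<mu> p) = 2 \<and> SigmaINT S \<mu> \<and>
         subring_generated ((\<lambda>t. cis (2 * pi * \<nu> t)) ` branch_pts) \<in>
           {subring_generated {\<i>}, subring_generated {cis (2 * pi / 3)}})"

definition G_triple :: "nat \<Rightarrow> nat \<Rightarrow> nat \<Rightarrow> bool" where
  "G_triple a b d \<longleftrightarrow> (\<exists>P Q r \<nu>. G_data d P Q r \<nu> \<and> r (Some 0) = a \<and> r (Some 1) = b \<and>
     codim_in (DM d) (DM d closure_of S_locus d r) = 1)"

end

theory Submission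
  imports Defs "HOL-Computational_Algebra.Fundamental_Theorem_Algebra" "HOL-Library.Real_Mod"
begin

text \<open>
  Let \<open>d\<^sub>1 = N/a\<close>, \<open>d\<^sub>2 = N/b\<close>.  The forms \<open>A^a + B^b\<close> depend on \<open>d\<^sub>1 + d\<^sub>2 + 2\<close> parameters in the
  \<open>(N+1)\<close>-dimensional space of forms of degree \<open>N\<close>.  If \<open>a, b \<ge> 2\<close> and \<open>d\<^sub>1 + d\<^sub>2 < N\<close>, then the lowest
  \<open>d\<^sub>2 + 1\<close> and the highest \<open>d\<^sub>1 + 1\<close> coefficients of \<open>A^a + B^b\<close> are algebraically independent, as one
  sees by expanding to first order at \<open>(x^d\<^sub>1, y^d\<^sub>2)\<close>.  So the image is a hypersurface exactly if
  \<open>d\<^sub>1 + d\<^sub>2 + 2 = N\<close>, i.e. \<open>1/a + 1/b + 2/N = 1\<close>, whose solutions are the five triples.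

  Krull codimension is controlled by Hilbert functions instead of dimension theory.  If \<open>Z \<subset> W\<close> with \<open>W\<close>
  irreducible, and a form \<open>G\<close> vanishes on \<open>Z\<close> but not on \<open>W\<close>, then multiplication by \<open>G\<close> is injective on
  \<open>W\<close>, hence \<open>h\<^sub>W(k) \<ge> h\<^sub>W(k - deg G) + h\<^sub>Z(k)\<close>, and the order of growth increases strictly along a
  chain.  An upper bound comes from counting weighted monomials: more forms than monomials in the
  parameters give a form that vanishes on the image.  A chain above an image that is too small
  is obtained by joining it with a point.

  A map with property \<open>G\<close> has the form \<open>[A^a : A^a + B^b]\<close> up to roots of unity, with \<open>A\<close>, \<open>B\<close> and
  \<open>A^a + B^b\<close> free of multiple zeros. Hence the locus of its poles is the image of the pseudo-discriminant,
  intersected with an open set and divided by \<open>PGL\<^sub>2\<close>.  As \<open>PGL\<^sub>2\<close> is irreducible, the preimage of an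
  irreducible closed set of the moduli space is irreducible, and the same Hilbert function
  argument applies.  The conditions on the exponents force \<open>N \<in> {4, 6, 8, 12}\<close> and that the exponents
  \<open>a\<close>, \<open>b\<close> are multiples of those of one of the five triples, whose locus then lies strictly
  between a smaller locus and the whole moduli space.
\<close>


subsection \<open>Weighted homogeneous polynomial functions\<close>

text \<open>Images and loci of poles need not be closed. Everything is therefore expressed on sets
  of coefficient vectors: such a set is prime if a product of two forms vanishes on it only when a
  factor does. Vanishing of forms passes from a part of the set to all of it as soon as each point
  is reached by a polynomial curve that meets the part for infinitely many parameters.
  Irreducibility and density thus reduce to polynomials in one variable. In the moduli space, an
  arbitrary form \<open>f\<close> cuts out the closed set of orbits on which it vanishes
  identically, and chains of irreducible closed sets are measured by their preimages among the
  forms. The delicate point is to exclude further triples: the exponents over 0 and 1 are m/a and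
  n/b, where a priori m and n may exceed 1, so d1 + d2 + 2 < N has to be considered and the locus
  shown to have codimension at least 2. The join with a point, which settles this in projective
  space, is not invariant under substitutions; hence the passage to a pair of exponents that divide
  the given ones.\<close>

lemma underdetermined_system:
  fixes a :: "'i \<Rightarrow> 'j \<Rightarrow> 'a::field"
  assumes "finite J" "finite I" "card J < card I"
  shows "\<exists>c. (\<exists>i\<in>I. c i \<noteq> 0) \<and> (\<forall>j\<in>J. (\<Sum>i\<in>I. c i * a i j) = 0)"
  using assms
proof (induction J arbitrary: I a rule: finite_induct)
  case empty
  then have "I \<noteq> {}" by auto
  then show ?case by (intro exI[of _ "\<lambda>_. 1"]) auto
next
  case (insert j J)
  show ?case
  proof (cases "\<forall>i\<in>I. a i j = 0")
    case True
    have "card J < card I" using insert by simp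
    from insert.IH[OF insert.prems(1) this, of a] obtain c where
      "\<exists>i\<in>I. c i \<noteq> 0" "\<forall>j\<in>J. (\<Sum>i\<in>I. c i * a i j) = 0" by blast
    then show ?thesis using True by (intro exI[of _ c]) auto
  next
    case False
    then obtain i0 where i0: "i0 \<in> I" "a i0 j \<noteq> 0" by auto
    \<comment> \<open>Row reduction: the unknown \<open>i0\<close> is eliminated by means of
      equation \<open>j\<close>, and \<open>c'\<close> recovers its value from that equation
      afterwards.\<close>
    define a' where "a' = (\<lambda>i l. a i l - a i j / a i0 j * a i0 l)"
    have "card J < card (I - {i0})" using insert i0 by auto
    from insert.IH[OF _ this, of a'] insert.prems(1) obtain c where
      c: "\<exists>i\<in>I - {i0}. c i \<noteq> 0" "\<forall>l\<in>J. (\<Sum>i\<in>I - {i0}. c i * a' i l) = 0" by auto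
    define c' where "c' = c(i0 := - (\<Sum>i\<in>I-{i0}. c i * a i j / a i0 j))"
    have eq: "(\<Sum>i\<in>I. c' i * a i l) = (\<Sum>i\<in>I - {i0}. c i * a' i l)" for l
    proof -
      have "(\<Sum>i\<in>I. c' i * a i l) = c' i0 * a i0 l + (\<Sum>i\<in>I-{i0}. c' i * a i l)"
        using i0 insert.prems by (simp add: sum.remove)
      also have "(\<Sum>i\<in>I-{i0}. c' i * a i l) = (\<Sum>i\<in>I-{i0}. c i * a i l)"
        by (rule sum.cong) (auto simp: c'_def)
      also have "c' i0 * a i0 l + (\<Sum>i\<in>I-{i0}. c i * a i l) = (\<Sum>i\<in>I - {i0}. c i * a' i l)"
        by (simp add: c'_def a'_def algebra_simps sum_subtractf sum_distrib_left)
      finally show ?thesis .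
    qed
    have "\<exists>i\<in>I. c' i \<noteq> 0" using c(1) by (auto simp: c'_def)
    moreover have "(\<Sum>i\<in>I. c' i * a i l) = 0" if "l \<in> insert j J" for l
      using that c(2) i0 unfolding eq by (auto simp: a'_def)
    ultimately show ?thesis by blast
  qed
qed

definition mon :: "nat set \<Rightarrow> (nat \<Rightarrow> nat) \<Rightarrow> (nat \<Rightarrow> complex) \<Rightarrow> complex" where
  "mon I m x = (\<Prod>i\<in>I. x i ^ m i)"

text \<open>Exponents are functions on all of \<open>nat\<close>; forcing them to vanish outside
  \<open>I\<close> makes each monomial in the variables of \<open>I\<close> occur exactly
  once.\<close>

definition mons :: "nat set \<Rightarrow> (nat \<Rightarrow> nat) \<Rightarrow> nat \<Rightarrow> (nat \<Rightarrow> nat) set" where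
  "mons I w k = {m. (\<forall>i. i \<notin> I \<longrightarrow> m i = 0) \<and> (\<Sum>i\<in>I. w i * m i) = k}"

lemma mons_le:
  assumes "finite I" "\<forall>i\<in>I. w i > 0" "m \<in> mons I w k"
  shows "m i \<le> k"
proof (cases "i \<in> I")
  case True
  have "m i \<le> w i * m i" using assms True by auto
  also have "\<dots> \<le> (\<Sum>i\<in>I. w i * m i)" using assms True by (intro member_le_sum) auto
  finally show ?thesis using assms by (simp add: mons_def)
qed (use assms in \<open>auto simp: mons_def\<close>)

lemma finite_mons:
  assumes "finite I" "\<forall>i\<in>I. w i > 0"
  shows "finite (mons I w k)"
proof (rule finite_subset)
  show "mons I w k \<subseteq> {m. \<forall>i. (i \<in> I \<longrightarrow> m i \<in> {..k}) \<and> (i \<notin> I \<longrightarrow> m i = 0)}"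
    using mons_le[OF assms] by (auto simp: mons_def)
  show "finite {m. \<forall>i. (i \<in> I \<longrightarrow> m i \<in> {..k}) \<and> (i \<notin> I \<longrightarrow> m i = 0)}"
    by (rule finite_set_of_finite_funs) (use assms in auto)
qed

text \<open>The exponent of one variable \<open>i0\<close> is determined by the others through the
  weighted degree, as \<open>w i0 > 0\<close>, and each of the others takes at most
  \<open>k + 1\<close> values.\<close>

lemma card_mons_le:
  assumes "finite I" "\<forall>i\<in>I. w i > 0" "I \<noteq> {}"
  shows "card (mons I w k) \<le> (k + 1) ^ (card I - 1)"
proof -
  obtain i0 where i0: "i0 \<in> I" using assms by auto
  let ?R = "\<lambda>m. restrict m (I - {i0})"
  have inj: "inj_on ?R (mons I w k)"
  proof (rule inj_onI)
    fix m m' assume m: "m \<in> mons I w k" "m' \<in> mons I w k" and e: "?R m = ?R m'"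
    have e': "m i = m' i" if "i \<noteq> i0" for i
      using fun_cong[OF e, of i] m that by (cases "i \<in> I") (auto simp: mons_def)
    have "w i0 * m i0 + (\<Sum>i\<in>I-{i0}. w i * m i) = w i0 * m' i0 + (\<Sum>i\<in>I-{i0}. w i * m' i)"
      using m i0 assms unfolding mons_def by (simp add: sum.remove)
    moreover have "(\<Sum>i\<in>I-{i0}. w i * m i) = (\<Sum>i\<in>I-{i0}. w i * m' i)"
      by (rule sum.cong) (auto simp: e')
    ultimately have "m i0 = m' i0" using assms i0 by auto
    then show "m = m'" using e' by (intro ext) metis
  qed
  have "card (mons I w k) \<le> card (PiE (I - {i0}) (\<lambda>_. {..k}))"
    by (rule card_inj_on_le[OF inj]) (use mons_le[OF assms(1,2)] assms in \<open>auto intro!: finite_PiE\<close>)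
  also have "\<dots> = (k + 1) ^ (card I - 1)"
    using assms i0 by (simp add: card_PiE)
  finally show ?thesis .
qed

text \<open>All exponents but one are chosen freely up to \<open>k div card I\<close>, and the
  variable \<open>i0\<close> absorbs the missing degree.\<close>

lemma card_mons_ge:
  assumes "finite I" "I \<noteq> {}"
  shows "(k div card I + 1) ^ (card I - 1) \<le> card (mons I (\<lambda>_. 1) k)"
proof -
  obtain i0 where i0: "i0 \<in> I" using assms by auto
  let ?q = "k div card I"
  let ?S = "PiE (I - {i0}) (\<lambda>_. {..?q})"
  let ?h = "\<lambda>g i. if i = i0 then k - (\<Sum>j\<in>I-{i0}. g j) else if i \<in> I then g i else (0::nat)"
  have inj: "inj_on ?h ?S"
  proof (rule inj_onI)
    fix g g' assume g: "g \<in> ?S" "g' \<in> ?S" and e: "?h g = ?h g'"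
    show "g = g'"
    proof (rule PiE_ext[OF g])
      fix i assume "i \<in> I - {i0}"
      then show "g i = g' i" using fun_cong[OF e, of i] by auto
    qed
  qed
  have sub: "?h ` ?S \<subseteq> mons I (\<lambda>_. 1) k"
  proof
    fix m assume "m \<in> ?h ` ?S"
    then obtain g where g: "g \<in> ?S" "m = ?h g" by auto
    have "(\<Sum>j\<in>I-{i0}. g j) \<le> (\<Sum>j\<in>I-{i0}. ?q)" using g by (intro sum_mono) auto
    also have "\<dots> \<le> card I * ?q" by (simp add: assms i0)
    also have "\<dots> \<le> k" by simp
    finally have le: "(\<Sum>j\<in>I-{i0}. g j) \<le> k" .
    have "(\<Sum>i\<in>I. m i) = m i0 + (\<Sum>i\<in>I-{i0}. m i)" using assms i0 by (simp add: sum.remove)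
    also have "(\<Sum>i\<in>I-{i0}. m i) = (\<Sum>i\<in>I-{i0}. g i)"
      by (rule sum.cong) (auto simp: g)
    also have "m i0 + \<dots> = k" using le g by simp
    finally show "m \<in> mons I (\<lambda>_. 1) k" using g i0 by (auto simp: mons_def)
  qed
  have "card ?S \<le> card (mons I (\<lambda>_. 1) k)"
    by (rule card_inj_on_le[OF inj sub]) (use finite_mons[OF assms(1)] in auto)
  moreover have "card ?S = (?q + 1) ^ (card I - 1)" using assms i0 by (simp add: card_PiE)
  ultimately show ?thesis by simp
qed

definition wform :: "nat set \<Rightarrow> (nat \<Rightarrow> nat) \<Rightarrow> nat \<Rightarrow> ((nat \<Rightarrow> complex) \<Rightarrow> complex) \<Rightarrow> bool" where
  "wform I w k f \<longleftrightarrow> (\<exists>c. f = (\<lambda>x. \<Sum>m\<in>mons I w k. c m * mon I m x))"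

context
  fixes I :: "nat set" and w :: "nat \<Rightarrow> nat"
  assumes fin: "finite I" and wpos: "\<forall>i\<in>I. w i > 0"
begin

text \<open>The exponents \<open>e j\<close> may repeat; equal ones are collected. This is what
  makes weighted forms closed under products.\<close>

lemma wform_family:
  assumes "finite J" "\<And>j. j \<in> J \<Longrightarrow> e j \<in> mons I w k"
  shows "wform I w k (\<lambda>x. \<Sum>j\<in>J. c j * mon I (e j) x)"
proof -
  have "(\<Sum>j\<in>J. c j * mon I (e j) x) =
      (\<Sum>m\<in>mons I w k. (\<Sum>j | j \<in> J \<and> e j = m. c j) * mon I m x)" for x
  proof -
    have "(\<Sum>j\<in>J. c j * mon I (e j) x) =
        (\<Sum>m\<in>mons I w k. \<Sum>j | j \<in> J \<and> e j = m. c j * mon I (e j) x)"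
      by (rule sum.group[symmetric]) (use assms finite_mons[OF fin wpos] in auto)
    also have "\<dots> = (\<Sum>m\<in>mons I w k. (\<Sum>j | j \<in> J \<and> e j = m. c j) * mon I m x)"
      by (intro sum.cong) (auto simp: sum_distrib_right)
    finally show ?thesis .
  qed
  then show ?thesis unfolding wform_def by auto
qed

lemma wform_zero: "wform I w k (\<lambda>x. 0)"
  unfolding wform_def by (intro exI[of _ "\<lambda>_. 0"]) auto

lemma wform_const: "wform I w 0 (\<lambda>x. c)"
  using wform_family[of "{()}" "\<lambda>_ _. 0" 0 "\<lambda>_. c"] by (simp add: mons_def mon_def)

lemma wform_var:
  assumes "i \<in> I" shows "wform I w (w i) (\<lambda>x. x i)"
proof -
  let ?e = "\<lambda>j. if j = i then 1 else (0::nat)"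
  have "?e \<in> mons I w (w i)" using assms fin
    by (auto simp: mons_def if_distrib[of "\<lambda>t. _ * t"] cong: if_cong)
  moreover have "mon I ?e x = x i" for x using assms fin
    by (simp add: mon_def if_distrib[of "\<lambda>t. _ ^ t"] prod.delta cong: if_cong)
  ultimately show ?thesis using wform_family[of "{()}" "\<lambda>_. ?e" "w i" "\<lambda>_. 1"] by simp
qed

lemma wform_add:
  assumes "wform I w k f" "wform I w k g" shows "wform I w k (\<lambda>x. f x + g x)"
proof -
  obtain c d where "f = (\<lambda>x. \<Sum>m\<in>mons I w k. c m * mon I m x)"
    "g = (\<lambda>x. \<Sum>m\<in>mons I w k. d m * mon I m x)" using assms unfolding wform_def by auto
  then show ?thesis unfolding wform_def
    by (intro exI[of _ "\<lambda>m. c m + d m"]) (simp add: sum.distrib algebra_simps)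
qed

lemma wform_sum:
  assumes "\<And>j. j \<in> J \<Longrightarrow> wform I w k (f j)" shows "wform I w k (\<lambda>x. \<Sum>j\<in>J. f j x)"
  using assms by (induction J rule: infinite_finite_induct) (auto intro: wform_zero wform_add)

lemma wform_mult:
  assumes "wform I w k f" "wform I w l g" shows "wform I w (k + l) (\<lambda>x. f x * g x)"
proof -
  obtain c d where fg: "f = (\<lambda>x. \<Sum>m\<in>mons I w k. c m * mon I m x)"
    "g = (\<lambda>x. \<Sum>m\<in>mons I w l. d m * mon I m x)" using assms unfolding wform_def by auto
  have "f x * g x = (\<Sum>p\<in>mons I w k \<times> mons I w l.
      (c (fst p) * d (snd p)) * mon I (\<lambda>i. fst p i + snd p i) x)" for x
    unfolding fg sum_product sum.cartesian_product
    by (rule sum.cong) (auto simp: mon_def power_add prod.distrib)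
  then show ?thesis
    using wform_family[of "mons I w k \<times> mons I w l" "\<lambda>p i. fst p i + snd p i" "k + l"
        "\<lambda>p. c (fst p) * d (snd p)"] finite_mons[OF fin wpos]
    by (auto simp: mons_def sum.distrib algebra_simps)
qed

lemma wform_cmult: "wform I w k f \<Longrightarrow> wform I w k (\<lambda>x. c * f x)"
  using wform_mult[OF wform_const, of k f c] by simp

lemma wform_power: "wform I w k f \<Longrightarrow> wform I w (n * k) (\<lambda>x. f x ^ n)"
  by (induction n) (auto intro: wform_const wform_mult)

lemma wform_prod:
  assumes "finite J" "\<And>j. j \<in> J \<Longrightarrow> wform I w (k j) (f j)"
  shows "wform I w (\<Sum>j\<in>J. k j) (\<lambda>x. \<Prod>j\<in>J. f j x)"
  using assms by (induction J rule: finite_induct) (auto intro: wform_const wform_mult)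

lemma wform_mon:
  assumes "finite J" "m \<in> mons J (\<lambda>_. 1) k" "\<And>j. j \<in> J \<Longrightarrow> wform I w K (\<psi> j)"
  shows "wform I w (K * k) (\<lambda>t. mon J m (\<lambda>j. \<psi> j t))"
proof -
  have "wform I w (\<Sum>j\<in>J. m j * K) (\<lambda>t. \<Prod>j\<in>J. \<psi> j t ^ m j)"
    using assms by (intro wform_prod wform_power) auto
  moreover have "(\<Sum>j\<in>J. m j * K) = K * k" using assms(2)
    by (simp add: mons_def flip: sum_distrib_right)
  ultimately show ?thesis by (simp add: mon_def)
qed

end

lemma wform_compose:
  assumes "finite I" "\<forall>i\<in>I. w i > 0" "finite J" "wform J (\<lambda>_. 1) k f"
    "\<And>j. j \<in> J \<Longrightarrow> wform I w K (\<psi> j)"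
  shows "wform I w (K * k) (\<lambda>t. f (\<lambda>j. \<psi> j t))"
proof -
  obtain c where f: "f = (\<lambda>x. \<Sum>m\<in>mons J (\<lambda>_. 1) k. c m * mon J m x)"
    using assms unfolding wform_def by auto
  show ?thesis unfolding f
    by (intro wform_sum wform_cmult wform_mon assms) (use assms in auto)
qed

lemma mon_restrict:
  assumes "finite J" "I \<subseteq> J" "\<forall>i. i \<notin> I \<longrightarrow> m i = 0"
  shows "mon J m x = mon I m x"
  unfolding mon_def by (rule prod.mono_neutral_right) (use assms in auto)

lemma mons_subset:
  assumes "finite J" "I \<subseteq> J" shows "mons I w k \<subseteq> mons J w k"
proof
  fix m assume m: "m \<in> mons I w k"
  then have "(\<Sum>i\<in>J. w i * m i) = (\<Sum>i\<in>I. w i * m i)"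
    by (intro sum.mono_neutral_right) (use assms in \<open>auto simp: mons_def\<close>)
  then show "m \<in> mons J w k" using m assms by (auto simp: mons_def)
qed

text \<open>In \<open>homogeneous_poly\<close> the exponents are arbitrary beyond \<open>n\<close>,
  and different exponent functions may give the same monomial; truncating and collecting them leads
  to the normal form of \<open>wform\<close>.\<close>

lemma homogeneous_poly_iff_wform: "homogeneous_poly n k f \<longleftrightarrow> wform {..n} (\<lambda>_. 1) k f"
proof
  assume "homogeneous_poly n k f"
  then obtain M c where M: "finite M" "\<forall>m\<in>M. (\<Sum>i\<le>n. m i) = k"
    "f = (\<lambda>x. \<Sum>m\<in>M. c m * (\<Prod>i\<le>n. x i ^ m i))" unfolding homogeneous_poly_def by blast
  have "wform {..n} (\<lambda>_. 1) k (\<lambda>x. \<Sum>m\<in>M. c m * mon {..n} (\<lambda>i. if i \<le> n then m i else 0) x)"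
    by (rule wform_family) (use M in \<open>auto simp: mons_def\<close>)
  moreover have "mon {..n} (\<lambda>i. if i \<le> n then m i else 0) x = (\<Prod>i\<le>n. x i ^ m i)" for x m
    unfolding mon_def by (rule prod.cong) auto
  ultimately show "wform {..n} (\<lambda>_. 1) k f" using M by simp
next
  assume "wform {..n} (\<lambda>_. 1) k f"
  then show "homogeneous_poly n k f" unfolding wform_def homogeneous_poly_def
    using finite_mons[of "{..n}" "\<lambda>_. 1" k]
    by (auto simp: mons_def mon_def intro!: exI[of _ "mons {..n} (\<lambda>_. 1) k"])
qed

lemma digits_less:
  fixes m :: "nat \<Rightarrow> nat"
  assumes "\<And>i. m i < B" shows "(\<Sum>i<L. m i * B ^ i) < B ^ L"
proof (induction L)
  case (Suc L)
  have "(\<Sum>i<Suc L. m i * B ^ i) < B ^ L + m L * B ^ L" using Suc by simp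
  also have "\<dots> = (m L + 1) * B ^ L" by simp
  also have "\<dots> \<le> B * B ^ L" using assms[of L] by (intro mult_right_mono) auto
  finally show ?case by simp
qed simp

lemma digits_unique:
  fixes m m' :: "nat \<Rightarrow> nat"
  assumes "\<And>i. m i < B" "\<And>i. m' i < B" "(\<Sum>i<L. m i * B ^ i) = (\<Sum>i<L. m' i * B ^ i)" "i < L"
  shows "m i = m' i"
  using assms(3,4)
proof (induction L)
  case (Suc L)
  have lt: "(\<Sum>i<L. m i * B ^ i) < B ^ L" "(\<Sum>i<L. m' i * B ^ i) < B ^ L"
    using digits_less assms by auto
  have "B ^ L > 0" using assms(1)[of 0] by simp
  then have "m L = (\<Sum>i<Suc L. m i * B ^ i) div B ^ L" using lt by (simp add: div_add1_eq)
  also have "\<dots> = m' L" unfolding Suc.prems using lt \<open>B ^ L > 0\<close> by (simp add: div_add1_eq)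
  finally have "m L = m' L" .
  then show ?case using Suc by (cases "i = L") auto
qed simp

text \<open>Kronecker substitution \<open>x\<^sub>i = s^(B^i)\<close> sends distinct monomials to distinct powers of \<open>s\<close>.\<close>

lemma mon_independent:
  assumes "finite I" "finite S" "\<forall>m\<in>S. \<forall>i. i \<notin> I \<longrightarrow> m i = 0"
    and van: "\<And>x. (\<And>i. x i \<noteq> 0) \<Longrightarrow> (\<Sum>m\<in>S. c m * mon I m x) = 0"
    and "m0 \<in> S"
  shows "c m0 = 0"
proof -
  \<comment> \<open>\<open>B\<close> exceeds every exponent that occurs, so the exponents are the
    base \<open>B\<close> digits of \<open>code m\<close>.\<close>
  define B where "B = Suc (Max (insert 0 ((\<lambda>(m, i). m i) ` (S \<times> I))))"
  obtain L where L: "I \<subseteq> {..<L}" using assms(1) finite_nat_bounded by auto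
  have B: "m i < B" if "m \<in> S" for m i
  proof (cases "i \<in> I")
    case True
    then show ?thesis unfolding B_def using that assms by (auto simp: less_Suc_eq_le intro!: Max_ge)
  qed (use assms that in \<open>auto simp: B_def\<close>)
  define code where "code m = (\<Sum>i<L. m i * B ^ i)" for m :: "nat \<Rightarrow> nat"
  have inj: "inj_on code S"
  proof (rule inj_onI)
    fix m m' assume m: "m \<in> S" "m' \<in> S" "code m = code m'"
    show "m = m'"
    proof
      fix i show "m i = m' i"
      proof (cases "i < L")
        case True
        then show ?thesis using digits_unique[of m B m' L i] B m unfolding code_def by auto
      next
        case False
        then have "i \<notin> I" using L by auto
        then have "m i = 0" "m' i = 0" using m(1,2) assms(3) by blast+
        then show ?thesis by simp
      qed
    qed
  qed
  define p where "p = (\<Sum>m\<in>S. monom (c m) (code m))"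
  \<comment> \<open>The hypothesis covers only points with nonzero coordinates, so
    \<open>s = 0\<close> is left out; infinitely many roots remain.\<close>
  have "poly p s = 0" if "s \<noteq> 0" for s
  proof -
    have "mon I m (\<lambda>i. s ^ (B ^ i)) = s ^ code m" if "m \<in> S" for m
    proof -
      have "code m = (\<Sum>i\<in>I. m i * B ^ i)" unfolding code_def
        by (rule sum.mono_neutral_right) (use L that assms in auto)
      then show ?thesis by (simp add: mon_def power_sum mult.commute flip: power_mult)
    qed
    then have "poly p s = (\<Sum>m\<in>S. c m * mon I m (\<lambda>i. s ^ (B ^ i)))"
      by (simp add: p_def poly_sum poly_monom)
    also have "\<dots> = 0" by (rule van) (use that in auto)
    finally show ?thesis .
  qed
  then have sub: "UNIV - {0} \<subseteq> {s. poly p s = 0}" by auto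
  have "p = 0"
  proof (rule ccontr)
    assume "p \<noteq> 0"
    then have "finite (UNIV - {0::complex})" using poly_roots_finite sub finite_subset by blast
    then show False using infinite_UNIV_char_0[where 'a = complex] by simp
  qed
  then have "coeff p (code m0) = 0" by simp
  moreover have "coeff p (code m0) = (\<Sum>m\<in>S. if m = m0 then c m else 0)"
    unfolding p_def coeff_sum using inj assms(5)
    by (intro sum.cong) (auto simp: inj_on_def)
  ultimately show ?thesis using assms by simp
qed

subsection \<open>Growth of Hilbert functions\<close>

lemma homogeneous_poly_mult:
  "homogeneous_poly n k f \<Longrightarrow> homogeneous_poly n l g \<Longrightarrow> homogeneous_poly n (k + l) (\<lambda>x. f x * g x)"
  unfolding homogeneous_poly_iff_wform by (rule wform_mult) auto

lemma homogeneous_poly_const: "homogeneous_poly n 0 (\<lambda>x. c)"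
  unfolding homogeneous_poly_iff_wform by (rule wform_const) auto

lemma homogeneous_poly_0_const: "homogeneous_poly n 0 f \<Longrightarrow> f x = f y"
proof -
  have "mons {..n} (\<lambda>_. 1) 0 = {\<lambda>_. 0}"
  proof (intro equalityI subsetI)
    fix m assume "m \<in> mons {..n} (\<lambda>_. 1) 0"
    then have "m i = 0" for i by (cases "i \<le> n") (auto simp: mons_def)
    then show "m \<in> {\<lambda>_. 0}" by auto
  qed (auto simp: mons_def)
  then show "homogeneous_poly n 0 f \<Longrightarrow> f x = f y"
    unfolding homogeneous_poly_iff_wform wform_def by (auto simp: mon_def)
qed

text \<open>The homogeneous ideal of \<open>E\<close> is prime, tested on forms. Stating it for
  arbitrary sets of vectors lets it pass between a set and a dense part without taking
  closures.\<close>

definition prime_set :: "nat \<Rightarrow> (nat \<Rightarrow> complex) set \<Rightarrow> bool" where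
  "prime_set n E \<longleftrightarrow> (\<forall>k l f g. homogeneous_poly n k f \<longrightarrow> homogeneous_poly n l g \<longrightarrow>
     (\<forall>x\<in>E. f x * g x = 0) \<longrightarrow> (\<forall>x\<in>E. f x = 0) \<or> (\<forall>x\<in>E. g x = 0))"

text \<open>Equivalently, the Hilbert function of \<open>E\<close> in degree \<open>k\<close> is at
  least \<open>D\<close>. It is recorded through explicit independent forms, which can be multiplied
  and merged.\<close>

definition indep_forms :: "nat \<Rightarrow> nat \<Rightarrow> (nat \<Rightarrow> complex) set \<Rightarrow> nat \<Rightarrow> bool" where
  "indep_forms n k E D \<longleftrightarrow> (\<exists>F. (\<forall>i<D. homogeneous_poly n k (F i)) \<and>
     (\<forall>c. (\<forall>x\<in>E. (\<Sum>i<D. c i * F i x) = 0) \<longrightarrow> (\<forall>i<D. c i = 0)))"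

lemma indep_forms_mono:
  assumes "indep_forms n k E D" "E \<subseteq> E'" shows "indep_forms n k E' D"
proof -
  obtain F where F: "\<forall>i<D. homogeneous_poly n k (F i)"
    "\<And>c. (\<forall>x\<in>E. (\<Sum>i<D. c i * F i x) = 0) \<Longrightarrow> (\<forall>i<D. c i = 0)"
    using assms unfolding indep_forms_def by blast
  have "\<forall>i<D. c i = 0" if "\<forall>x\<in>E'. (\<Sum>i<D. c i * F i x) = 0" for c
    using F(2)[of c] that assms(2) by auto
  then show ?thesis using F(1) unfolding indep_forms_def by (intro exI[of _ F]) simp
qed

lemma indep_forms_le:
  assumes "indep_forms n k E D" shows "D \<le> (k + 1) ^ n"
proof (rule ccontr)
  assume D: "\<not> ?thesis"
  obtain F where F: "\<forall>i<D. homogeneous_poly n k (F i)"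
    "\<And>c. (\<forall>x\<in>E. (\<Sum>i<D. c i * F i x) = 0) \<Longrightarrow> (\<forall>i<D. c i = 0)"
    using assms unfolding indep_forms_def by blast
  let ?M = "mons {..n} (\<lambda>_. 1) k"
  have "\<exists>a. \<forall>i<D. F i = (\<lambda>x. \<Sum>m\<in>?M. a i m * mon {..n} m x)"
    using F(1) unfolding homogeneous_poly_iff_wform wform_def by metis
  then obtain a where a: "\<And>i x. i < D \<Longrightarrow> F i x = (\<Sum>m\<in>?M. a i m * mon {..n} m x)" by metis
  have fin: "finite ?M" by (rule finite_mons) auto
  have "card ?M \<le> (k + 1) ^ n" using card_mons_le[of "{..n}" "\<lambda>_. 1" k] by simp
  then have "card ?M < card {..<D}" using D by simp
  from underdetermined_system[OF fin _ this, of a]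
  obtain c where c: "\<exists>i\<in>{..<D}. c i \<noteq> 0" "\<forall>m\<in>?M. (\<Sum>i<D. c i * a i m) = 0" by auto
  have "(\<Sum>i<D. c i * F i x) = 0" for x
  proof -
    have "(\<Sum>i<D. c i * F i x) = (\<Sum>i<D. \<Sum>m\<in>?M. c i * a i m * mon {..n} m x)"
      by (intro sum.cong) (auto simp: a sum_distrib_left mult.assoc)
    also have "\<dots> = (\<Sum>m\<in>?M. (\<Sum>i<D. c i * a i m) * mon {..n} m x)"
      by (subst sum.swap) (simp add: sum_distrib_right)
    also have "\<dots> = 0" using c(2) by simp
    finally show ?thesis .
  qed
  then show False using F(2)[of c] c(1) by auto
qed

lemma indep_forms_extend:
  assumes E': "indep_forms n k E' D'" and E: "indep_forms n (k + g) E D"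
    and "E \<subseteq> E'" "prime_set n E'" "homogeneous_poly n g G"
    and G0: "\<forall>x\<in>E. G x = 0" and G1: "\<exists>x\<in>E'. G x \<noteq> 0"
  shows "indep_forms n (k + g) E' (D + D')"
proof -
  obtain F where F: "\<forall>i<D. homogeneous_poly n (k + g) (F i)"
    "\<And>c. (\<forall>x\<in>E. (\<Sum>i<D. c i * F i x) = 0) \<Longrightarrow> (\<forall>i<D. c i = 0)"
    using E unfolding indep_forms_def by blast
  obtain F' where F': "\<forall>i<D'. homogeneous_poly n k (F' i)"
    "\<And>c. (\<forall>x\<in>E'. (\<Sum>i<D'. c i * F' i x) = 0) \<Longrightarrow> (\<forall>i<D'. c i = 0)"
    using E' unfolding indep_forms_def by blast
  define H where "H i = (if i < D then F i else (\<lambda>x. F' (i - D) x * G x))" for i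
  have split: "(\<Sum>i<D + D'. c i * H i x) =
      (\<Sum>i<D. c i * F i x) + (\<Sum>i<D'. c (D + i) * F' i x) * G x" for c x
  proof -
    have "(\<Sum>i<D + D'. c i * H i x) = (\<Sum>i<D. c i * H i x) + (\<Sum>i<D'. c (D + i) * H (D + i) x)"
      using sum.atLeastLessThan_concat[of 0 D "D + D'" "\<lambda>i. c i * H i x"]
        sum.shift_bounds_nat_ivl[of "\<lambda>i. c i * H i x" 0 D D']
      by (simp add: lessThan_atLeast0 add.commute)
    then show ?thesis by (simp add: H_def sum_distrib_right mult.assoc)
  qed
  show ?thesis unfolding indep_forms_def
  proof (intro exI[of _ H] conjI allI impI)
    fix i assume "i < D + D'"
    then have "i < D \<or> i - D < D'" by auto
    then show "homogeneous_poly n (k + g) (H i)"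
      using F(1) homogeneous_poly_mult[OF _ assms(5), of k "F' (i - D)"] F'(1)
      unfolding H_def by (cases "i < D") simp_all
  next
    fix c i assume van: "\<forall>x\<in>E'. (\<Sum>i<D + D'. c i * H i x) = 0" and i: "i < D + D'"
    \<comment> \<open>On \<open>E\<close> the multiples of \<open>G\<close> disappear, which
      isolates the first \<open>D\<close> coefficients; primality of \<open>E'\<close> then cancels
      \<open>G\<close> from what remains.\<close>
    have "(\<Sum>i<D. c i * F i x) = 0" if "x \<in> E" for x
    proof -
      have "x \<in> E'" "G x = 0" using that G0 \<open>E \<subseteq> E'\<close> by auto
      then show ?thesis using bspec[OF van, of x] unfolding split by simp
    qed
    then have c: "\<forall>i<D. c i = 0" using F(2) by blast
    let ?f = "\<lambda>x. \<Sum>i<D'. c (D + i) * F' i x"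
    have "\<forall>x\<in>E'. ?f x * G x = 0" using van c unfolding split by simp
    moreover have "homogeneous_poly n k ?f"
      using F'(1) unfolding homogeneous_poly_iff_wform by (intro wform_sum wform_cmult) auto
    ultimately have "(\<forall>x\<in>E'. ?f x = 0) \<or> (\<forall>x\<in>E'. G x = 0)"
      using assms(4)[unfolded prime_set_def, rule_format, of k ?f g G] assms(5) by simp
    then have "\<forall>x\<in>E'. ?f x = 0" using G1 by blast
    then have "\<forall>i<D'. c (D + i) = 0" using F'(2)[of "\<lambda>i. c (D + i)"] by blast
    then have "c i = 0" if "\<not> i < D" using i that by (metis add_diff_inverse_nat nat_add_left_cancel_less)
    then show "c i = 0" using c by blast
  qed
qed

text \<open>The Hilbert function of the cone spanned by \<open>E\<close> is at least \<open>c k^s\<close>.\<close>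

definition growth :: "nat \<Rightarrow> (nat \<Rightarrow> complex) set \<Rightarrow> nat \<Rightarrow> bool" where
  "growth n E s \<longleftrightarrow> (\<exists>c>0. \<forall>k. \<exists>D. c * real k ^ s \<le> real D \<and> indep_forms n k E D)"

text \<open>The inequality \<open>h_E'(k) >= h_E'(k - g) + h_E(k)\<close> is iterated about
  \<open>k / (2 g)\<close> times. This adds up values of \<open>h_E\<close> at arguments at least
  \<open>k / 2\<close>, each of order \<open>k ^ s\<close>, and the number of terms raises the
  exponent by one.\<close>

lemma growth_step:
  assumes gr: "growth n E s" and "E \<subseteq> E'" "prime_set n E'" "homogeneous_poly n g G"
    and G0: "\<forall>x\<in>E. G x = 0" and G1: "\<exists>x\<in>E'. G x \<noteq> 0" and "E \<noteq> {}"
  shows "growth n E' (Suc s)"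
proof -
  \<comment> \<open>A form of degree 0 is constant, so it cannot vanish on the nonempty set
    \<open>E\<close> and be nonzero somewhere on \<open>E'\<close>.\<close>
  have g: "g > 0"
  proof (rule ccontr)
    assume "\<not> g > 0"
    then have "homogeneous_poly n 0 G" using assms by simp
    then show False using homogeneous_poly_0_const[of n G] G0 G1 \<open>E \<noteq> {}\<close> by (metis ex_in_conv)
  qed
  obtain c D where c: "c > 0" "\<And>k. c * real k ^ s \<le> real (D k)" "\<And>k. indep_forms n k E (D k)"
    using gr unfolding growth_def by metis
  have iter: "indep_forms n k E' (\<Sum>j<q. D (k - j * g))" if "\<forall>j<q. j * g \<le> k" for k q
    using that
  proof (induction q arbitrary: k)
    case 0
    then show ?case by (auto simp: indep_forms_def)
  next
    case (Suc q)
    show ?case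
    proof (cases "q = 0")
      case True
      then show ?thesis using indep_forms_mono[OF c(3)[of k] \<open>E \<subseteq> E'\<close>] by simp
    next
      case False
      then have gk: "g \<le> k" using Suc.prems[rule_format, of 1] by simp
      have "j * g \<le> k - g" if "j < q" for j
        using Suc.prems[rule_format, of "Suc j"] that by simp
      then have "indep_forms n (k - g) E' (\<Sum>j<q. D (k - g - j * g))" using Suc.IH by blast
      moreover have "indep_forms n (k - g + g) E (D k)" using c(3)[of k] gk by simp
      ultimately have "indep_forms n (k - g + g) E' (D k + (\<Sum>j<q. D (k - g - j * g)))"
        by (rule indep_forms_extend) (use assms in auto)
      moreover have "(\<Sum>j<Suc q. D (k - j * g)) = D k + (\<Sum>j<q. D (k - g - j * g))"
        by (subst sum.lessThan_Suc_shift) (simp add: algebra_simps)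
      ultimately show ?thesis using gk by simp
    qed
  qed
  \<comment> \<open>The factor \<open>2 g\<close> comes from the number of terms, the factor
    \<open>2 ^ s\<close> from replacing \<open>k\<close> by \<open>k / 2\<close>.\<close>
  define c' where "c' = c / (2 * real g * 2 ^ s)"
  have "c' > 0" using c g by (simp add: c'_def)
  moreover have "\<exists>D. c' * real k ^ Suc s \<le> real D \<and> indep_forms n k E' D" for k
  proof -
    let ?q = "k div (2 * g) + 1"
    have half: "2 * (j * g) \<le> k" if "j < ?q" for j
    proof -
      have "2 * (j * g) \<le> (k div (2 * g)) * (2 * g)" using that by (simp add: mult.commute mult.left_commute)
      also have "\<dots> \<le> k" by simp
      finally show ?thesis .
    qed
    have "\<forall>j<?q. j * g \<le> k" using half by fastforce
    then have ind: "indep_forms n k E' (\<Sum>j<?q. D (k - j * g))" by (rule iter)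
    have "real k / (2 * real g) \<le> real ?q"
    proof -
      have "k < ?q * (2 * g)" using g dividend_less_div_times[of "2 * g" k] by simp
      then have "real k \<le> real (?q * (2 * g))" unfolding of_nat_le_iff by simp
      then show ?thesis using g by (simp add: field_simps)
    qed
    then have "c' * real k ^ Suc s \<le> real ?q * (c * (real k / 2) ^ s)"
      using mult_right_mono[of "real k / (2 * real g)" "real ?q" "c * (real k / 2) ^ s"] c
      by (simp add: c'_def power_divide field_simps)
    also have "\<dots> = (\<Sum>j<?q. c * (real k / 2) ^ s)" by simp
    also have "\<dots> \<le> (\<Sum>j<?q. real (D (k - j * g)))"
    proof (rule sum_mono)
      fix j assume "j \<in> {..<?q}"
      then have "2 * (j * g) \<le> k" using half by simp
      then have "real (2 * (j * g)) \<le> real k" unfolding of_nat_le_iff .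
      then have "real k / 2 \<le> real (k - j * g)" using \<open>2 * (j * g) \<le> k\<close> by (subst of_nat_diff) auto
      then have "c * (real k / 2) ^ s \<le> c * real (k - j * g) ^ s"
        using c by (intro mult_left_mono power_mono) auto
      then show "c * (real k / 2) ^ s \<le> real (D (k - j * g))" using c(2) order_trans by blast
    qed
    finally show ?thesis using ind by (intro exI[of _ "\<Sum>j<?q. D (k - j * g)"]) simp
  qed
  ultimately show ?thesis unfolding growth_def by blast
qed

text \<open>There are at most \<open>(k + 1) ^ n\<close> monomials of degree \<open>k\<close>, so
  growth of order \<open>n + 1\<close> would force \<open>c * k <= 2 ^ n\<close> for all positive
  \<open>k\<close>.\<close>

lemma not_growth_Suc: "\<not> growth n E (Suc n)"
proof
  assume "growth n E (Suc n)"
  then obtain c D where c: "c > 0" "\<And>k. c * real k ^ Suc n \<le> real (D k)" "\<And>k. indep_forms n k E (D k)"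
    unfolding growth_def by metis
  have "c * real k \<le> 2 ^ n" if "k > 0" for k
  proof -
    have "c * real k ^ Suc n \<le> real (k + 1) ^ n"
      using c(2)[of k] indep_forms_le[OF c(3)[of k]]
      by (metis of_nat_le_iff of_nat_power order_trans)
    also have "\<dots> \<le> (2 * real k) ^ n" using that by (intro power_mono) auto
    finally have "(c * real k) * real k ^ n \<le> 2 ^ n * real k ^ n" by (simp add: power_mult_distrib algebra_simps)
    then show ?thesis using that by simp
  qed
  note bound = this
  obtain k where k: "real k > 2 ^ n / c" using reals_Archimedean2 by blast
  have "0 \<le> 2 ^ n / c" using c(1) by simp
  with k have "0 < real k" by linarith
  then have "c * real k \<le> 2 ^ n" using bound by simp
  moreover have "2 ^ n < c * real k" using k c(1) by (simp add: pos_divide_less_eq mult.commute)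
  ultimately show False by linarith
qed

text \<open>The monomials in the coordinates of \<open>I\<close> are themselves the independent
  forms on \<open>E\<close>, and \<open>card_mons_ge\<close> bounds their number from below.\<close>

lemma growth_of_monomials:
  assumes "I \<subseteq> {..n}" "I \<noteq> {}"
    and ind: "\<And>k c. (\<forall>x\<in>E. (\<Sum>m\<in>mons I (\<lambda>_. 1) k. c m * mon I m x) = 0) \<Longrightarrow>
      \<forall>m\<in>mons I (\<lambda>_. 1) k. c m = 0"
  shows "growth n E (card I - 1)"
proof -
  have fin: "finite I" using assms finite_subset by blast
  define q where "q = real (card I)"
  have q: "q > 0" using assms fin by (auto simp: q_def card_gt_0_iff)
  have "\<exists>D. (1 / q ^ (card I - 1)) * real k ^ (card I - 1) \<le> real D \<and> indep_forms n k E D" for k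
  proof (intro exI conjI)
    let ?M = "mons I (\<lambda>_. 1) k"
    have finM: "finite ?M" by (rule finite_mons) (use fin in auto)
    have "real k / q \<le> real (k div card I + 1)"
    proof -
      have "k < (k div card I + 1) * card I" using q dividend_less_div_times[of "card I" k]
        by (simp add: q_def)
      then have "real k \<le> real ((k div card I + 1) * card I)" unfolding of_nat_le_iff by simp
      then show ?thesis using q unfolding q_def by (simp add: field_simps)
    qed
    then have "(real k / q) ^ (card I - 1) \<le> real (k div card I + 1) ^ (card I - 1)"
      using q by (intro power_mono) auto
    also have "\<dots> = real ((k div card I + 1) ^ (card I - 1))" by simp
    also have "\<dots> \<le> real (card ?M)" using card_mons_ge[OF fin \<open>I \<noteq> {}\<close>] of_nat_le_iff by blast
    finally show "(1 / q ^ (card I - 1)) * real k ^ (card I - 1) \<le> real (card ?M)"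
      by (simp add: power_divide)
    obtain e where e: "bij_betw e {..<card ?M} ?M"
      using ex_bij_betw_nat_finite[OF finM] by (auto simp: lessThan_atLeast0)
    show "indep_forms n k E (card ?M)" unfolding indep_forms_def
    proof (intro exI[of _ "\<lambda>i. mon I (e i)"] conjI allI impI)
      fix i assume "i < card ?M"
      then have ei: "e i \<in> ?M" using e by (auto simp: bij_betw_def)
      have "wform {..n} (\<lambda>_. 1) k (\<lambda>x. \<Sum>j\<in>{()}. 1 * mon {..n} (e i) x)"
        by (rule wform_family) (use ei mons_subset[of "{..n}" I] assms in auto)
      moreover have "mon {..n} (e i) = mon I (e i)"
        using mon_restrict[of "{..n}" I "e i"] assms ei by (auto simp: mons_def)
      ultimately show "homogeneous_poly n k (mon I (e i))"
        by (simp add: homogeneous_poly_iff_wform)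
    next
      fix c i assume van: "\<forall>x\<in>E. (\<Sum>i<card ?M. c i * mon I (e i) x) = 0" and i: "i < card ?M"
      let ?c = "\<lambda>m. c (the_inv_into {..<card ?M} e m)"
      have inv: "the_inv_into {..<card ?M} e (e j) = j" if "j < card ?M" for j
        using e that by (auto simp: bij_betw_def the_inv_into_f_f)
      have "(\<Sum>m\<in>?M. ?c m * mon I m x) = (\<Sum>i<card ?M. c i * mon I (e i) x)" for x
        using inv by (subst sum.reindex_bij_betw[OF e, symmetric]) simp
      then have "\<forall>m\<in>?M. ?c m = 0" using ind[where k = k and c = ?c] van by simp
      then have "?c (e i) = 0" using e i by (auto simp: bij_betw_def)
      then show "c i = 0" using inv i by simp
    qed
  qed
  moreover have "1 / q ^ (card I - 1) > 0" using q by simp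
  ultimately show ?thesis unfolding growth_def by blast
qed

subsection \<open>Algebraic independence and vanishing forms\<close>

definition polyfun :: "(complex \<Rightarrow> complex) \<Rightarrow> bool" where
  "polyfun u \<longleftrightarrow> (\<exists>p. u = poly p)"

lemma polyfun_const [simp]: "polyfun (\<lambda>s. c)"
  unfolding polyfun_def by (intro exI[of _ "[:c:]"]) auto

lemma polyfun_id [simp]: "polyfun (\<lambda>s. s)"
  unfolding polyfun_def by (intro exI[of _ "[:0, 1:]"]) auto

lemma polyfun_add:
  assumes "polyfun u" "polyfun v" shows "polyfun (\<lambda>s. u s + v s)"
proof -
  obtain p q where "u = poly p" "v = poly q" using assms unfolding polyfun_def by auto
  then show ?thesis unfolding polyfun_def by (intro exI[of _ "p + q"]) auto
qed

lemma polyfun_mult: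
  assumes "polyfun u" "polyfun v" shows "polyfun (\<lambda>s. u s * v s)"
proof -
  obtain p q where "u = poly p" "v = poly q" using assms unfolding polyfun_def by auto
  then show ?thesis unfolding polyfun_def by (intro exI[of _ "p * q"]) auto
qed

lemma polyfun_power: "polyfun u \<Longrightarrow> polyfun (\<lambda>s. u s ^ n)"
  by (induction n) (auto intro: polyfun_mult)

lemma polyfun_sum: "(\<And>j. j \<in> J \<Longrightarrow> polyfun (u j)) \<Longrightarrow> polyfun (\<lambda>s. \<Sum>j\<in>J. u j s)"
  by (induction J rule: infinite_finite_induct) (auto intro: polyfun_add)

lemma polyfun_prod: "(\<And>j. j \<in> J \<Longrightarrow> polyfun (u j)) \<Longrightarrow> polyfun (\<lambda>s. \<Prod>j\<in>J. u j s)"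
  by (induction J rule: infinite_finite_induct) (auto intro: polyfun_mult)

lemma polyfun_wform:
  assumes "wform I w k f" "\<And>i. i \<in> I \<Longrightarrow> polyfun (\<lambda>s. x s i)"
  shows "polyfun (\<lambda>s. f (x s))"
proof -
  obtain c where f: "f = (\<lambda>x. \<Sum>m\<in>mons I w k. c m * mon I m x)"
    using assms unfolding wform_def by auto
  show ?thesis unfolding f mon_def
    by (intro polyfun_sum polyfun_mult polyfun_prod polyfun_power polyfun_const assms)
qed

lemma polyfun_homogeneous:
  assumes "homogeneous_poly n k f" "\<And>i. polyfun (\<lambda>s. x s i)"
  shows "polyfun (\<lambda>s. f (x s))"
  using polyfun_wform assms unfolding homogeneous_poly_iff_wform by blast

lemma polyfun_eq_0:
  assumes "polyfun u" "infinite {s. u s = 0}" shows "u s = 0"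
proof -
  obtain p where p: "u = poly p" using assms unfolding polyfun_def by auto
  have "p = 0" using poly_roots_finite[of p] assms(2) p by auto
  then show ?thesis using p by simp
qed

lemma polyfun_eq_0':
  assumes "polyfun u" "\<And>s. s \<noteq> 0 \<Longrightarrow> u s = 0" shows "u s = 0"
proof (rule polyfun_eq_0[OF assms(1)])
  have "infinite (UNIV - {0::complex})" using infinite_UNIV_char_0[where 'a = complex] by simp
  then show "infinite {s. u s = 0}" by (rule infinite_super[rotated]) (use assms in auto)
qed

lemma polyfun_mult_eq_0:
  assumes "polyfun u" "polyfun v" "\<And>s. u s * v s = 0"
  shows "(\<forall>s. u s = 0) \<or> (\<forall>s. v s = 0)"
proof -
  obtain p q where p: "u = poly p" "v = poly q" using assms unfolding polyfun_def by auto
  have "poly (p * q) s = 0" for s using assms(3)[of s] p by simp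
  then have "p * q = 0" using poly_all_0_iff_0 by blast
  then show ?thesis using p by auto
qed

definition polycurve :: "(complex \<Rightarrow> complex poly) \<Rightarrow> bool" where
  "polycurve P \<longleftrightarrow> (\<forall>i. polyfun (\<lambda>s. coeff (P s) i))"

lemma polycurve_const [simp]: "polycurve (\<lambda>s. P)"
  by (simp add: polycurve_def)

lemma polycurve_add: "polycurve P \<Longrightarrow> polycurve Q \<Longrightarrow> polycurve (\<lambda>s. P s + Q s)"
  by (simp add: polycurve_def polyfun_add)

lemma polycurve_mult: "polycurve P \<Longrightarrow> polycurve Q \<Longrightarrow> polycurve (\<lambda>s. P s * Q s)"
  by (auto simp: polycurve_def coeff_mult intro!: polyfun_sum polyfun_mult)

lemma polycurve_smult: "polyfun u \<Longrightarrow> polycurve P \<Longrightarrow> polycurve (\<lambda>s. smult (u s) (P s))"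
  by (auto simp: polycurve_def intro!: polyfun_mult)

lemma polycurve_power: "polycurve P \<Longrightarrow> polycurve (\<lambda>s. P s ^ n)"
  by (induction n) (auto intro: polycurve_mult)

lemma polycurve_sum: "(\<And>j. j \<in> J \<Longrightarrow> polycurve (P j)) \<Longrightarrow> polycurve (\<lambda>s. \<Sum>j\<in>J. P j s)"
  by (induction J rule: infinite_finite_induct) (auto intro: polycurve_add)

section \<open>First-order expansion and algebraic independence of coefficients\<close>

lemma power_first_order:
  "\<exists>R. polycurve R \<and> (\<forall>s. (X + smult s Y) ^ n =
     X ^ n + smult s (of_nat n * (X ^ (n - 1) * Y)) + smult (s\<^sup>2) (R s))"
proof (induction n)
  case 0
  show ?case by (intro exI[of _ "\<lambda>_. 0"]) auto
next
  case (Suc n)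
  then obtain R where R: "polycurve R" "\<And>s. (X + smult s Y) ^ n =
     X ^ n + smult s (of_nat n * (X ^ (n - 1) * Y)) + smult (s\<^sup>2) (R s)" by blast
  define Q where "Q s = X * R s + of_nat n * (X ^ (n - 1) * Y * Y) + smult s (Y * R s)" for s
  have "polycurve Q" unfolding Q_def
    by (intro polycurve_add polycurve_mult polycurve_smult polycurve_const R polyfun_id)
  moreover have "(X + smult s Y) ^ Suc n =
     X ^ Suc n + smult s (of_nat (Suc n) * (X ^ (Suc n - 1) * Y)) + smult (s\<^sup>2) (Q s)" for s
  proof -
    have XX: "of_nat n * (X ^ n * Y) = of_nat n * (X * X ^ (n - 1) * Y)" by (cases n) auto
    have ring: "(X + c * Y) * (P + c * (k * (M * Y)) + c * c * W) =
        X * P + c * (P * Y + k * (X * M * Y)) + c * c * (X * W + k * (M * Y * Y) + c * (Y * W))"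
      for c k P M W :: "complex poly" by (simp add: algebra_simps)
    have sm: "smult t P = [:t:] * P" for t and P :: "complex poly" by simp
    have "(X + smult s Y) ^ Suc n = (X + [:s:] * Y) *
       (X ^ n + [:s:] * (of_nat n * (X ^ (n - 1) * Y)) + [:s:] * [:s:] * R s)"
      unfolding power_Suc R(2) by (simp add: power2_eq_square)
    also have "\<dots> = X * X ^ n + [:s:] * (X ^ n * Y + of_nat n * (X * X ^ (n - 1) * Y)) + [:s:] * [:s:] *
       (X * R s + of_nat n * (X ^ (n - 1) * Y * Y) + [:s:] * (Y * R s))" by (rule ring)
    also have "\<dots> = X * X ^ n + [:s:] * (of_nat (Suc n) * (X ^ n * Y)) + [:s:] * [:s:] * Q s"
    proof -
      have "X ^ n * Y + of_nat n * (X * X ^ (n - 1) * Y) = of_nat (Suc n) * (X ^ n * Y)"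
        unfolding XX[symmetric] of_nat_Suc distrib_right mult_1 ..
      then show ?thesis unfolding Q_def sm by simp
    qed
    finally show ?thesis by (simp add: power2_eq_square)
  qed
  ultimately show ?case by blast
qed

text \<open>Initial terms decide independence. Along a curve the monomial \<open>m\<close> starts in
  order \<open>r m\<close> in \<open>s\<close>, with the monomial at a freely chosen
  \<open>z\<close> as its coefficient. By induction the terms of smaller order are absent, and
  comparing coefficients of \<open>s ^ r m0\<close> gives a relation among honest monomials.\<close>

lemma filtered_mon_independent:
  fixes r :: "(nat \<Rightarrow> nat) \<Rightarrow> nat"
  assumes "finite I" "finite S" "\<forall>m\<in>S. \<forall>i. i \<notin> I \<longrightarrow> m i = 0"
    and van: "\<And>z. (\<And>i. z i \<noteq> 0) \<Longrightarrow> \<exists>h. (\<forall>m\<in>S. polyfun (h m) \<and> h m 0 = mon I m z) \<and>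
      (\<forall>s. (\<Sum>m\<in>S. c m * (s ^ r m * h m s)) = 0)"
    and "m0 \<in> S"
  shows "c m0 = 0"
  using \<open>m0 \<in> S\<close>
proof (induction "r m0" arbitrary: m0 rule: less_induct)
  case less
  define S' where "S' = {m \<in> S. r m = r m0}"
  have "(\<Sum>m\<in>S'. c m * mon I m z) = 0" if z: "\<And>i. z i \<noteq> 0" for z
  proof -
    obtain h where h: "\<And>m. m \<in> S \<Longrightarrow> polyfun (h m)" "\<And>m. m \<in> S \<Longrightarrow> h m 0 = mon I m z"
      "\<And>s. (\<Sum>m\<in>S. c m * (s ^ r m * h m s)) = 0" using van[of z] z by blast
    \<comment> \<open>Division by \<open>s ^ r m0\<close>. For \<open>r m < r m0\<close> the
      truncated difference is 0, which is harmless because \<open>c m = 0\<close> by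
      induction.\<close>
    define u where "u s = (\<Sum>m\<in>S. c m * (s ^ (r m - r m0) * h m s))" for s
    have "polyfun u" unfolding u_def
      by (intro polyfun_sum polyfun_mult polyfun_const polyfun_power polyfun_id h)
    moreover have "u s = 0" if "s \<noteq> 0" for s
    proof -
      have "s ^ r m0 * u s = (\<Sum>m\<in>S. c m * (s ^ r m * h m s))"
        unfolding u_def sum_distrib_left
      proof (rule sum.cong[OF refl])
        fix m assume m: "m \<in> S"
        show "s ^ r m0 * (c m * (s ^ (r m - r m0) * h m s)) = c m * (s ^ r m * h m s)"
        proof (cases "r m < r m0")
          case True
          then show ?thesis using less m by simp
        next
          case False
          then have "s ^ r m = s ^ r m0 * s ^ (r m - r m0)" by (simp flip: power_add)
          then show ?thesis by simp
        qed
      qed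
      then show ?thesis using h(3) that by simp
    qed
    ultimately have "u 0 = 0" by (rule polyfun_eq_0')
    moreover have "u 0 = (\<Sum>m\<in>S'. c m * mon I m z)"
      unfolding u_def S'_def
    proof (rule sum.mono_neutral_cong_right)
      show "\<forall>m\<in>S - {m \<in> S. r m = r m0}. c m * (0 ^ (r m - r m0) * h m 0) = 0"
      proof
        fix m assume m: "m \<in> S - {m \<in> S. r m = r m0}"
        show "c m * (0 ^ (r m - r m0) * h m 0) = 0"
          using m less by (cases "r m < r m0") auto
      qed
    qed (use assms h in auto)
    ultimately show ?thesis by simp
  qed
  then show ?case
    by (intro mon_independent[of I S' c m0]) (use assms less in \<open>auto simp: S'_def\<close>)
qed

lemma complex_nth_root_exists:
  assumes "n > 0" shows "\<exists>z::complex. z ^ n = c"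
proof (cases "c = 0")
  case True
  then show ?thesis using assms by (intro exI[of _ 0]) auto
next
  case False
  then have "card {z. z ^ n = c} = n" using card_nth_roots assms by blast
  then show ?thesis using assms by (metis (mono_tags, lifting) card.empty empty_Collect_eq less_irrefl)
qed

text \<open>Along \<open>A = T x^d1 + s Y\<close>, \<open>B = U y^d2 + s V\<close> the coefficients
  at 0 and \<open>N\<close> start in order 0, the others in \<open>I\<close> in order 1, with
  leading terms that can be prescribed. As \<open>d1 + d2 < N\<close>, the two blocks of
  \<open>I\<close> are disjoint, so the linear terms from \<open>Y\<close> and \<open>V\<close> do
  not interfere.\<close>

lemma powersum_coords_independent:
  assumes ab: "a \<ge> 2" "b \<ge> 2" and d: "d1 > 0" "d2 > 0" and N: "N = a * d1" "N = b * d2"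
    and lt: "d1 + d2 < N" and I: "I = {..d2} \<union> {N - d1..N}"
    and van: "\<And>A B. A \<in> Sym d1 \<Longrightarrow> B \<in> Sym d2 \<Longrightarrow>
      (\<Sum>m\<in>mons I (\<lambda>_. 1) k. c m * mon I m (coeff (A ^ a + B ^ b))) = 0"
    and m0: "m0 \<in> mons I (\<lambda>_. 1) k"
  shows "c m0 = 0"
proof -
  have finI: "finite I" unfolding I by auto
  \<comment> \<open>The total exponent of the coordinates of initial order 1, hence the order of the
    monomial along the curve.\<close>
  define r where "r m = (\<Sum>i\<in>I - {0, N}. m i)" for m :: "nat \<Rightarrow> nat"
  show ?thesis
  proof (rule filtered_mon_independent[where S = "mons I (\<lambda>_. 1) k" and r = r and I = I and c = c, OF finI _ _ _ m0])
    fix z :: "nat \<Rightarrow> complex" assume z: "\<And>i. z i \<noteq> 0"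
    obtain T U where T: "T ^ a = z N" and U: "U ^ b = z 0"
      using complex_nth_root_exists[of a "z N"] complex_nth_root_exists[of b "z 0"] ab by auto
    have TU: "T \<noteq> 0" "U \<noteq> 0" using T U z ab by (auto simp: power_0_left split: if_splits)
    \<comment> \<open>\<open>Y\<close> and \<open>V\<close> cancel the multipliers
      \<open>a T^(a-1)\<close> and \<open>b U^(b-1)\<close> of the linear terms, which thereby get
      the coefficients \<open>z i\<close>. The positions \<open>N\<close> and 0 are left out, since
      \<open>T\<close> and \<open>U\<close> already take care of them.\<close>
    define Y where "Y = (\<Sum>i<d1. monom (z (N - d1 + i) / (of_nat a * T ^ (a - 1))) i)"
    define V where "V = (\<Sum>i\<in>{1..d2}. monom (z i / (of_nat b * U ^ (b - 1))) i)"
    obtain R where R: "polycurve R" "\<And>s. (monom T d1 + smult s Y) ^ a =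
     monom T d1 ^ a + smult s (of_nat a * (monom T d1 ^ (a - 1) * Y)) + smult (s\<^sup>2) (R s)"
      using power_first_order by blast
    obtain Q where Q: "polycurve Q" "\<And>s. ([:U:] + smult s V) ^ b =
     [:U:] ^ b + smult s (of_nat b * ([:U:] ^ (b - 1) * V)) + smult (s\<^sup>2) (Q s)"
      using power_first_order by blast
    define F where "F s = (monom T d1 + smult s Y) ^ a + ([:U:] + smult s V) ^ b" for s
    have coeffY: "coeff Y i = (if i < d1 then z (N - d1 + i) / (of_nat a * T ^ (a - 1)) else 0)" for i
      unfolding Y_def by (simp add: coeff_sum)
    have coeffV: "coeff V i = (if 1 \<le> i \<and> i \<le> d2 then z i / (of_nat b * U ^ (b - 1)) else 0)" for i
      unfolding V_def by (simp add: coeff_sum)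
    have powT: "monom T d1 ^ j = monom (T ^ j) (d1 * j)" for j
      by (simp add: monom_power)
    have Nd: "d1 * (a - 1) = N - d1" using N by (simp add: algebra_simps diff_mult_distrib2)
    define e where "e i = (if i = 0 \<or> i = N then 0 else (1::nat))" for i
    have aux: "coeff (of_nat n * P) i = of_nat n * coeff P i" for n i and P :: "complex poly"
      by (simp add: of_nat_poly)
    \<comment> \<open>Where \<open>e i = 0\<close> there is no linear term and the remainder carries
      \<open>s\<close> twice, so one more \<open>s\<close> stays inside \<open>g\<close>.\<close>
    define g where "g i s = s ^ (1 - e i) * (coeff (R s) i + coeff (Q s) i)" for i s
    have Fi: "coeff (F s) i = s ^ e i * (z i + s * g i s)" if i: "i \<in> I" for i s
    proof -
      have 1: "coeff (monom T d1 ^ a) i = (if i = N then z N else 0)"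
        unfolding powT using N T by (simp add: mult.commute)
      have 2: "of_nat a * coeff (monom T d1 ^ (a - 1) * Y) i = (if N - d1 \<le> i \<and> i < N then z i else 0)"
      proof -
        have "coeff (monom T d1 ^ (a - 1) * Y) i = (if N - d1 \<le> i then T ^ (a - 1) * coeff Y (i - (N - d1)) else 0)"
          unfolding powT Nd coeff_monom_mult by simp
        then show ?thesis using TU ab lt d i by (auto simp: coeffY)
      qed
      have 3: "coeff ([:U:] ^ b) i = (if i = 0 then z 0 else 0)"
        using U by (cases i) (auto simp: poly_const_pow)
      have 4: "of_nat b * coeff ([:U:] ^ (b - 1) * V) i = (if 1 \<le> i \<and> i \<le> d2 then z i else 0)"
        using TU ab by (auto simp: poly_const_pow coeffV)
      have "coeff (F s) i = (if i = N then z N else 0) + s * (if N - d1 \<le> i \<and> i < N then z i else 0)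
         + (if i = 0 then z 0 else 0) + s * (if 1 \<le> i \<and> i \<le> d2 then z i else 0)
         + s\<^sup>2 * (coeff (R s) i + coeff (Q s) i)"
        unfolding F_def R(2) Q(2) coeff_add coeff_smult 1 aux 2 3 4 by (simp add: algebra_simps)
      also have "\<dots> = s ^ e i * (z i + s * g i s)"
        using i lt d unfolding I g_def e_def by (auto simp: power2_eq_square algebra_simps)
      finally show ?thesis .
    qed
    have gpoly: "polyfun (g i)" for i
      using R(1) Q(1) unfolding g_def polycurve_def
      by (intro polyfun_mult polyfun_add polyfun_power polyfun_id) auto
    define h where "h m s = (\<Prod>i\<in>I. (z i + s * g i s) ^ m i)" for m s
    show "\<exists>h. (\<forall>m\<in>mons I (\<lambda>_. 1) k. polyfun (h m) \<and> h m 0 = mon I m z) \<and>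
      (\<forall>s. (\<Sum>m\<in>mons I (\<lambda>_. 1) k. c m * (s ^ r m * h m s)) = 0)"
    proof (intro exI[of _ h] conjI ballI allI)
      fix m show "polyfun (h m)" unfolding h_def
        by (intro polyfun_prod polyfun_power polyfun_add polyfun_mult polyfun_const polyfun_id gpoly)
      show "h m 0 = mon I m z" by (simp add: h_def mon_def)
    next
      fix s
      have deg: "monom T d1 + smult s Y \<in> Sym d1" "[:U:] + smult s V \<in> Sym d2"
        unfolding Sym_def mem_Collect_eq
        by (auto intro!: degree_add_le degree_smult_le[THEN order_trans] degree_monom_le
            simp: degree_le coeffY coeffV)
      have "s ^ r m * h m s = mon I m (coeff (F s))" for m
      proof -
        have "r m = (\<Sum>i\<in>I. e i * m i)"
          unfolding r_def by (rule sum.mono_neutral_cong_left) (use finI in \<open>auto simp: e_def\<close>)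
        then have "s ^ r m = (\<Prod>i\<in>I. (s ^ e i) ^ m i)" by (simp add: power_sum power_mult)
        then show ?thesis unfolding mon_def h_def
          by (simp add: Fi power_mult_distrib prod.distrib)
      qed
      then show "(\<Sum>m\<in>mons I (\<lambda>_. 1) k. c m * (s ^ r m * h m s)) = 0"
        using van[OF deg] unfolding F_def by simp
    qed
  next
    show "finite (mons I (\<lambda>_. 1) k)" by (rule finite_mons[OF finI]) auto
  qed (auto simp: mons_def)
qed

section \<open>Forms that vanish on a parametrised set, found by counting monomials\<close>

lemma homogeneous_mon_sum:
  assumes "I \<subseteq> {..n}"
  shows "homogeneous_poly n k (\<lambda>x. \<Sum>m\<in>mons I (\<lambda>_. 1) k. c m * mon I m x)"
proof -
  have fin: "finite I" using assms finite_subset by blast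
  have "wform {..n} (\<lambda>_. 1) k (\<lambda>x. \<Sum>m\<in>mons I (\<lambda>_. 1) k. c m * mon {..n} m x)"
    by (rule wform_family) (use mons_subset[of "{..n}" I] assms finite_mons[OF fin] in auto)
  moreover have "(\<Sum>m\<in>mons I (\<lambda>_. 1) k. c m * mon {..n} m x) = (\<Sum>m\<in>mons I (\<lambda>_. 1) k. c m * mon I m x)" for x
    by (intro sum.cong arg_cong2[where f = "(*)"] mon_restrict) (use assms in \<open>auto simp: mons_def\<close>)
  ultimately show ?thesis by (simp add: homogeneous_poly_iff_wform)
qed

lemma vanishing_combination:
  assumes fin: "finite I" "finite J" and w: "\<forall>j\<in>J. w j > 0" and J: "J \<noteq> {}"
    and card: "card J < card I" and psi: "\<And>i. i \<in> I \<Longrightarrow> wform J w K (\<psi> i)"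
  shows "\<exists>k c. (\<exists>m\<in>mons I (\<lambda>_. 1) k. c m \<noteq> 0) \<and>
    (\<forall>t. (\<Sum>m\<in>mons I (\<lambda>_. 1) k. c m * mon I m (\<lambda>i. \<psi> i t)) = 0)"
proof -
  define s where "s = card I - 1"
  \<comment> \<open>\<open>M\<close> is chosen so that \<open>K k + 1 <= M (q + 1)\<close>, and
    \<open>q\<close> so that \<open>(M (q + 1)) ^ (s - 1) = q (q + 1) ^ (s - 1)\<close>, which is
    just below the lower bound \<open>(q + 1) ^ s\<close> for the monomials in
    \<open>I\<close>.\<close>
  define M where "M = Suc (K * card I)"
  define q where "q = M ^ (s - 1)"
  define k where "k = card I * q"
  have s: "s \<ge> card J" "card J > 0" using card J fin by (auto simp: s_def card_gt_0_iff)
  have I: "I \<noteq> {}" using card by auto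
  let ?M = "mons I (\<lambda>_. 1) k" and ?W = "mons J w (K * k)"
  have finM: "finite ?M" by (rule finite_mons) (use fin in auto)
  have finW: "finite ?W" by (rule finite_mons) (use fin w in auto)
  have "card ?W \<le> (K * k + 1) ^ (card J - 1)" using card_mons_le[OF fin(2) w J] .
  also have "\<dots> \<le> (M * (q + 1)) ^ (card J - 1)"
    by (rule power_mono) (auto simp: M_def k_def algebra_simps)
  also have "\<dots> \<le> (M * (q + 1)) ^ (s - 1)"
    by (rule power_increasing) (use s in \<open>auto simp: M_def\<close>)
  also have "\<dots> = q * (q + 1) ^ (s - 1)" by (simp only: power_mult_distrib q_def)
  also have "\<dots> < (q + 1) * (q + 1) ^ (s - 1)" by simp
  also have "\<dots> = (q + 1) ^ s" using s by (cases s) auto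
  also have "\<dots> = (k div card I + 1) ^ (card I - 1)"
    using card by (simp add: k_def s_def)
  also have "\<dots> \<le> card ?M" using card_mons_ge[OF fin(1) I] .
  finally have lt: "card ?W < card ?M" .
  have "\<exists>a. \<forall>t. mon I m (\<lambda>i. \<psi> i t) = (\<Sum>l\<in>?W. a l * mon J l t)" if "m \<in> ?M" for m
  proof -
    have "wform J w (K * k) (\<lambda>t. mon I m (\<lambda>i. \<psi> i t))"
      using wform_mon[OF fin(2) w fin(1) that] psi by blast
    then obtain a where "(\<lambda>t. mon I m (\<lambda>i. \<psi> i t)) = (\<lambda>t. \<Sum>l\<in>?W. a l * mon J l t)"
      unfolding wform_def by blast
    then show ?thesis by (intro exI[of _ a] allI) (drule fun_cong, assumption)
  qed
  then have "\<forall>m\<in>?M. \<exists>a. \<forall>t. mon I m (\<lambda>i. \<psi> i t) = (\<Sum>l\<in>?W. a l * mon J l t)" by blast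
  from bchoice[OF this] obtain a where
    a: "\<And>m t. m \<in> ?M \<Longrightarrow> mon I m (\<lambda>i. \<psi> i t) = (\<Sum>l\<in>?W. a m l * mon J l t)" by blast
  from underdetermined_system[OF finW finM lt, of a] obtain c where
    c: "\<exists>m\<in>?M. c m \<noteq> 0" "\<forall>l\<in>?W. (\<Sum>m\<in>?M. c m * a m l) = 0" by blast
  have "(\<Sum>m\<in>?M. c m * mon I m (\<lambda>i. \<psi> i t)) = 0" for t
  proof -
    have "(\<Sum>m\<in>?M. c m * mon I m (\<lambda>i. \<psi> i t)) = (\<Sum>m\<in>?M. \<Sum>l\<in>?W. c m * a m l * mon J l t)"
      by (intro sum.cong) (auto simp: a sum_distrib_left mult.assoc)
    also have "\<dots> = (\<Sum>l\<in>?W. (\<Sum>m\<in>?M. c m * a m l) * mon J l t)"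
      by (subst sum.swap) (simp add: sum_distrib_right)
    also have "\<dots> = 0" using c(2) by simp
    finally show ?thesis .
  qed
  then show ?thesis using c(1) by blast
qed

lemma wform_coeff_mult:
  assumes J: "finite J" "\<forall>j\<in>J. w j > 0"
    and "\<And>i. wform J w k (\<lambda>t. coeff (P t) i)" "\<And>i. wform J w l (\<lambda>t. coeff (Q t) i)"
  shows "wform J w (k + l) (\<lambda>t. coeff (P t * Q t) i)"
  unfolding coeff_mult by (intro wform_sum wform_mult assms)

lemma wform_coeff_power:
  assumes J: "finite J" "\<forall>j\<in>J. w j > 0" and P: "\<And>i. wform J w k (\<lambda>t. coeff (P t) i)"
  shows "wform J w (n * k) (\<lambda>t. coeff (P t ^ n) i)"
proof (induction n arbitrary: i)
  case 0
  show ?case using wform_const[OF J, of "coeff 1 i"] by simp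
next
  case (Suc n)
  show ?case using wform_coeff_mult[OF J P Suc] by simp
qed

lemma sum_monom_coeff: "F \<in> Sym d \<Longrightarrow> (\<Sum>i\<le>d. monom (coeff F i) i) = F"
  by (rule poly_eqI) (auto simp: Sym_def coeff_sum coeff_eq_0)

text \<open>The parameters are the coefficients of \<open>A\<close> with weight \<open>d1\<close>,
  those of \<open>B\<close> with weight \<open>d2\<close>, stored from index \<open>Suc d1\<close>
  on, and possibly one more of weight \<open>N\<close>. With these weights \<open>A^a\<close>,
  \<open>B^b\<close> and the multiple of \<open>L\<close> all become homogeneous of weight
  \<open>N = a d1 = b d2\<close>.\<close>

lemma powersum_vanishing_aux:
  assumes "a > 0" "b > 0" and d: "d1 > 0" "d2 > 0" and N: "N = a * d1" "N = b * d2"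
    and I: "finite I" and J: "finite J" "{..d1 + d2 + 1} \<subseteq> J" "card J < card I"
    and w: "w = (\<lambda>i. if i \<le> d1 then d1 else if i \<le> d1 + d2 + 1 then d2 else N)"
    and u: "wform J w N u"
  shows "\<exists>k c. (\<exists>m\<in>mons I (\<lambda>_. 1) k. c m \<noteq> 0) \<and>
    (\<forall>t. (\<Sum>m\<in>mons I (\<lambda>_. 1) k. c m * mon I m (coeff
       ((\<Sum>i\<le>d1. monom (t i) i) ^ a + (\<Sum>i\<le>d2. monom (t (Suc (d1 + i))) i) ^ b + smult (u t) L))) = 0)"
proof -
  have wpos: "\<forall>j\<in>J. w j > 0" using d assms by (auto simp: w)
  have v: "wform J w (w j) (\<lambda>t. t j)" if "j \<le> d1 + d2 + 1" for j
    by (rule wform_var) (use J wpos that in auto)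
  have A: "wform J w d1 (\<lambda>t. coeff (\<Sum>i\<le>d1. monom (t i) i) j)" for j
    using v[of j] wform_zero[OF J(1) wpos, of d1] by (cases "j \<le> d1") (auto simp: coeff_sum w)
  have B: "wform J w d2 (\<lambda>t. coeff (\<Sum>i\<le>d2. monom (t (Suc (d1 + i))) i) j)" for j
    using v[of "Suc (d1 + j)"] wform_zero[OF J(1) wpos, of d2]
    by (cases "j \<le> d2") (auto simp: coeff_sum w)
  have "wform J w N (\<lambda>t. coeff ((\<Sum>i\<le>d1. monom (t i) i) ^ a + (\<Sum>i\<le>d2. monom (t (Suc (d1 + i))) i) ^ b + smult (u t) L) j)" for j
  proof -
    have 1: "wform J w N (\<lambda>t. coeff ((\<Sum>i\<le>d1. monom (t i) i) ^ a) j)"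
      using wform_coeff_power[OF J(1) wpos A, of a j] N by simp
    have 2: "wform J w N (\<lambda>t. coeff ((\<Sum>i\<le>d2. monom (t (Suc (d1 + i))) i) ^ b) j)"
      using wform_coeff_power[OF J(1) wpos B, of b j] N by simp
    have 3: "wform J w N (\<lambda>t. coeff (smult (u t) L) j)"
      using wform_cmult[OF J(1) wpos u, of "coeff L j"] by (simp add: mult.commute)
    show ?thesis using wform_add[OF J(1) wpos wform_add[OF J(1) wpos 1 2] 3] by simp
  qed
  note psi = this
  have "J \<noteq> {}" using J(2) by auto
  from vanishing_combination[OF I J(1) wpos this J(3) psi] show ?thesis .
qed

lemma powersum_vanishing:
  assumes "a > 0" "b > 0" "d1 > 0" "d2 > 0" "N = a * d1" "N = b * d2"
    and I: "finite I" "d1 + d2 + 2 < card I"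
  shows "\<exists>k c. (\<exists>m\<in>mons I (\<lambda>_. 1) k. c m \<noteq> 0) \<and> (\<forall>A\<in>Sym d1. \<forall>B\<in>Sym d2.
    (\<Sum>m\<in>mons I (\<lambda>_. 1) k. c m * mon I m (coeff (A ^ a + B ^ b))) = 0)"
proof -
  let ?J = "{..d1 + d2 + 1}"
  have "wform ?J (\<lambda>i. if i \<le> d1 then d1 else if i \<le> d1 + d2 + 1 then d2 else N) N (\<lambda>_. 0)"
    by (rule wform_zero) (use assms in auto)
  note u = this
  have "finite ?J" "{..d1 + d2 + 1} \<subseteq> ?J" "card ?J < card I" using I by auto
  from powersum_vanishing_aux[OF assms(1-7) this refl u, of 0] obtain k c where
    c: "\<exists>m\<in>mons I (\<lambda>_. 1) k. c m \<noteq> 0" "\<forall>t. (\<Sum>m\<in>mons I (\<lambda>_. 1) k. c m * mon I m (coeff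
       ((\<Sum>i\<le>d1. monom (t i) i) ^ a + (\<Sum>i\<le>d2. monom (t (Suc (d1 + i))) i) ^ b + smult (0) 0))) = 0"
    by (elim exE conjE)
  have "(\<Sum>m\<in>mons I (\<lambda>_. 1) k. c m * mon I m (coeff (A ^ a + B ^ b))) = 0"
    if "A \<in> Sym d1" "B \<in> Sym d2" for A B
    using spec[OF c(2), of "\<lambda>i. if i \<le> d1 then coeff A i else coeff B (i - Suc d1)"] sum_monom_coeff[OF that(1)]
      sum_monom_coeff[OF that(2)] by simp
  then show ?thesis using c(1) by blast
qed

text \<open>The multiple of \<open>L\<close> costs one additional parameter of weight
  \<open>N\<close>, hence the bound \<open>d1 + d2 + 3\<close>.\<close>

lemma powersum_join_vanishing:
  assumes "a > 0" "b > 0" "d1 > 0" "d2 > 0" "N = a * d1" "N = b * d2"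
    and I: "finite I" "d1 + d2 + 3 < card I"
  shows "\<exists>k c. (\<exists>m\<in>mons I (\<lambda>_. 1) k. c m \<noteq> 0) \<and> (\<forall>A\<in>Sym d1. \<forall>B\<in>Sym d2. \<forall>s.
    (\<Sum>m\<in>mons I (\<lambda>_. 1) k. c m * mon I m (coeff (A ^ a + B ^ b + smult s L))) = 0)"
proof -
  let ?J = "{..d1 + d2 + 2}"
  have "wform ?J (\<lambda>i. if i \<le> d1 then d1 else if i \<le> d1 + d2 + 1 then d2 else N) N (\<lambda>t. t (d1 + d2 + 2))"
    using wform_var[of ?J "\<lambda>i. if i \<le> d1 then d1 else if i \<le> d1 + d2 + 1 then d2 else N" "d1 + d2 + 2"]
      assms by auto
  note u = this
  have "finite ?J" "{..d1 + d2 + 1} \<subseteq> ?J" "card ?J < card I" using I by auto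
  from powersum_vanishing_aux[OF assms(1-7) this refl u, of L] obtain k c where
    c: "\<exists>m\<in>mons I (\<lambda>_. 1) k. c m \<noteq> 0" "\<forall>t. (\<Sum>m\<in>mons I (\<lambda>_. 1) k. c m * mon I m (coeff
       ((\<Sum>i\<le>d1. monom (t i) i) ^ a + (\<Sum>i\<le>d2. monom (t (Suc (d1 + i))) i) ^ b + smult (t (d1 + d2 + 2)) L))) = 0"
    by (elim exE conjE)
  have "(\<Sum>m\<in>mons I (\<lambda>_. 1) k. c m * mon I m (coeff (A ^ a + B ^ b + smult s L))) = 0"
    if "A \<in> Sym d1" "B \<in> Sym d2" for A B s
    using spec[OF c(2), of "\<lambda>i. if i \<le> d1 then coeff A i else if i \<le> d1 + d2 + 1 then coeff B (i - Suc d1) else s"]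
      sum_monom_coeff[OF that(1)] sum_monom_coeff[OF that(2)] by simp
  then show ?thesis using c(1) by blast
qed

text \<open>Turns a nontrivial combination of monomials into a form with a proper zero set in
  projective space.\<close>

lemma mon_sum_nonzero:
  assumes "I \<subseteq> {..n}" "\<exists>m\<in>mons I (\<lambda>_. 1) k. c m \<noteq> 0"
  shows "\<exists>F\<in>Sym n - {0}. (\<Sum>m\<in>mons I (\<lambda>_. 1) k. c m * mon I m (coeff F)) \<noteq> 0"
proof -
  have fin: "finite I" using assms finite_subset by blast
  obtain m0 where m0: "m0 \<in> mons I (\<lambda>_. 1) k" "c m0 \<noteq> 0" using assms by blast
  have finM: "finite (mons I (\<lambda>_. 1) k)" by (rule finite_mons) (use fin in auto)
  have "\<exists>x. (\<forall>i. x i \<noteq> 0) \<and> (\<Sum>m\<in>mons I (\<lambda>_. 1) k. c m * mon I m x) \<noteq> 0"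
  proof (rule ccontr)
    assume neg: "\<not> ?thesis"
    have "c m0 = 0"
    proof (rule mon_independent[OF fin finM _ _ m0(1)])
      show "\<forall>m\<in>mons I (\<lambda>_. 1) k. \<forall>i. i \<notin> I \<longrightarrow> m i = 0" by (simp add: mons_def)
      show "(\<Sum>m\<in>mons I (\<lambda>_. 1) k. c m * mon I m x) = 0" if "\<And>i. x i \<noteq> 0" for x
        using neg that by blast
    qed
    with m0(2) show False by simp
  qed
  then obtain x where x: "\<And>i. x i \<noteq> 0" "(\<Sum>m\<in>mons I (\<lambda>_. 1) k. c m * mon I m x) \<noteq> 0" by blast
  define F where "F = (\<Sum>i\<le>n. monom (x i) i)"
  have coeffF: "coeff F i = (if i \<le> n then x i else 0)" for i by (simp add: F_def coeff_sum)
  have "F \<in> Sym n" unfolding Sym_def by (auto intro: degree_le simp: coeffF)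
  moreover have "F \<noteq> 0" using coeffF[of 0] x(1)[of 0] by auto
  moreover have "mon I m (coeff F) = mon I m x" for m
    unfolding mon_def by (rule prod.cong) (use assms in \<open>auto simp: coeffF\<close>)
  ultimately show ?thesis using x(2) by (intro bexI[of _ F]) auto
qed

subsection \<open>The Zariski topology and Krull codimension\<close>

lemma proj_class_eq:
  "F \<in> Sym n - {0} \<Longrightarrow> proj_rel n `` {F} = {smult c F | c. c \<noteq> 0}"
  by (auto simp: proj_rel_def)

lemma proj_class_refl: "F \<in> Sym n - {0} \<Longrightarrow> F \<in> proj_rel n `` {F}"
  unfolding proj_class_eq by (auto intro!: exI[of _ 1])

lemma proj_class_eqI:
  assumes "F \<in> Sym n - {0}" "c \<noteq> 0" shows "proj_rel n `` {smult c F} = proj_rel n `` {F}"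
proof -
  have cF: "smult c F \<in> Sym n - {0}" using assms by (auto simp: Sym_def)
  show ?thesis unfolding proj_class_eq[OF assms(1)] proj_class_eq[OF cF]
  proof (intro equalityI subsetI)
    fix G assume "G \<in> {smult e F | e. e \<noteq> 0}"
    then obtain e where "e \<noteq> 0" "G = smult e F" by auto
    then show "G \<in> {smult e (smult c F) | e. e \<noteq> 0}"
      using assms(2) by (auto intro!: exI[of _ "e / c"])
  qed (use assms in auto)
qed

lemma proj_space_iff: "x \<in> proj_space n \<longleftrightarrow> (\<exists>F\<in>Sym n - {0}. x = proj_rel n `` {F})"
  by (auto simp: proj_space_def quotient_def)

lemma proj_space_mem:
  assumes "x \<in> proj_space n" "F \<in> x" shows "F \<in> Sym n - {0}" "x = proj_rel n `` {F}"
proof -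
  obtain G where G: "G \<in> Sym n - {0}" "x = proj_rel n `` {G}" using assms proj_space_iff by auto
  then obtain c where c: "c \<noteq> 0" "F = smult c G" using assms proj_class_eq[OF G(1)] by auto
  then show "F \<in> Sym n - {0}" using G by (auto simp: Sym_def)
  show "x = proj_rel n `` {F}" using proj_class_eqI[OF G(1) c(1)] c G by simp
qed

lemma proj_space_nonempty: "x \<in> proj_space n \<Longrightarrow> \<exists>F. F \<in> x"
  using proj_space_iff proj_class_refl by blast

lemma homogeneous_smult:
  assumes "homogeneous_poly n k f"
  shows "f (coeff (smult c F)) = c ^ k * f (coeff F)"
proof -
  obtain M e where M: "\<forall>m\<in>M. (\<Sum>i\<le>n. m i) = k"
    "f = (\<lambda>x. \<Sum>m\<in>M. e m * (\<Prod>i\<le>n. x i ^ m i))" using assms unfolding homogeneous_poly_def by blast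
  have "e m * (\<Prod>i\<le>n. (c * coeff F i) ^ m i) = c ^ k * (e m * (\<Prod>i\<le>n. coeff F i ^ m i))" if "m \<in> M" for m
    using that M(1) by (auto simp: power_mult_distrib prod.distrib power_sum[symmetric])
  then show ?thesis unfolding M(2) coeff_smult sum_distrib_left by (intro sum.cong) auto
qed

text \<open>By homogeneity a single representative \<open>F\<close> decides for the whole
  class.\<close>

lemma vanish_class_iff:
  assumes "x \<in> proj_space n" "homogeneous_poly n k f" "F \<in> x"
  shows "(\<forall>G\<in>x. f (coeff G) = 0) \<longleftrightarrow> f (coeff F) = 0" "(\<forall>G\<in>x. f (coeff G) \<noteq> 0) \<longleftrightarrow> f (coeff F) \<noteq> 0"
proof -
  have x: "x = {smult c F | c. c \<noteq> 0}" using proj_space_mem[OF assms(1,3)] proj_class_eq by simp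
  show "(\<forall>G\<in>x. f (coeff G) = 0) \<longleftrightarrow> f (coeff F) = 0" "(\<forall>G\<in>x. f (coeff G) \<noteq> 0) \<longleftrightarrow> f (coeff F) \<noteq> 0"
    using assms(3) unfolding x by (auto simp: homogeneous_smult[OF assms(2)])
qed

lemma zariski_basic_open:
  assumes "homogeneous_poly n k f"
  shows "openin (zariski n) {x \<in> proj_space n. \<forall>F\<in>x. f (coeff F) \<noteq> 0}"
  unfolding zariski_def by (rule topology_generated_by_Basis) (use assms in blast)

lemma topspace_zariski [simp]: "topspace (zariski n) = proj_space n"
proof
  show "topspace (zariski n) \<subseteq> proj_space n" unfolding zariski_def by auto
  show "proj_space n \<subseteq> topspace (zariski n)"
    using openin_subset[OF zariski_basic_open[OF homogeneous_poly_const[of n 1]]] by simp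
qed

definition zeros :: "nat \<Rightarrow> ((nat \<Rightarrow> complex) \<Rightarrow> complex) \<Rightarrow> complex poly set set" where
  "zeros n f = {x \<in> proj_space n. \<forall>F\<in>x. f (coeff F) = 0}"

lemma closedin_zeros:
  assumes "homogeneous_poly n k f" shows "closedin (zariski n) (zeros n f)"
proof -
  have "proj_space n - zeros n f = {x \<in> proj_space n. \<forall>F\<in>x. f (coeff F) \<noteq> 0}"
    unfolding zeros_def using vanish_class_iff[OF _ assms] proj_space_nonempty by blast
  then show ?thesis using zariski_basic_open[OF assms] by (auto simp: closedin_def zeros_def)
qed

text \<open>The principal open sets of \<open>f\<close> and \<open>g\<close> meet in that of the
  product \<open>f g\<close>, so the generating family is already a base of the topology.\<close>

lemma zariski_open_nbhd:
  assumes "openin (zariski n) U" "x \<in> U"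
  shows "\<exists>k f. homogeneous_poly n k f \<and> (\<forall>F\<in>x. f (coeff F) \<noteq> 0) \<and>
    {y \<in> proj_space n. \<forall>F\<in>y. f (coeff F) \<noteq> 0} \<subseteq> U"
proof -
  define D where "D f = {y \<in> proj_space n. \<forall>F\<in>y. f (coeff F) \<noteq> 0}"
    for f :: "(nat \<Rightarrow> complex) \<Rightarrow> complex"
  have "generate_topology_on {D f | f k. homogeneous_poly n k f} U"
    using openin_topology_generated_by[OF assms(1)[unfolded zariski_def]] by (simp add: D_def)
  then have "\<forall>x\<in>U. \<exists>k f. homogeneous_poly n k f \<and> x \<in> D f \<and> D f \<subseteq> U"
  proof induction
    case (Int A B)
    show ?case
    proof
      fix x assume x: "x \<in> A \<inter> B"
      obtain k f where f: "homogeneous_poly n k f" "x \<in> D f" "D f \<subseteq> A" using Int x by blast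
      obtain l g where g: "homogeneous_poly n l g" "x \<in> D g" "D g \<subseteq> B" using Int x by blast
      have "D (\<lambda>x. f x * g x) = D f \<inter> D g" by (auto simp: D_def)
      then show "\<exists>k f. homogeneous_poly n k f \<and> x \<in> D f \<and> D f \<subseteq> A \<inter> B"
        using homogeneous_poly_mult[OF f(1) g(1)] f g by blast
    qed
  qed blast+
  then show ?thesis using assms(2) unfolding D_def by blast
qed

lemma zariski_separate:
  assumes "closedin (zariski n) C" "x \<in> proj_space n" "x \<notin> C"
  shows "\<exists>k f. homogeneous_poly n k f \<and> C \<subseteq> zeros n f \<and> (\<forall>F\<in>x. f (coeff F) \<noteq> 0)"
proof -
  have "openin (zariski n) (proj_space n - C)" using assms by (simp add: closedin_def)
  from zariski_open_nbhd[OF this, of x] assms obtain k f where f: "homogeneous_poly n k f"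
    "\<forall>F\<in>x. f (coeff F) \<noteq> 0" "{y \<in> proj_space n. \<forall>F\<in>y. f (coeff F) \<noteq> 0} \<subseteq> proj_space n - C" by auto
  have "C \<subseteq> zeros n f"
  proof
    fix y assume y: "y \<in> C"
    have yp: "y \<in> proj_space n" using y closedin_subset[OF assms(1)] by auto
    obtain G where G: "G \<in> y" using proj_space_nonempty[OF yp] by blast
    have "\<not> (\<forall>F\<in>y. f (coeff F) \<noteq> 0)" using f(3) y yp by blast
    then have "f (coeff G) = 0" using vanish_class_iff(2)[OF yp f(1) G] by blast
    then show "y \<in> zeros n f" using vanish_class_iff(1)[OF yp f(1) G] yp by (simp add: zeros_def)
  qed
  then show ?thesis using f by blast
qed

text \<open>The coefficient vectors of all representatives. For points of projective space 0 is
  never among them, which matters when curves run through 0.\<close>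

definition affine_cone :: "complex poly set set \<Rightarrow> (nat \<Rightarrow> complex) set" where
  "affine_cone Z = coeff ` \<Union>Z"

lemma affine_cone_mono: "Z \<subseteq> Z' \<Longrightarrow> affine_cone Z \<subseteq> affine_cone Z'"
  by (auto simp: affine_cone_def)

lemma vanish_cone_iff: "Z \<subseteq> proj_space n \<Longrightarrow> (\<forall>x\<in>affine_cone Z. f x = 0) \<longleftrightarrow> Z \<subseteq> zeros n f"
  by (auto simp: affine_cone_def zeros_def)

lemma irreducible_zariskiI:
  assumes Z: "Z \<noteq> {}" "Z \<subseteq> proj_space n" and prime: "prime_set n (affine_cone Z)"
  shows "irreducible_in (zariski n) Z"
  unfolding irreducible_in_def
proof (intro conjI allI impI)
  fix C D assume CD: "closedin (zariski n) C \<and> closedin (zariski n) D \<and> Z \<subseteq> C \<union> D"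
  show "Z \<subseteq> C \<or> Z \<subseteq> D"
  proof (rule ccontr)
    assume "\<not> ?thesis"
    then obtain x y where xy: "x \<in> Z" "x \<notin> C" "y \<in> Z" "y \<notin> D" by auto
    obtain k f where f: "homogeneous_poly n k f" "C \<subseteq> zeros n f" "\<forall>F\<in>x. f (coeff F) \<noteq> 0"
      using zariski_separate[of n C x] CD xy Z by blast
    obtain l g where g: "homogeneous_poly n l g" "D \<subseteq> zeros n g" "\<forall>F\<in>y. g (coeff F) \<noteq> 0"
      using zariski_separate[of n D y] CD xy Z by blast
    have "\<forall>v\<in>affine_cone Z. f v * g v = 0" using CD f(2) g(2) by (auto simp: affine_cone_def zeros_def)
    then have "(\<forall>v\<in>affine_cone Z. f v = 0) \<or> (\<forall>v\<in>affine_cone Z. g v = 0)"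
      using prime f(1) g(1) unfolding prime_set_def by blast
    moreover have "x \<in> proj_space n" "y \<in> proj_space n" using xy Z by auto
    ultimately show False
      using f(3) g(3) xy proj_space_nonempty[of x n] proj_space_nonempty[of y n]
      by (auto simp: affine_cone_def)
  qed
qed (use Z in auto)

lemma prime_cone_irreducible:
  assumes "irreducible_in (zariski n) Z" shows "prime_set n (affine_cone Z)"
  unfolding prime_set_def
proof (intro allI impI)
  fix k l f g assume f: "homogeneous_poly n k f" and g: "homogeneous_poly n l g"
    and fg: "\<forall>x\<in>affine_cone Z. f x * g x = 0"
  have Z: "Z \<subseteq> proj_space n" using assms by (simp add: irreducible_in_def)
  have "Z \<subseteq> zeros n f \<union> zeros n g"
  proof
    fix x assume x: "x \<in> Z"
    then have xp: "x \<in> proj_space n" using Z by auto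
    then obtain F where F: "F \<in> x" using proj_space_nonempty by blast
    then have "f (coeff F) * g (coeff F) = 0" using fg x by (auto simp: affine_cone_def)
    then show "x \<in> zeros n f \<union> zeros n g"
      using vanish_class_iff(1)[OF xp f F] vanish_class_iff(1)[OF xp g F] xp by (auto simp: zeros_def)
  qed
  then have "Z \<subseteq> zeros n f \<or> Z \<subseteq> zeros n g"
    using assms closedin_zeros[OF f] closedin_zeros[OF g] unfolding irreducible_in_def by blast
  then show "(\<forall>x\<in>affine_cone Z. f x = 0) \<or> (\<forall>x\<in>affine_cone Z. g x = 0)"
    using vanish_cone_iff[OF Z] by blast
qed

lemma irreducible_closure:
  assumes "irreducible_in X Z" shows "irreducible_in X (X closure_of Z)"
proof -
  have "Z \<subseteq> X closure_of Z" using assms closure_of_subset by (auto simp: irreducible_in_def)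
  then show ?thesis using assms closure_of_minimal closure_of_subset_topspace
    unfolding irreducible_in_def by (metis closedin_Un order_trans subset_empty)
qed

definition chains_from :: "'a topology \<Rightarrow> 'a set \<Rightarrow> nat set" where
  "chains_from X Z = {n. \<exists>C. C 0 = Z \<and> (\<forall>i\<le>n. closedin X (C i) \<and> irreducible_in X (C i)) \<and>
                       (\<forall>i<n. C i \<subset> C (Suc i))}"

lemma codim_in_alt: "codim_in X Y =
    (INF Z \<in> {Z. closedin X Z \<and> irreducible_in X Z \<and> Z \<subseteq> Y}. SUP n \<in> chains_from X Z. enat n)"
  by (simp add: codim_in_def chains_from_def)

lemma codim_in_le:
  assumes "closedin X Z" "irreducible_in X Z" "Z \<subseteq> Y" "\<And>n. n \<in> chains_from X Z \<Longrightarrow> n \<le> m"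
  shows "codim_in X Y \<le> enat m"
  unfolding codim_in_alt
  by (rule INF_lower2[of Z]) (use assms in \<open>auto intro!: SUP_least\<close>)

lemma codim_in_ge:
  assumes "\<And>Z. closedin X Z \<Longrightarrow> irreducible_in X Z \<Longrightarrow> Z \<subseteq> Y \<Longrightarrow> m \<in> chains_from X Z"
  shows "enat m \<le> codim_in X Y"
  unfolding codim_in_alt
  by (rule INF_greatest) (use assms in \<open>auto intro!: SUP_upper\<close>)

lemma codim_in_eq_0:
  assumes "irreducible_in X (topspace X)" "topspace X \<subseteq> Y" shows "codim_in X Y = 0"
proof -
  have "codim_in X Y \<le> enat 0"
  proof (rule codim_in_le[OF _ assms])
    fix n assume "n \<in> chains_from X (topspace X)"
    then obtain C where C: "C 0 = topspace X" "\<forall>i\<le>n. closedin X (C i)" "\<forall>i<n. C i \<subset> C (Suc i)"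
      unfolding chains_from_def by blast
    show "n \<le> 0"
    proof (rule ccontr)
      assume n: "\<not> n \<le> 0"
      then have "C 0 \<subset> C 1" "closedin X (C 1)" using C(2,3) by auto
      then show False using C(1) closedin_subset by blast
    qed
  qed simp
  then show ?thesis by (simp flip: zero_enat_def)
qed

text \<open>A single irreducible closed \<open>Z\<close> inside \<open>Y\<close> with at most one
  step above it bounds the infimum by 1. Conversely, every irreducible closed subset of
  \<open>Y\<close> is proper and extends by the whole space to a chain of length 1.\<close>

lemma codim_in_eq_1:
  assumes top: "irreducible_in X (topspace X)" and Z: "closedin X Z" "irreducible_in X Z" "Z \<subseteq> Y"
    and Y: "\<not> topspace X \<subseteq> Y"
    and no: "\<And>W V. closedin X W \<Longrightarrow> irreducible_in X W \<Longrightarrow> closedin X V \<Longrightarrow> irreducible_in X V \<Longrightarrow>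
      Z \<subset> W \<Longrightarrow> W \<subset> V \<Longrightarrow> False"
  shows "codim_in X Y = 1"
proof (rule antisym)
  have "codim_in X Y \<le> enat 1"
  proof (rule codim_in_le[OF Z])
    fix n assume "n \<in> chains_from X Z"
    then obtain C where C: "C 0 = Z" "\<forall>i\<le>n. closedin X (C i) \<and> irreducible_in X (C i)" "\<forall>i<n. C i \<subset> C (Suc i)"
      unfolding chains_from_def by blast
    show "n \<le> 1"
    proof (rule ccontr)
      assume n: "\<not> n \<le> 1"
      then have "C 0 \<subset> C 1" "C 1 \<subset> C 2" using C(3) by (auto simp: numeral_2_eq_2)
      then show False using no[of "C 1" "C 2"] C(1,2) n by auto
    qed
  qed
  then show "codim_in X Y \<le> 1" by (simp add: one_enat_def)
  have "enat 1 \<le> codim_in X Y"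
  proof (rule codim_in_ge)
    fix Z' assume Z': "closedin X Z'" "irreducible_in X Z'" "Z' \<subseteq> Y"
    then have "Z' \<subset> topspace X" using Y closedin_subset by blast
    then show "1 \<in> chains_from X Z'" unfolding chains_from_def
      using Z' top by (intro CollectI exI[of _ "\<lambda>i. if i = 0 then Z' else topspace X"]) auto
  qed
  then show "1 \<le> codim_in X Y" by (simp add: one_enat_def)
qed

text \<open>Every irreducible closed subset of \<open>Y\<close> is the bottom of a chain through
  \<open>W\<close> and the whole space.\<close>

lemma codim_in_ge_2:
  assumes top: "irreducible_in X (topspace X)" and W: "closedin X W" "irreducible_in X W"
    "Y \<subset> W" "W \<noteq> topspace X"
  shows "codim_in X Y \<ge> 2"
proof -
  have "enat 2 \<le> codim_in X Y"
  proof (rule codim_in_ge)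
    fix Z assume Z: "closedin X Z" "irreducible_in X Z" "Z \<subseteq> Y"
    have "Z \<subset> W" "W \<subset> topspace X" using Z W closedin_subset by blast+
    moreover have "(i::nat) < 2 \<Longrightarrow> i = 0 \<or> i = 1" for i by auto
    ultimately show "2 \<in> chains_from X Z" unfolding chains_from_def
      using Z W top
      by (intro CollectI exI[of _ "\<lambda>i. if i = 0 then Z else if i = 1 then W else topspace X"]) auto
  qed
  then show ?thesis by (simp add: numeral_eq_enat)
qed

lemma prime_set_all: "prime_set n (affine_cone (proj_space n))"
  unfolding prime_set_def
proof (intro allI impI, rule ccontr)
  fix k l f g assume f: "homogeneous_poly n k f" and g: "homogeneous_poly n l g"
    and fg: "\<forall>x\<in>affine_cone (proj_space n). f x * g x = 0"
    and neg: "\<not> ((\<forall>x\<in>affine_cone (proj_space n). f x = 0) \<or> (\<forall>x\<in>affine_cone (proj_space n). g x = 0))"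
  then obtain x y where xy: "x \<in> proj_space n" "y \<in> proj_space n" and "\<exists>F\<in>x. f (coeff F) \<noteq> 0" "\<exists>G\<in>y. g (coeff G) \<noteq> 0"
    by (auto simp: affine_cone_def)
  then obtain F G where F: "F \<in> x" "f (coeff F) \<noteq> 0" and G: "G \<in> y" "g (coeff G) \<noteq> 0" by auto
  have FG: "F \<in> Sym n - {0}" "G \<in> Sym n - {0}" using proj_space_mem F G xy by blast+
  define H where "H s = F + smult s (G - F)" for s
  have H: "H s \<in> Sym n" for s using FG
    by (auto simp: H_def Sym_def intro!: degree_add_le degree_smult_le[THEN order_trans] degree_diff_le)
  have Hc: "polyfun (\<lambda>s. coeff (H s) i)" for i
    unfolding H_def coeff_add coeff_smult by (intro polyfun_add polyfun_mult polyfun_const polyfun_id)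
  \<comment> \<open>The line from \<open>F\<close> to \<open>G\<close> may pass through 0, which is
    not in the cone; the extra factor \<open>coeff (H s) j\<close> makes the product vanish there
    too.\<close>
  have "(\<lambda>s. f (coeff (H s)) * g (coeff (H s)) * coeff (H s) j) s = 0" for j s
  proof (cases "H s = 0")
    case False
    then have "proj_rel n `` {H s} \<in> proj_space n" "H s \<in> proj_rel n `` {H s}"
      using H[of s] proj_space_iff proj_class_refl by blast+
    then have "coeff (H s) \<in> affine_cone (proj_space n)" by (auto simp: affine_cone_def)
    then show ?thesis using fg by simp
  qed simp
  then have "f (coeff (H s)) * (g (coeff (H s)) * coeff (H s) j) = 0" for j s by (simp add: mult.assoc)
  from polyfun_mult_eq_0[OF polyfun_homogeneous[OF f Hc] polyfun_mult[OF polyfun_homogeneous[OF g Hc] Hc] this]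
  have "(\<forall>s. f (coeff (H s)) = 0) \<or> (\<forall>s. g (coeff (H s)) * coeff (H s) j = 0)" for j by blast
  moreover have "f (coeff (H 0)) \<noteq> 0" using F by (simp add: H_def)
  ultimately have "g (coeff (H 1)) * coeff (H 1) j = 0" for j by blast
  then have "coeff G j = 0" for j using G by (simp add: H_def)
  then show False using FG by (simp add: poly_eq_iff)
qed

lemma irreducible_proj_space: "irreducible_in (zariski n) (topspace (zariski n))"
proof -
  have "proj_rel n `` {1} \<in> proj_space n" unfolding proj_space_iff by (intro bexI[of _ 1]) (auto simp: Sym_def)
  then show ?thesis using irreducible_zariskiI[OF _ _ prime_set_all] by auto
qed

subsection \<open>Sets connected by polynomial curves\<close>

definition curve :: "(complex \<Rightarrow> nat \<Rightarrow> complex) \<Rightarrow> bool" where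
  "curve \<gamma> \<longleftrightarrow> (\<forall>i. polyfun (\<lambda>s. \<gamma> s i))"

text \<open>A criterion for irreducibility that can be checked directly: in all applications the
  curve is a line in a space of parameters.\<close>

definition curve_connected :: "(nat \<Rightarrow> complex) set \<Rightarrow> bool" where
  "curve_connected S \<longleftrightarrow> (\<forall>x\<in>S. \<forall>y\<in>S. \<exists>\<gamma>. curve \<gamma> \<and> \<gamma> 0 = x \<and> \<gamma> 1 = y \<and> (\<forall>s. \<gamma> s \<in> S))"

text \<open>The curve may leave \<open>E\<close>. Infinitely many hits suffice, since a polynomial
  in \<open>s\<close> with infinitely many zeros also vanishes at \<open>s = 1\<close>.\<close>

definition curve_dense :: "(nat \<Rightarrow> complex) set \<Rightarrow> (nat \<Rightarrow> complex) set \<Rightarrow> bool" where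
  "curve_dense E S \<longleftrightarrow> E \<subseteq> S \<and> (\<forall>x\<in>S. \<exists>\<gamma>. curve \<gamma> \<and> \<gamma> 1 = x \<and> infinite {s. \<gamma> s \<in> E})"

lemma polyfun_curve: "homogeneous_poly n k f \<Longrightarrow> curve \<gamma> \<Longrightarrow> polyfun (\<lambda>s. f (\<gamma> s))"
  unfolding curve_def by (rule polyfun_homogeneous) auto

lemma curve_polycurve: "polycurve P \<Longrightarrow> curve (\<lambda>s. coeff (P s))"
  by (simp add: curve_def polycurve_def)

text \<open>Along a curve from a point with \<open>f \<noteq> 0\<close> to one with
  \<open>g \<noteq> 0\<close>, the product \<open>f g\<close> is a polynomial in one variable, and
  these form an integral domain.\<close>

lemma prime_curve_connected:
  assumes "curve_connected S" shows "prime_set n S"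
  unfolding prime_set_def
proof (intro allI impI, rule ccontr)
  fix k l f g assume f: "homogeneous_poly n k f" and g: "homogeneous_poly n l g"
    and fg: "\<forall>x\<in>S. f x * g x = 0" and neg: "\<not> ((\<forall>x\<in>S. f x = 0) \<or> (\<forall>x\<in>S. g x = 0))"
  then obtain x y where xy: "x \<in> S" "f x \<noteq> 0" "y \<in> S" "g y \<noteq> 0" by auto
  obtain \<gamma> where \<gamma>: "curve \<gamma>" "\<gamma> 0 = x" "\<gamma> 1 = y" "\<And>s. \<gamma> s \<in> S"
    using assms xy unfolding curve_connected_def by blast
  have "(\<forall>s. f (\<gamma> s) = 0) \<or> (\<forall>s. g (\<gamma> s) = 0)"
    by (rule polyfun_mult_eq_0) (use polyfun_curve[OF f \<gamma>(1)] polyfun_curve[OF g \<gamma>(1)] fg \<gamma>(4) in auto)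
  then show False using xy \<gamma> by metis
qed

lemma vanish_dense:
  assumes "curve_dense E S" "homogeneous_poly n k f" "\<forall>x\<in>E. f x = 0" "x \<in> S"
  shows "f x = 0"
proof -
  obtain \<gamma> where \<gamma>: "curve \<gamma>" "\<gamma> 1 = x" "infinite {s. \<gamma> s \<in> E}"
    using assms unfolding curve_dense_def by blast
  have "infinite {s. f (\<gamma> s) = 0}" by (rule infinite_super[OF _ \<gamma>(3)]) (use assms in auto)
  from polyfun_eq_0[OF polyfun_curve[OF assms(2) \<gamma>(1)] this, of 1] show ?thesis using \<gamma> by simp
qed

lemma prime_dense:
  assumes "curve_dense E S" "prime_set n S" shows "prime_set n E"
  unfolding prime_set_def
proof (intro allI impI)
  fix k l f g assume f: "homogeneous_poly n k f" and g: "homogeneous_poly n l g"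
    and fg: "\<forall>x\<in>E. f x * g x = 0"
  have "\<forall>x\<in>S. f x * g x = 0"
    using vanish_dense[OF assms(1) homogeneous_poly_mult[OF f g] fg] by blast
  then have "(\<forall>x\<in>S. f x = 0) \<or> (\<forall>x\<in>S. g x = 0)"
    using assms(2) f g unfolding prime_set_def by blast
  moreover have "E \<subseteq> S" using assms(1) by (simp add: curve_dense_def)
  ultimately show "(\<forall>x\<in>E. f x = 0) \<or> (\<forall>x\<in>E. g x = 0)" by blast
qed

lemma infinite_curve_nonzero:
  assumes "curve \<gamma>" "\<gamma> s0 \<noteq> (\<lambda>_. 0)" shows "infinite {s. \<gamma> s \<noteq> (\<lambda>_. 0)}"
proof
  assume fin: "finite {s. \<gamma> s \<noteq> (\<lambda>_. 0)}"
  obtain i where i: "\<gamma> s0 i \<noteq> 0" using assms(2) by auto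
  have "finite {s. \<gamma> s i \<noteq> 0}" by (rule finite_subset[OF _ fin]) (auto dest: fun_cong)
  moreover have "finite {s. \<gamma> s i = 0}"
    using polyfun_eq_0[of "\<lambda>s. \<gamma> s i" s0] assms(1) i unfolding curve_def by blast
  ultimately have "finite ({s. \<gamma> s i \<noteq> 0} \<union> {s. \<gamma> s i = 0})" by blast
  moreover have "{s. \<gamma> s i \<noteq> 0} \<union> {s. \<gamma> s i = 0} = UNIV" by auto
  ultimately show False using infinite_UNIV_char_0[where 'a = complex] by simp
qed

lemma curve_dense_nonzero:
  assumes "curve_connected S" "x0 \<in> S" "x0 \<noteq> (\<lambda>_. 0)" shows "curve_dense (S - {\<lambda>_. 0}) S"
  unfolding curve_dense_def
proof (intro conjI ballI)
  fix x assume "x \<in> S"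
  then obtain \<gamma> where \<gamma>: "curve \<gamma>" "\<gamma> 0 = x0" "\<gamma> 1 = x" "\<And>s. \<gamma> s \<in> S"
    using assms unfolding curve_connected_def by blast
  have "infinite {s. \<gamma> s \<in> S - {\<lambda>_. 0}}" using infinite_curve_nonzero[of \<gamma> 0] \<gamma> assms(3) by simp
  then show "\<exists>\<gamma>. curve \<gamma> \<and> \<gamma> 1 = x \<and> infinite {s. \<gamma> s \<in> S - {\<lambda>_. 0}}" using \<gamma> by blast
qed auto

text \<open>Contains the zero vector, including the case \<open>A^a = - B^b\<close>, so that lines
  in the space of pairs \<open>(A, B)\<close> stay inside; \<open>curve_dense_nonzero\<close>
  removes it again.\<close>

definition powersum_vecs :: "nat \<Rightarrow> nat \<Rightarrow> nat \<Rightarrow> nat \<Rightarrow> (nat \<Rightarrow> complex) set" where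
  "powersum_vecs a b d1 d2 = {coeff (A ^ a + B ^ b) | A B. A \<in> Sym d1 \<and> B \<in> Sym d2}"

lemma Sym_line: "A \<in> Sym d \<Longrightarrow> A' \<in> Sym d \<Longrightarrow> A + smult s (A' - A) \<in> Sym d"
  by (auto simp: Sym_def intro!: degree_add_le degree_smult_le[THEN order_trans] degree_diff_le)

lemma polycurve_line: "polycurve (\<lambda>s. A + smult s (A' - A))"
  by (intro polycurve_add polycurve_smult polycurve_const polyfun_id)

lemma curve_powersum_line:
  "curve (\<lambda>s. coeff ((A + smult s (A' - A)) ^ a + (B + smult s (B' - B)) ^ b))"
  by (intro curve_polycurve polycurve_add[OF polycurve_power polycurve_power] polycurve_line)

lemma curve_connected_powersum: "curve_connected (powersum_vecs a b d1 d2)"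
  unfolding curve_connected_def
proof (intro ballI)
  fix x y assume "x \<in> powersum_vecs a b d1 d2" "y \<in> powersum_vecs a b d1 d2"
  then obtain A B A' B' where S: "A \<in> Sym d1" "B \<in> Sym d2" "A' \<in> Sym d1" "B' \<in> Sym d2"
    and xy: "x = coeff (A ^ a + B ^ b)" "y = coeff (A' ^ a + B' ^ b)"
    unfolding powersum_vecs_def by blast
  show "\<exists>\<gamma>. curve \<gamma> \<and> \<gamma> 0 = x \<and> \<gamma> 1 = y \<and> (\<forall>s. \<gamma> s \<in> powersum_vecs a b d1 d2)"
  proof (intro exI conjI allI)
    show "curve (\<lambda>s. coeff ((A + smult s (A' - A)) ^ a + (B + smult s (B' - B)) ^ b))"
      by (rule curve_powersum_line)
    show "coeff ((A + smult s (A' - A)) ^ a + (B + smult s (B' - B)) ^ b) \<in> powersum_vecs a b d1 d2" for s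
      unfolding powersum_vecs_def using Sym_line[OF S(1,3)] Sym_line[OF S(2,4)] by blast
  qed (simp_all add: xy)
qed

lemma Sym_power: "A \<in> Sym d \<Longrightarrow> A ^ n \<in> Sym (n * d)"
proof -
  assume "A \<in> Sym d"
  then have "degree A * n \<le> d * n" unfolding Sym_def by (intro mult_le_mono1) simp
  with degree_power_le[of A n] have "degree (A ^ n) \<le> d * n" by (rule order_trans)
  then show "A ^ n \<in> Sym (n * d)" by (simp add: Sym_def mult.commute)
qed

lemma Sym_add: "A \<in> Sym d \<Longrightarrow> B \<in> Sym d \<Longrightarrow> A + B \<in> Sym d"
  by (simp add: Sym_def degree_add_le)

lemma Sym_smult: "A \<in> Sym d \<Longrightarrow> smult c A \<in> Sym d"
  by (auto simp: Sym_def intro: degree_smult_le[THEN order_trans])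

text \<open>A scalar has an \<open>a\<close>-th and a \<open>b\<close>-th root, which can be applied
  to \<open>A\<close> and \<open>B\<close> separately; so the set is a cone.\<close>

lemma powersum_scale:
  assumes "a > 0" "b > 0" "A \<in> Sym d1" "B \<in> Sym d2"
  shows "coeff (smult c (A ^ a + B ^ b)) \<in> powersum_vecs a b d1 d2"
proof -
  obtain \<alpha> \<beta> where "\<alpha> ^ a = c" "\<beta> ^ b = c" using complex_nth_root_exists assms by metis
  then have "smult c (A ^ a + B ^ b) = (smult \<alpha> A) ^ a + (smult \<beta> B) ^ b"
    by (simp add: smult_power smult_add_right)
  moreover have "smult \<alpha> A \<in> Sym d1" "smult \<beta> B \<in> Sym d2" using Sym_smult assms by auto
  ultimately show ?thesis unfolding powersum_vecs_def mem_Collect_eq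
    by (intro exI[of _ "smult \<alpha> A"] exI[of _ "smult \<beta> B"]) simp
qed

lemma growth_powersum:
  assumes "a \<ge> 2" "b \<ge> 2" "d1 > 0" "d2 > 0" "N = a * d1" "N = b * d2" "d1 + d2 < N"
    and dense: "curve_dense E (powersum_vecs a b d1 d2)"
  shows "growth N E (d1 + d2 + 1)"
proof -
  let ?I = "{..d2} \<union> {N - d1..N}"
  have "growth N E (card ?I - 1)"
  proof (rule growth_of_monomials)
    show "?I \<subseteq> {..N}" using assms by auto
    fix k c assume "\<forall>x\<in>E. (\<Sum>m\<in>mons ?I (\<lambda>_. 1) k. c m * mon ?I m x) = 0"
    then have "\<forall>x\<in>powersum_vecs a b d1 d2. (\<Sum>m\<in>mons ?I (\<lambda>_. 1) k. c m * mon ?I m x) = 0"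
      using vanish_dense[OF dense homogeneous_mon_sum[of ?I N k c]] assms by auto
    then show "\<forall>m\<in>mons ?I (\<lambda>_. 1) k. c m = 0"
      using powersum_coords_independent[OF assms(1-7) refl, where k = k and c = c] unfolding powersum_vecs_def by blast
  qed auto
  moreover have "card ?I = d1 + d2 + 2"
    using assms(7) by (subst card_Un_disjoint) auto
  ultimately show ?thesis by simp
qed

lemma exists_vanishing_form:
  assumes "a > 0" "b > 0" "d1 > 0" "d2 > 0" "N = a * d1" "N = b * d2" "d1 + d2 + 1 < N"
  shows "\<exists>k f. homogeneous_poly N k f \<and> (\<forall>x\<in>powersum_vecs a b d1 d2. f x = 0) \<and> (\<exists>F\<in>Sym N - {0}. f (coeff F) \<noteq> 0)"
proof -
  obtain k c where c: "\<exists>m\<in>mons {..N} (\<lambda>_. 1) k. c m \<noteq> 0" "\<forall>A\<in>Sym d1. \<forall>B\<in>Sym d2.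
    (\<Sum>m\<in>mons {..N} (\<lambda>_. 1) k. c m * mon {..N} m (coeff (A ^ a + B ^ b))) = 0"
    using powersum_vanishing[OF assms(1-6), of "{..N}"] assms(7) by auto
  show ?thesis
    by (rule exI[of _ k], rule exI[of _ "\<lambda>x. \<Sum>m\<in>mons {..N} (\<lambda>_. 1) k. c m * mon {..N} m x"])
      (use homogeneous_mon_sum[of "{..N}" N k c] mon_sum_nonzero[of "{..N}" N k c] c
        in \<open>auto simp: powersum_vecs_def\<close>)
qed

text \<open>Each of two proper inclusions raises the order of growth by one, from
  \<open>n - 1\<close> to \<open>n + 1\<close>, which exceeds the maximum \<open>n\<close> in
  \<open>n + 1\<close> variables.\<close>

lemma no_long_chain:
  assumes "growth n E1 (n - 1)" "n > 0" "E1 \<subseteq> E2" "E2 \<subseteq> E3" "prime_set n E2" "prime_set n E3" "E1 \<noteq> {}"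
    and "homogeneous_poly n k f" "\<forall>x\<in>E1. f x = 0" "\<exists>x\<in>E2. f x \<noteq> 0"
    and "homogeneous_poly n l g" "\<forall>x\<in>E2. g x = 0" "\<exists>x\<in>E3. g x \<noteq> 0"
  shows False
proof -
  have "growth n E2 (Suc (n - 1))" by (rule growth_step[OF assms(1,3,5,8,9,10,7)])
  then have "growth n E3 (Suc (Suc (n - 1)))"
    by (rule growth_step[OF _ assms(4,6,11,12,13)]) (use assms in blast)
  then show False using not_growth_Suc assms(2) by simp
qed

lemma separate_cone:
  assumes "closedin (zariski n) Z" "Z \<subset> W" "W \<subseteq> proj_space n"
  shows "\<exists>k f. homogeneous_poly n k f \<and> (\<forall>x\<in>affine_cone Z. f x = 0) \<and> (\<exists>x\<in>affine_cone W. f x \<noteq> 0)"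
proof -
  obtain x where x: "x \<in> W" "x \<notin> Z" using assms by blast
  obtain k f where f: "homogeneous_poly n k f" "Z \<subseteq> zeros n f" "\<forall>F\<in>x. f (coeff F) \<noteq> 0"
    using zariski_separate[OF assms(1), of x] x assms by blast
  obtain F where "F \<in> x" using proj_space_nonempty[of x n] x assms by blast
  then have "\<exists>x\<in>affine_cone W. f x \<noteq> 0" using f x by (auto simp: affine_cone_def)
  moreover have "\<forall>x\<in>affine_cone Z. f x = 0" using vanish_cone_iff[of Z n f] f assms by auto
  ultimately show ?thesis using f by blast
qed

lemma affine_cone_nonempty: "Z \<noteq> {} \<Longrightarrow> Z \<subseteq> proj_space n \<Longrightarrow> affine_cone Z \<noteq> {}"
  using proj_space_nonempty unfolding affine_cone_def by fastforce

text \<open>The growth hypothesis makes \<open>Z\<close> so large that at most one step is left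
  above its closure; the form \<open>f\<close> shows that the closure is a proper subset.\<close>

lemma codim_closure_1:
  assumes Z: "Z \<noteq> {}" "Z \<subseteq> proj_space n" "prime_set n (affine_cone Z)" and "growth n (affine_cone Z) (n - 1)" "n > 0"
    and f: "homogeneous_poly n k f" "\<forall>x\<in>affine_cone Z. f x = 0" "\<exists>F\<in>Sym n - {0}. f (coeff F) \<noteq> 0"
  shows "codim_in (zariski n) (zariski n closure_of Z) = 1"
proof (rule codim_in_eq_1[OF irreducible_proj_space])
  let ?Z = "zariski n closure_of Z"
  have ZZ: "Z \<subseteq> ?Z" using Z closure_of_subset by (metis topspace_zariski)
  show "closedin (zariski n) ?Z" by simp
  show irr: "irreducible_in (zariski n) ?Z"
    by (rule irreducible_closure[OF irreducible_zariskiI[OF Z]])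
  show "?Z \<subseteq> ?Z" by simp
  have "Z \<subseteq> zeros n f" using vanish_cone_iff[OF Z(2)] f(2) by blast
  then have "?Z \<subseteq> zeros n f" using closure_of_minimal closedin_zeros[OF f(1)] by blast
  moreover obtain F where F: "F \<in> Sym n - {0}" "f (coeff F) \<noteq> 0" using f(3) by blast
  ultimately have "proj_rel n `` {F} \<notin> ?Z" using proj_class_refl[OF F(1)] by (auto simp: zeros_def)
  moreover have "proj_rel n `` {F} \<in> proj_space n" using F proj_space_iff by blast
  ultimately show "\<not> topspace (zariski n) \<subseteq> ?Z" by auto
  fix W V assume W: "closedin (zariski n) W" "irreducible_in (zariski n) W"
    and V: "closedin (zariski n) V" "irreducible_in (zariski n) V" and sub: "?Z \<subset> W" "W \<subset> V"
  have Vp: "V \<subseteq> proj_space n" "W \<subseteq> proj_space n" using V W closedin_subset[of "zariski n"] by auto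
  obtain k' f' where f': "homogeneous_poly n k' f'" "\<forall>x\<in>affine_cone ?Z. f' x = 0" "\<exists>x\<in>affine_cone W. f' x \<noteq> 0"
    using separate_cone[of n ?Z W] sub Vp by auto
  obtain l g where g: "homogeneous_poly n l g" "\<forall>x\<in>affine_cone W. g x = 0" "\<exists>x\<in>affine_cone V. g x \<noteq> 0"
    using separate_cone[OF W(1) sub(2) Vp(1)] by blast
  show False
    by (rule no_long_chain[OF assms(4,5) _ _ prime_cone_irreducible[OF W(2)] prime_cone_irreducible[OF V(2)]
          _ f'(1) _ f'(3) g])
      (use affine_cone_mono[of Z W] affine_cone_mono[of W V] affine_cone_mono[OF ZZ] ZZ sub f'(2) affine_cone_nonempty[OF Z(1,2)] in auto)
qed

lemma codim_closure_0:
  assumes Z: "Z \<subseteq> proj_space n"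
    and dense: "\<And>k f F. homogeneous_poly n k f \<Longrightarrow> \<forall>x\<in>affine_cone Z. f x = 0 \<Longrightarrow> F \<in> Sym n - {0} \<Longrightarrow> f (coeff F) = 0"
  shows "codim_in (zariski n) (zariski n closure_of Z) = 0"
proof (rule codim_in_eq_0[OF irreducible_proj_space])
  show "topspace (zariski n) \<subseteq> zariski n closure_of Z"
  proof
    fix x assume "x \<in> topspace (zariski n)"
    then have x: "x \<in> proj_space n" by simp
    show "x \<in> zariski n closure_of Z"
    proof (rule ccontr)
      assume "x \<notin> zariski n closure_of Z"
      then obtain k f where f: "homogeneous_poly n k f" "zariski n closure_of Z \<subseteq> zeros n f" "\<forall>F\<in>x. f (coeff F) \<noteq> 0"
        using zariski_separate[of n "zariski n closure_of Z" x] x by auto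
      have "Z \<subseteq> zeros n f" using f(2) Z closure_of_subset[of Z "zariski n"] by auto
      then have "\<forall>x\<in>affine_cone Z. f x = 0" using vanish_cone_iff[OF Z] by blast
      moreover obtain F where "F \<in> x" using proj_space_nonempty[OF x] by blast
      ultimately show False using dense[OF f(1), of F] f(3) proj_space_mem[OF x, of F] by blast
    qed
  qed
qed

text \<open>The weighted action multiplies \<open>A^a + B^b\<close> by \<open>c^N\<close>, so the
  projective class is independent of the representative.\<close>

lemma pseudo_disc_image:
  assumes "a > 0" "b > 0" "d1 > 0" "d2 > 0" and N: "N = a * d1" "N = b * d2"
  shows "pseudo_disc a b N ` pseudo_disc_domain a b N =
    {proj_rel N `` {A ^ a + B ^ b} | A B. A \<in> Sym d1 \<and> B \<in> Sym d2 \<and> A ^ a + B ^ b \<noteq> 0}"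
proof -
  have "N div a = d1" using assms(1) by (simp add: N(1))
  moreover have "N div b = d2" using assms(2) by (simp add: N(2))
  ultimately have div: "N div a = d1" "N div b = d2" by auto
  have cls: "wp_rel d1 d2 `` {(A, B)} = (\<lambda>c. (smult (c ^ d1) A, smult (c ^ d2) B)) ` {c. c \<noteq> 0}"
    if "(A, B) \<in> Sym d1 \<times> Sym d2 - {(0, 0)}" for A B
    using that by (auto simp: wp_rel_def)
  have scale: "smult (c ^ d1) A ^ a + smult (c ^ d2) B ^ b = smult (c ^ N) (A ^ a + B ^ b)" for c A B
  proof -
    have "(c ^ d1) ^ a = c ^ N" unfolding N(1) by (simp add: mult.commute flip: power_mult)
    moreover have "(c ^ d2) ^ b = c ^ N" unfolding N(2) by (simp add: mult.commute flip: power_mult)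
    ultimately show ?thesis by (simp add: smult_power smult_add_right)
  qed
  have ne: "A ^ a + B ^ b \<noteq> 0 \<Longrightarrow> (A, B) \<noteq> (0, 0)" for A B :: "complex poly"
    using assms by (auto simp: power_0_left)
  have inS: "A ^ a + B ^ b \<in> Sym N" if "A \<in> Sym d1" "B \<in> Sym d2" for A B
    using Sym_add[of "A ^ a" N "B ^ b"] Sym_power[OF that(1), of a] Sym_power[OF that(2), of b]
    by (simp flip: N)
  have val: "pseudo_disc a b N (wp_rel d1 d2 `` {(A, B)}) = proj_rel N `` {A ^ a + B ^ b}"
    and dom: "wp_rel d1 d2 `` {(A, B)} \<in> pseudo_disc_domain a b N"
    if "A \<in> Sym d1" "B \<in> Sym d2" "A ^ a + B ^ b \<noteq> 0" for A B
  proof -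
    have AB: "(A, B) \<in> Sym d1 \<times> Sym d2 - {(0, 0)}" using that ne by blast
    have F: "A ^ a + B ^ b \<in> Sym N - {0}" using inS that by auto
    have "pseudo_disc a b N (wp_rel d1 d2 `` {(A, B)}) =
        (\<Union>c\<in>{c. c \<noteq> 0}. proj_rel N `` {smult (c ^ N) (A ^ a + B ^ b)})"
      unfolding pseudo_disc_def cls[OF AB] by (simp add: scale)
    also have "\<dots> = (\<Union>c\<in>{c::complex. c \<noteq> 0}. proj_rel N `` {A ^ a + B ^ b})"
      using proj_class_eqI[OF F] by (intro SUP_cong) auto
    also have "\<dots> = proj_rel N `` {A ^ a + B ^ b}" using zero_neq_one by blast
    finally show "pseudo_disc a b N (wp_rel d1 d2 `` {(A, B)}) = proj_rel N `` {A ^ a + B ^ b}" .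
    show "wp_rel d1 d2 `` {(A, B)} \<in> pseudo_disc_domain a b N"
      unfolding pseudo_disc_domain_def div WP_def mem_Collect_eq
    proof
      show "wp_rel d1 d2 `` {(A, B)} \<in> (Sym d1 \<times> Sym d2 - {(0, 0)}) // wp_rel d1 d2"
        using AB by (rule quotientI)
      show "\<forall>(A', B')\<in>wp_rel d1 d2 `` {(A, B)}. A' ^ a + B' ^ b \<noteq> 0"
        unfolding cls[OF AB] using that(3) by (auto simp: scale)
    qed
  qed
  show ?thesis
  proof (intro equalityI subsetI)
    fix y assume "y \<in> pseudo_disc a b N ` pseudo_disc_domain a b N"
    then obtain X where X: "X \<in> pseudo_disc_domain a b N" "y = pseudo_disc a b N X" by blast
    then obtain A B where AB: "(A, B) \<in> Sym d1 \<times> Sym d2 - {(0, 0)}" "X = wp_rel d1 d2 `` {(A, B)}"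
      unfolding pseudo_disc_domain_def div WP_def quotient_def by auto
    have "(A, B) \<in> X" unfolding AB(2) cls[OF AB(1)] by (auto intro!: image_eqI[of _ _ 1])
    then have "A ^ a + B ^ b \<noteq> 0" using X unfolding pseudo_disc_domain_def by auto
    then show "y \<in> {proj_rel N `` {A ^ a + B ^ b} | A B. A \<in> Sym d1 \<and> B \<in> Sym d2 \<and> A ^ a + B ^ b \<noteq> 0}"
      using val X AB by auto
  next
    fix y assume "y \<in> {proj_rel N `` {A ^ a + B ^ b} | A B. A \<in> Sym d1 \<and> B \<in> Sym d2 \<and> A ^ a + B ^ b \<noteq> 0}"
    then obtain A B where "A \<in> Sym d1" "B \<in> Sym d2" "A ^ a + B ^ b \<noteq> 0" "y = proj_rel N `` {A ^ a + B ^ b}" by blast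
    then show "y \<in> pseudo_disc a b N ` pseudo_disc_domain a b N"
      using val[of A B] dom[of A B] by (auto intro!: image_eqI)
  qed
qed

subsection \<open>Pseudo-discriminants\<close>

definition powersum_classes :: "nat \<Rightarrow> nat \<Rightarrow> nat \<Rightarrow> nat \<Rightarrow> nat \<Rightarrow> complex poly set set" where
  "powersum_classes a b d1 d2 N =
    {proj_rel N `` {A ^ a + B ^ b} | A B. A \<in> Sym d1 \<and> B \<in> Sym d2 \<and> A ^ a + B ^ b \<noteq> 0}"

lemma coeff_eq_0_iff: "coeff F = (\<lambda>_. 0) \<longleftrightarrow> F = 0"
  by (auto simp: poly_eq_iff fun_eq_iff)

context
  fixes a b d1 d2 N :: nat
  assumes ab: "a > 0" "b > 0" and N: "N = a * d1" "N = b * d2"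
begin

lemma powersum_Sym: "A \<in> Sym d1 \<Longrightarrow> B \<in> Sym d2 \<Longrightarrow> A ^ a + B ^ b \<in> Sym N"
  using Sym_add[of "A ^ a" N "B ^ b"] Sym_power[of A d1 a] Sym_power[of B d2 b] by (simp flip: N)

lemma powersum_classes_subset: "powersum_classes a b d1 d2 N \<subseteq> proj_space N"
proof
  fix x assume "x \<in> powersum_classes a b d1 d2 N"
  then obtain A B where "A \<in> Sym d1" "B \<in> Sym d2" "A ^ a + B ^ b \<noteq> 0" "x = proj_rel N `` {A ^ a + B ^ b}"
    unfolding powersum_classes_def by blast
  then show "x \<in> proj_space N" unfolding proj_space_iff using powersum_Sym by blast
qed

lemma affine_cone_powersum_classes: "affine_cone (powersum_classes a b d1 d2 N) = powersum_vecs a b d1 d2 - {\<lambda>_. 0}"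
proof (intro equalityI subsetI)
  fix v assume "v \<in> affine_cone (powersum_classes a b d1 d2 N)"
  then obtain A B G where AB: "A \<in> Sym d1" "B \<in> Sym d2" "A ^ a + B ^ b \<noteq> 0"
    and G: "G \<in> proj_rel N `` {A ^ a + B ^ b}" "v = coeff G"
    unfolding affine_cone_def powersum_classes_def by blast
  have F: "A ^ a + B ^ b \<in> Sym N - {0}" using powersum_Sym AB by auto
  obtain c where c: "c \<noteq> 0" "G = smult c (A ^ a + B ^ b)" using G proj_class_eq[OF F] by auto
  then have "G \<noteq> 0" using AB by simp
  then show "v \<in> powersum_vecs a b d1 d2 - {\<lambda>_. 0}"
    using powersum_scale[OF ab AB(1,2), of c] c G coeff_eq_0_iff[of G] by simp
next
  fix v assume v: "v \<in> powersum_vecs a b d1 d2 - {\<lambda>_. 0}"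
  then obtain A B where AB: "A \<in> Sym d1" "B \<in> Sym d2" "v = coeff (A ^ a + B ^ b)"
    unfolding powersum_vecs_def by blast
  then have F: "A ^ a + B ^ b \<in> Sym N - {0}"
    using powersum_Sym v coeff_eq_0_iff[of "A ^ a + B ^ b"] by auto
  then have "proj_rel N `` {A ^ a + B ^ b} \<in> powersum_classes a b d1 d2 N"
    unfolding powersum_classes_def using AB by blast
  then show "v \<in> affine_cone (powersum_classes a b d1 d2 N)"
    using proj_class_refl[OF F] AB(3) unfolding affine_cone_def by blast
qed

lemma powersum_vecs_nonzero: "\<exists>x\<in>powersum_vecs a b d1 d2. x \<noteq> (\<lambda>_. 0)"
proof -
  have "(1::complex poly) \<in> Sym d1" "(0::complex poly) \<in> Sym d2" by (auto simp: Sym_def)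
  then have "coeff ((1::complex poly) ^ a + 0 ^ b) \<in> powersum_vecs a b d1 d2"
    unfolding powersum_vecs_def by blast
  moreover have "coeff ((1::complex poly) ^ a + 0 ^ b) \<noteq> (\<lambda>_. 0)"
    unfolding coeff_eq_0_iff using ab by (simp add: zero_power)
  ultimately show ?thesis by blast
qed

lemma dense_powersum_cone: "curve_dense (affine_cone (powersum_classes a b d1 d2 N)) (powersum_vecs a b d1 d2)"
  unfolding affine_cone_powersum_classes
  using curve_dense_nonzero[OF curve_connected_powersum] powersum_vecs_nonzero by blast

lemma powersum_classes_nonempty: "powersum_classes a b d1 d2 N \<noteq> {}"
proof -
  have "affine_cone (powersum_classes a b d1 d2 N) \<noteq> {}"
    unfolding affine_cone_powersum_classes using powersum_vecs_nonzero by blast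
  then show ?thesis by (auto simp: affine_cone_def)
qed

lemma prime_powersum_cone: "prime_set N (affine_cone (powersum_classes a b d1 d2 N))"
  by (rule prime_dense[OF dense_powersum_cone prime_curve_connected[OF curve_connected_powersum]])

lemma codim_powersum_1:
  assumes "a \<ge> 2" "b \<ge> 2" "d1 > 0" "d2 > 0" "d1 + d2 + 2 = N"
  shows "codim_in (zariski N) (zariski N closure_of powersum_classes a b d1 d2 N) = 1"
proof -
  have gr: "growth N (affine_cone (powersum_classes a b d1 d2 N)) (N - 1)"
    using growth_powersum[OF assms(1-4) N _ dense_powersum_cone] assms(5) by (simp flip: assms(5))
  obtain k f where f: "homogeneous_poly N k f" "\<forall>x\<in>powersum_vecs a b d1 d2. f x = 0" "\<exists>F\<in>Sym N - {0}. f (coeff F) \<noteq> 0"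
    using exists_vanishing_form[OF ab assms(3,4) N] assms(5) by auto
  have "\<forall>x\<in>affine_cone (powersum_classes a b d1 d2 N). f x = 0" using f(2) unfolding affine_cone_powersum_classes by blast
  from codim_closure_1[OF powersum_classes_nonempty powersum_classes_subset prime_powersum_cone gr _ f(1) this f(3)]
  show ?thesis using assms by simp
qed

lemma codim_powersum_0:
  assumes van: "\<And>k f F. homogeneous_poly N k f \<Longrightarrow> \<forall>x\<in>powersum_vecs a b d1 d2. f x = 0 \<Longrightarrow>
    F \<in> Sym N - {0} \<Longrightarrow> f (coeff F) = 0"
  shows "codim_in (zariski N) (zariski N closure_of powersum_classes a b d1 d2 N) = 0"
  by (rule codim_closure_0[OF powersum_classes_subset])
    (use van vanish_dense[OF dense_powersum_cone] in blast)

text \<open>With \<open>d1 + d2 + 1 = N\<close> the two blocks of independent coordinates exhaust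
  \<open>0, ..., N\<close>, so only the zero form vanishes on the image.\<close>

lemma codim_powersum_dense:
  assumes "a \<ge> 2" "b \<ge> 2" "d1 > 0" "d2 > 0" "d1 + d2 + 1 = N"
  shows "codim_in (zariski N) (zariski N closure_of powersum_classes a b d1 d2 N) = 0"
proof (rule codim_powersum_0)
  fix k f F assume f: "homogeneous_poly N k f" "\<forall>x\<in>powersum_vecs a b d1 d2. f x = 0"
  obtain c where c: "f = (\<lambda>x. \<Sum>m\<in>mons {..N} (\<lambda>_. 1) k. c m * mon {..N} m x)"
    using f(1) unfolding homogeneous_poly_iff_wform wform_def by blast
  have I: "{..N} = {..d2} \<union> {N - d1..N}" using assms(5) by auto
  have "c m = 0" if "m \<in> mons {..N} (\<lambda>_. 1) k" for m
  proof (rule powersum_coords_independent[OF assms(1-4) N _ I _ that])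
    fix A B assume "A \<in> Sym d1" "B \<in> Sym d2"
    then have "coeff (A ^ a + B ^ b) \<in> powersum_vecs a b d1 d2" unfolding powersum_vecs_def by blast
    then show "(\<Sum>m\<in>mons {..N} (\<lambda>_. 1) k. c m * mon {..N} m (coeff (A ^ a + B ^ b))) = 0"
      using f(2) unfolding c by blast
  qed (use assms in simp)
  then show "f (coeff F) = 0" unfolding c by simp
qed

text \<open>The join of the image with the point \<open>L\<close>. The value \<open>s = 0\<close> is
  allowed, so the image itself is contained in it.\<close>

definition join_vecs :: "complex poly \<Rightarrow> (nat \<Rightarrow> complex) set" where
  "join_vecs L = {coeff (A ^ a + B ^ b + smult s L) | A B s. A \<in> Sym d1 \<and> B \<in> Sym d2}"

definition join_classes :: "complex poly \<Rightarrow> complex poly set set" where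
  "join_classes L = {x \<in> proj_space N. \<exists>F\<in>x. coeff F \<in> join_vecs L}"

lemma join_vecs_scale:
  assumes "coeff F \<in> join_vecs L" shows "coeff (smult c F) \<in> join_vecs L"
proof -
  obtain A B s where AB: "A \<in> Sym d1" "B \<in> Sym d2" "F = A ^ a + B ^ b + smult s L"
    using assms unfolding join_vecs_def by (auto simp: coeff_inject)
  obtain \<alpha> \<beta> where "\<alpha> ^ a = c" "\<beta> ^ b = c" using complex_nth_root_exists ab by metis
  then have "smult c F = (smult \<alpha> A) ^ a + (smult \<beta> B) ^ b + smult (c * s) L"
    using AB by (simp add: smult_power smult_add_right)
  moreover have "smult \<alpha> A \<in> Sym d1" "smult \<beta> B \<in> Sym d2" using Sym_smult AB by auto
  ultimately show ?thesis unfolding join_vecs_def mem_Collect_eq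
    by (intro exI[of _ "smult \<alpha> A"] exI[of _ "smult \<beta> B"] exI[of _ "c * s"]) simp
qed

lemma affine_cone_join_classes:
  assumes L: "L \<in> Sym N" shows "affine_cone (join_classes L) = join_vecs L - {\<lambda>_. 0}"
proof (intro equalityI subsetI)
  fix v assume "v \<in> affine_cone (join_classes L)"
  then obtain x F G where x: "x \<in> proj_space N" "F \<in> x" "coeff F \<in> join_vecs L" "G \<in> x" "v = coeff G"
    unfolding affine_cone_def join_classes_def by blast
  then obtain c where "c \<noteq> 0" "G = smult c F" using proj_space_mem[OF x(1,2)] proj_class_eq[of F N] by auto
  moreover have "G \<noteq> 0" using proj_space_mem[OF x(1,4)] by blast
  ultimately show "v \<in> join_vecs L - {\<lambda>_. 0}"
    using join_vecs_scale[OF x(3), of c] x(5) coeff_eq_0_iff[of G] by simp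
next
  fix v assume v: "v \<in> join_vecs L - {\<lambda>_. 0}"
  then obtain A B s where AB: "A \<in> Sym d1" "B \<in> Sym d2" "v = coeff (A ^ a + B ^ b + smult s L)"
    unfolding join_vecs_def by blast
  define F where "F = A ^ a + B ^ b + smult s L"
  have "F \<in> Sym N" unfolding F_def using Sym_add[OF powersum_Sym[OF AB(1,2)] Sym_smult[OF L]] .
  then have F: "F \<in> Sym N - {0}" using v AB(3) coeff_eq_0_iff[of F] by (auto simp: F_def)
  then have "proj_rel N `` {F} \<in> join_classes L"
    using v AB(3) proj_class_refl[OF F] proj_space_iff unfolding join_classes_def F_def by blast
  then show "v \<in> affine_cone (join_classes L)"
    using proj_class_refl[OF F] AB(3) unfolding affine_cone_def F_def by blast
qed

lemma curve_connected_join: "curve_connected (join_vecs L)"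
  unfolding curve_connected_def
proof (intro ballI)
  fix x y assume "x \<in> join_vecs L" "y \<in> join_vecs L"
  then obtain A B t A' B' t' where S: "A \<in> Sym d1" "B \<in> Sym d2" "A' \<in> Sym d1" "B' \<in> Sym d2"
    and xy: "x = coeff (A ^ a + B ^ b + smult t L)" "y = coeff (A' ^ a + B' ^ b + smult t' L)"
    unfolding join_vecs_def by blast
  let ?g = "\<lambda>s. coeff ((A + smult s (A' - A)) ^ a + (B + smult s (B' - B)) ^ b + smult (t + s * (t' - t)) L)"
  show "\<exists>\<gamma>. curve \<gamma> \<and> \<gamma> 0 = x \<and> \<gamma> 1 = y \<and> (\<forall>s. \<gamma> s \<in> join_vecs L)"
  proof (intro exI conjI allI)
    show "curve ?g"
      by (intro curve_polycurve polycurve_add polycurve_power polycurve_smult polycurve_const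
          polyfun_add polyfun_mult polyfun_const polyfun_id)
    show "?g s \<in> join_vecs L" for s
      unfolding join_vecs_def using Sym_line[OF S(1,3)] Sym_line[OF S(2,4)] by blast
  qed (simp_all add: xy)
qed

lemma codim_powersum_ge_2:
  assumes "d1 > 0" "d2 > 0" "d1 + d2 + 2 < N"
  shows "codim_in (zariski N) (zariski N closure_of powersum_classes a b d1 d2 N) \<ge> 2"
proof -
  let ?Z = "zariski N"
  let ?Y = "?Z closure_of powersum_classes a b d1 d2 N"
  \<comment> \<open>\<open>L\<close> is taken outside the zero set of a form that vanishes on the
    image, which makes the join strictly larger than the closure of the image.\<close>
  obtain k f L where f: "homogeneous_poly N k f" "\<forall>x\<in>powersum_vecs a b d1 d2. f x = 0"
    and L: "L \<in> Sym N - {0}" "f (coeff L) \<noteq> 0"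
    using exists_vanishing_form[OF ab assms(1,2) N] assms(3) by auto
  let ?W = "?Z closure_of join_classes L"
  have coneW: "affine_cone (join_classes L) = join_vecs L - {\<lambda>_. 0}" using affine_cone_join_classes L by blast
  have Wp: "join_classes L \<subseteq> proj_space N" unfolding join_classes_def by blast
  have sub: "powersum_vecs a b d1 d2 \<subseteq> join_vecs L"
  proof
    fix v assume "v \<in> powersum_vecs a b d1 d2"
    then obtain A B where "A \<in> Sym d1" "B \<in> Sym d2" "v = coeff (A ^ a + B ^ b)"
      unfolding powersum_vecs_def by blast
    then show "v \<in> join_vecs L" unfolding join_vecs_def mem_Collect_eq
      by (intro exI[of _ A] exI[of _ B] exI[of _ 0]) simp
  qed
  obtain x0 where x0: "x0 \<in> join_vecs L" "x0 \<noteq> (\<lambda>_. 0)" using powersum_vecs_nonzero sub by blast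
  have prime: "prime_set N (affine_cone (join_classes L))" unfolding coneW
    by (rule prime_dense[OF curve_dense_nonzero[OF curve_connected_join x0] prime_curve_connected[OF curve_connected_join]])
  have "affine_cone (join_classes L) \<noteq> {}" unfolding coneW using x0 by blast
  then have "join_classes L \<noteq> {}" by (auto simp: affine_cone_def)
  then have irr: "irreducible_in ?Z ?W"
    using irreducible_closure irreducible_zariskiI[OF _ Wp prime] by blast
  have "powersum_classes a b d1 d2 N \<subseteq> join_classes L"
  proof
    fix x assume x: "x \<in> powersum_classes a b d1 d2 N"
    then have xp: "x \<in> proj_space N" using powersum_classes_subset by blast
    then obtain F where F: "F \<in> x" using proj_space_nonempty by blast
    then have "coeff F \<in> affine_cone (powersum_classes a b d1 d2 N)" using x unfolding affine_cone_def by blast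
    then have "coeff F \<in> join_vecs L" using sub unfolding affine_cone_powersum_classes by blast
    then show "x \<in> join_classes L" using xp F unfolding join_classes_def by blast
  qed
  then have YW: "?Y \<subseteq> ?W" by (rule closure_of_mono)
  have "powersum_classes a b d1 d2 N \<subseteq> zeros N f"
    using vanish_cone_iff[OF powersum_classes_subset] f(2) unfolding affine_cone_powersum_classes by blast
  then have Yf: "?Y \<subseteq> zeros N f" using closure_of_minimal closedin_zeros[OF f(1)] by blast
  have "coeff L \<in> join_vecs L" unfolding join_vecs_def mem_Collect_eq
    using ab by (intro exI[of _ 0] exI[of _ 1]) (auto simp: Sym_def zero_power)
  then have "proj_rel N `` {L} \<in> join_classes L" unfolding join_classes_def
    using L proj_class_refl[OF L(1)] proj_space_iff by blast
  then have LW: "proj_rel N `` {L} \<in> ?W" using closure_of_subset[of "join_classes L" ?Z] Wp by auto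
  have "proj_rel N `` {L} \<notin> ?Y" using Yf L(2) proj_class_refl[OF L(1)] by (auto simp: zeros_def)
  then have strict: "?Y \<subset> ?W" using YW LW by blast
  \<comment> \<open>There are \<open>d1 + d2 + 3\<close> parameters for \<open>N + 1\<close>
    coefficients, so the join is still contained in a proper closed subset.\<close>
  obtain k' c where c: "\<exists>m\<in>mons {..N} (\<lambda>_. 1) k'. c m \<noteq> 0" "\<forall>A\<in>Sym d1. \<forall>B\<in>Sym d2. \<forall>s.
    (\<Sum>m\<in>mons {..N} (\<lambda>_. 1) k'. c m * mon {..N} m (coeff (A ^ a + B ^ b + smult s L))) = 0"
    using powersum_join_vanishing[OF ab assms(1,2) N, of "{..N}" L] assms(3) by auto
  define g where "g = (\<lambda>x. \<Sum>m\<in>mons {..N} (\<lambda>_. 1) k'. c m * mon {..N} m x)"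
  have g: "homogeneous_poly N k' g" unfolding g_def by (rule homogeneous_mon_sum) simp
  have "\<forall>x\<in>join_vecs L. g x = 0" using c(2) unfolding g_def join_vecs_def by blast
  then have "join_classes L \<subseteq> zeros N g" using vanish_cone_iff[OF Wp] unfolding coneW by blast
  then have Wg: "?W \<subseteq> zeros N g" using closure_of_minimal closedin_zeros[OF g] by blast
  obtain F where F: "F \<in> Sym N - {0}" "g (coeff F) \<noteq> 0"
    using mon_sum_nonzero[of "{..N}" N k' c] c(1) unfolding g_def by blast
  then have "proj_rel N `` {F} \<notin> ?W" using Wg proj_class_refl[OF F(1)] by (auto simp: zeros_def)
  moreover have "proj_rel N `` {F} \<in> topspace ?Z" using F proj_space_iff by auto
  ultimately have "?W \<noteq> topspace ?Z" by blast
  then show ?thesis by (intro codim_in_ge_2[OF irreducible_proj_space _ irr strict]) auto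
qed

end

section \<open>The exceptional exponents 2 and 2, and the arithmetic of the hypersurface
  case\<close>

lemma poly_factor_degree:
  fixes F :: "complex poly"
  assumes "F \<noteq> 0" "j \<le> degree F"
  shows "\<exists>U V. F = U * V \<and> degree U = j"
  using assms(2)
proof (induction j)
  case 0
  show ?case by (intro exI[of _ 1] exI[of _ F]) auto
next
  case (Suc j)
  then obtain U V where UV: "F = U * V" "degree U = j" by auto
  then have "U \<noteq> 0" "V \<noteq> 0" using assms(1) by auto
  then have "degree V > 0" using Suc.prems UV by (simp add: degree_mult_eq)
  then have "\<not> constant (poly V)" by (simp add: constant_degree)
  then obtain z where "poly V z = 0" using fundamental_theorem_of_algebra by blast
  then obtain W where W: "V = [:-z, 1:] * W" by (metis dvdE poly_eq_0_iff_dvd)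
  have "F = (U * [:-z, 1:]) * W" using UV W by (simp only: mult.assoc)
  moreover have "degree (U * [:-z, 1:]) = Suc j" using \<open>U \<noteq> 0\<close> UV(2) by (subst degree_mult_eq) auto
  ultimately show ?case by blast
qed

text \<open>A form of degree \<open>2 e\<close> splits into two forms of degree \<open>e\<close>,
  and \<open>U V = ((U + V) / 2)^2 + (i (U - V) / 2)^2\<close>. For \<open>a = b = 2\<close> one has
  \<open>d1 + d2 = N\<close>, outside the range of \<open>powersum_coords_independent\<close>, so
  this case is treated by hand.\<close>

lemma sum_of_two_squares:
  fixes F :: "complex poly"
  assumes "F \<in> Sym (2 * e)"
  shows "\<exists>A\<in>Sym e. \<exists>B\<in>Sym e. F = A\<^sup>2 + B\<^sup>2"
proof -
  have "\<exists>U\<in>Sym e. \<exists>V\<in>Sym e. F = U * V"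
  proof (cases "degree F \<le> e")
    case True
    then show ?thesis by (intro bexI[of _ F] bexI[of _ 1]) (auto simp: Sym_def)
  next
    case False
    then have "F \<noteq> 0" "e \<le> degree F" by auto
    then obtain U V where UV: "F = U * V" "degree U = e" using poly_factor_degree by blast
    then have "degree F = e + degree V" using \<open>F \<noteq> 0\<close> by (auto simp: degree_mult_eq)
    then have "degree V \<le> e" using assms by (simp add: Sym_def)
    then show ?thesis using UV by (intro bexI[of _ U] bexI[of _ V]) (auto simp: Sym_def)
  qed
  then obtain U V where UV: "U \<in> Sym e" "V \<in> Sym e" "F = U * V" by blast
  define A where "A = smult (1 / 2) (U + V)"
  define B where "B = smult (\<i> / 2) (U - V)"
  have "poly (A\<^sup>2 + B\<^sup>2) z = poly F z" for z
  proof -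
    have "(1 / 2 * (u + v))\<^sup>2 + (\<i> / 2 * (u - v))\<^sup>2 = u * v" for u v :: complex
      by (simp add: power2_eq_square field_simps)
    then show ?thesis unfolding A_def B_def UV(3) by simp
  qed
  then have "A\<^sup>2 + B\<^sup>2 = F" by (simp add: poly_eq_poly_eq_iff[symmetric] fun_eq_iff)
  moreover have "A \<in> Sym e" "B \<in> Sym e"
    using UV unfolding A_def B_def by (auto simp: Sym_def degree_add_le degree_diff_le intro: degree_smult_le[THEN order_trans])
  ultimately show ?thesis by blast
qed

text \<open>With \<open>b = c + 2\<close> the equation becomes \<open>(c + 1) d2 = d1 + 2\<close>,
  and \<open>d1 <= d2\<close> leaves \<open>c d2 <= 2\<close>. For \<open>c = 0\<close> and
  \<open>a = h + 2\<close> it reduces to \<open>h d1 = 4\<close>, whence the three triples with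
  \<open>b = 2\<close>; the cases \<open>c = 1\<close> and \<open>c = 2\<close> contribute one
  triple each.\<close>

lemma hypersurface_arith:
  fixes a b d1 d2 N :: nat
  assumes "a \<ge> b" "b \<ge> 2" "d1 > 0" "d2 > 0" "N = a * d1" "N = b * d2"
  shows "d1 + d2 + 2 = N \<longleftrightarrow> (a, b, N) \<in> {(3, 2, 12), (4, 2, 8), (6, 2, 6), (3, 3, 6), (4, 4, 4)}"
proof
  assume e: "d1 + d2 + 2 = N"
  have "b * d1 \<le> b * d2" using assms(1,5,6) by (metis mult_le_mono1)
  then have le: "d1 \<le> d2" using assms(2) by simp
  obtain c where c: "b = c + 2" using assms(2) by (metis add.commute le_iff_add)
  have cd: "c * d2 + d2 = d1 + 2" using e assms(6) c by (simp add: algebra_simps)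
  then have "c * d2 \<le> 2" using le by linarith
  moreover have "c \<le> c * d2" using assms(4) by simp
  ultimately have "c \<le> 2" by linarith
  then consider "c = 0" | "c = 1" | "c = 2" by linarith
  then show "(a, b, N) \<in> {(3, 2, 12), (4, 2, 8), (6, 2, 6), (3, 3, 6), (4, 4, 4)}"
  proof cases
    case 1
    obtain h where h: "a = h + 2" using assms(1,2) by (metis add.commute le_iff_add order_trans)
    have "d2 = d1 + 2" using cd 1 by simp
    then have hd: "h * d1 = 4" using assms(5) e h by (simp add: algebra_simps)
    then have "d1 dvd 4" by (metis dvd_triv_right)
    then have "d1 \<le> 4" by (rule dvd_imp_le) simp
    then have "d1 = 1 \<or> d1 = 2 \<or> d1 = 3 \<or> d1 = 4" using assms(3) by linarith
    then show ?thesis using hd h 1 c assms(5) by (elim disjE) (auto, presburger)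
  next
    case 2
    then have "d2 \<le> 2" using \<open>c * d2 \<le> 2\<close> by simp
    then have "d2 = 1 \<or> d2 = 2" using assms(4) by linarith
    then show ?thesis using cd 2 c assms by auto
  next
    case 3
    then have "d2 = 1" using \<open>c * d2 \<le> 2\<close> assms(4) by simp
    then show ?thesis using cd 3 c assms by auto
  qed
next
  assume "(a, b, N) \<in> {(3, 2, 12), (4, 2, 8), (6, 2, 6), (3, 3, 6), (4, 4, 4)}"
  then show "d1 + d2 + 2 = N" using assms(5,6) by auto
qed

theorem pseudo_disc_classification:
  fixes a b N :: nat
  assumes "a > 0" "b > 0" "N > 0" and "a \<ge> b" and "a dvd N" and "b dvd N"
  shows "pseudo_disc_hypersurface a b N \<longleftrightarrow>
    (a, b, N) \<in> {(3, 2, 12), (4, 2, 8), (6, 2, 6), (3, 3, 6), (4, 4, 4)}"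
proof -
  obtain d1 where N1: "N = a * d1" using assms(5) by (rule dvdE)
  obtain d2 where N2: "N = b * d2" using assms(6) by (rule dvdE)
  note N = N1 N2
  have d: "d1 > 0" "d2 > 0" using N assms(3) by (metis gr0I mult_0_right)+
  let ?c = "codim_in (zariski N) (zariski N closure_of powersum_classes a b d1 d2 N)"
  have hyp: "pseudo_disc_hypersurface a b N \<longleftrightarrow> ?c = 1"
    unfolding pseudo_disc_hypersurface_def powersum_classes_def
      pseudo_disc_image[OF assms(1,2) d N] ..
  \<comment> \<open>For \<open>b = 1\<close> and for \<open>a = b = 2\<close> every form is in the
    image. Otherwise \<open>d1 <= N / 3\<close> and \<open>d2 <= N / 2\<close> give
    \<open>d1 + d2 < N\<close>.\<close>
  consider "b = 1" | "a = 2" "b = 2" | "b \<ge> 2" "a \<ge> 3" using assms(2,4) by linarith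
  then show ?thesis
  proof cases
    case 1
    have "?c = 0"
    proof (rule codim_powersum_0[OF assms(1,2) N])
      fix k f F assume f: "\<forall>x\<in>powersum_vecs a b d1 d2. f x = 0" and F: "F \<in> Sym N - {0}"
      have "coeff (0 ^ a + F ^ b) \<in> powersum_vecs a b d1 d2"
        unfolding powersum_vecs_def mem_Collect_eq using F 1 N(2)
        by (intro exI[of _ 0] exI[of _ F]) (auto simp: Sym_def)
      moreover have "0 ^ a + F ^ b = F" using assms(1) 1 by simp
      ultimately show "f (coeff F) = 0" using f by auto
    qed
    then show ?thesis using hyp 1 by auto
  next
    case 2
    have "?c = 0"
    proof (rule codim_powersum_0[OF assms(1,2) N])
      fix k f F assume f: "\<forall>x\<in>powersum_vecs a b d1 d2. f x = 0" and F: "F \<in> Sym N - {0}"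
      have "d1 = d2" using N 2 by simp
      have "F \<in> Sym (2 * d1)" using F N 2 by simp
      then obtain A B where "A \<in> Sym d1" "B \<in> Sym d1" "F = A\<^sup>2 + B\<^sup>2" using sum_of_two_squares by blast
      then have "coeff F \<in> powersum_vecs a b d1 d2" unfolding powersum_vecs_def using 2 \<open>d1 = d2\<close> by blast
      then show "f (coeff F) = 0" using f by auto
    qed
    then show ?thesis using hyp 2 by auto
  next
    case 3
    note ab3 = this
    have "3 * d1 \<le> N" "2 * d2 \<le> N" using N 3 by (metis mult_le_mono1)+
    then have "d1 + d2 < N" using d by linarith
    then consider "d1 + d2 + 1 = N" | "d1 + d2 + 2 = N" | "d1 + d2 + 2 < N" by linarith
    then show ?thesis
    proof cases
      case 1
      then have "?c = 0" using codim_powersum_dense[OF assms(1,2) N _ _ d] ab3 by simp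
      then show ?thesis using hyp hypersurface_arith[OF assms(4) ab3(1) d N] 1 by auto
    next
      case 2
      then have "?c = 1" using codim_powersum_1[OF assms(1,2) N _ _ d] ab3 by simp
      then show ?thesis using hyp hypersurface_arith[OF assms(4) ab3(1) d N] 2 by auto
    next
      case 3
      then have "?c \<ge> 2" using codim_powersum_ge_2[OF assms(1,2) N d] by simp
      then have "?c \<noteq> 1" by auto
      then show ?thesis using hyp hypersurface_arith[OF assms(4) ab3(1) d N] 3 by auto
    qed
  qed
qed

subsection \<open>Orders of vanishing and simple forms\<close>

fun vanishes_at :: "nat \<Rightarrow> complex poly \<Rightarrow> P1 \<Rightarrow> bool" where
  "vanishes_at d F (Some z) \<longleftrightarrow> poly F z = 0"
| "vanishes_at d F None \<longleftrightarrow> coeff F d = 0"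

lemma form_order_pos_iff:
  assumes "F \<in> Sym d - {0}" shows "form_order d F p > 0 \<longleftrightarrow> vanishes_at d F p"
proof (cases p)
  case None
  have "degree F < d \<longleftrightarrow> coeff F d = 0"
  proof
    assume z: "coeff F d = 0"
    have "degree F \<noteq> d"
    proof
      assume "degree F = d"
      then show False using z assms leading_coeff_0_iff[of F] by simp
    qed
    then show "degree F < d" using assms by (simp add: Sym_def)
  qed (simp add: coeff_eq_0)
  then show ?thesis using None by simp
next
  case (Some z)
  then show ?thesis using assms order_root[of F z] by auto
qed

lemma order_power: "F \<noteq> 0 \<Longrightarrow> order z (F ^ n) = n * order z F" for F :: "complex poly"
  by (induction n) (auto simp: order_mult)

lemma form_order_power:
  assumes "A \<noteq> 0" shows "form_order (n * d) (A ^ n) p = n * form_order d A p"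
  using assms by (cases p) (auto simp: order_power degree_power_eq diff_mult_distrib2)

lemma form_order_uminus: "form_order d (- F) p = form_order d F p"
proof (cases p)
  case (Some z)
  have "order z (- F) = order z F" using order_smult[of "-1" z F] by simp
  then show ?thesis using Some by simp
qed simp

lemma vanishes_at_uminus: "vanishes_at d (- F) p \<longleftrightarrow> vanishes_at d F p"
  by (cases p) auto

lemma sum_form_order:
  assumes "F \<in> Sym d - {0}"
  shows "finite {p. vanishes_at d F p}" "(\<Sum>p | vanishes_at d F p. form_order d F p) = d"
proof -
  let ?R = "{z. poly F z = 0}"
  have fin: "finite ?R" using assms poly_roots_finite by blast
  have deg: "(\<Sum>z\<in>?R. order z F) = degree F"
  proof -
    have "degree F = degree (\<Prod>z\<in>?R. [:-z, 1:] ^ order z F)"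
      using assms complex_poly_decompose[of F] by (metis degree_smult_eq Diff_iff leading_coeff_0_iff singletonI)
    also have "\<dots> = (\<Sum>z\<in>?R. degree ([:-z, 1:] ^ order z F))"
      by (rule degree_prod_eq_sum_degree) auto
    also have "\<dots> = (\<Sum>z\<in>?R. order z F)" by (simp add: degree_linear_power)
    finally show ?thesis by simp
  qed
  have le: "degree F \<le> d" using assms by (simp add: Sym_def)
  have eq: "{p. vanishes_at d F p} = Some ` ?R \<union> (if coeff F d = 0 then {None} else {})"
  proof (intro equalityI subsetI)
    fix p assume "p \<in> {p. vanishes_at d F p}"
    then show "p \<in> Some ` ?R \<union> (if coeff F d = 0 then {None} else {})" by (cases p) auto
  qed (auto split: if_splits)
  show "finite {p. vanishes_at d F p}" unfolding eq using fin by simp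
  have "(\<Sum>p | vanishes_at d F p. form_order d F p) =
      (\<Sum>p\<in>Some ` ?R. form_order d F p) + (\<Sum>p\<in>(if coeff F d = 0 then {None} else {}). form_order d F p)"
    unfolding eq by (rule sum.union_disjoint) (use fin in auto)
  also have "(\<Sum>p\<in>Some ` ?R. form_order d F p) = degree F"
    by (subst sum.reindex) (auto simp: deg)
  also have "(\<Sum>p\<in>(if coeff F d = 0 then {None} else {}). form_order d F p) = d - degree F"
    using form_order_pos_iff[OF assms, of None] by auto
  finally show "(\<Sum>p | vanishes_at d F p. form_order d F p) = d" using le by simp
qed

text \<open>All finite zeros have order \<open>a\<close>, so the root is the product over the
  distinct zeros, scaled by an \<open>a\<close>-th root of the leading coefficient. A zero at
  infinity shows only as the gap between \<open>degree A\<close> and \<open>d1\<close>.\<close>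

lemma form_is_power:
  assumes F: "F \<in> Sym d - {0}" and a: "a > 0" "d = a * d1"
    and ord: "\<And>p. vanishes_at d F p \<Longrightarrow> form_order d F p = a"
  shows "\<exists>A\<in>Sym d1. F = A ^ a"
proof -
  obtain l where l: "l ^ a = lead_coeff F" using complex_nth_root_exists[OF a(1)] by blast
  define A where "A = smult l (\<Prod>z | poly F z = 0. [:-z, 1:])"
  have "A ^ a = smult (lead_coeff F) (\<Prod>z | poly F z = 0. [:-z, 1:] ^ a)"
    unfolding A_def by (simp add: smult_power l flip: prod_power_distrib)
  also have "(\<Prod>z | poly F z = 0. [:-z, 1:] ^ a) = (\<Prod>z | poly F z = 0. [:-z, 1:] ^ order z F)"
    by (rule prod.cong) (use ord[of "Some _"] in auto)
  also have "smult (lead_coeff F) \<dots> = F" by (rule complex_poly_decompose)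
  finally have FA: "F = A ^ a" by simp
  then have "A \<noteq> 0" using F a by (auto simp: power_0_left)
  then have "a * degree A \<le> a * d1" using F a FA by (simp add: Sym_def degree_power_eq)
  then have "A \<in> Sym d1" using a by (simp add: Sym_def)
  then show ?thesis using FA by blast
qed

definition simple_form :: "nat \<Rightarrow> complex poly \<Rightarrow> bool" where
  "simple_form d F \<longleftrightarrow> F \<in> Sym d - {0} \<and> (\<forall>p. form_order d F p \<le> 1)"

lemma order_ge_2_iff:
  fixes F :: "complex poly"
  assumes "F \<noteq> 0" shows "order z F \<ge> 2 \<longleftrightarrow> poly F z = 0 \<and> poly (pderiv F) z = 0"
proof (cases "poly F z = 0")
  case True
  have "pderiv F \<noteq> 0"
  proof
    assume "pderiv F = 0"
    then obtain c where "F = [:c:]" using pderiv_iszero by blast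
    then show False using True assms by auto
  qed
  then have "order z F = Suc (order z (pderiv F))" by (intro order_pderiv assms True)
  then show ?thesis using True \<open>pderiv F \<noteq> 0\<close> order_root[of "pderiv F" z] by auto
next
  case False
  then show ?thesis using order_root[of F z] by auto
qed

text \<open>The partial derivatives of the binary form, whose common zeros are the multiple zeros.\<close>

definition dx_form :: "nat \<Rightarrow> complex poly \<Rightarrow> complex \<Rightarrow> complex \<Rightarrow> complex" where
  "dx_form d F x y = (\<Sum>i\<le>d. of_nat i * coeff F i * x ^ (i - 1) * y ^ (d - i))"

definition dy_form :: "nat \<Rightarrow> complex poly \<Rightarrow> complex \<Rightarrow> complex \<Rightarrow> complex" where
  "dy_form d F x y = (\<Sum>i\<le>d. of_nat (d - i) * coeff F i * x ^ i * y ^ (d - i - 1))"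

lemma poly_Sym: "F \<in> Sym d \<Longrightarrow> poly F z = (\<Sum>i\<le>d. coeff F i * z ^ i)"
  unfolding poly_altdef by (rule sum.mono_neutral_left) (auto simp: Sym_def coeff_eq_0)

lemma poly_pderiv_Sym:
  assumes "F \<in> Sym d" shows "poly (pderiv F) z = (\<Sum>i\<le>d. of_nat i * coeff F i * z ^ (i - 1))"
proof -
  have "F = (\<Sum>i\<le>d. monom (coeff F i) i)" using sum_monom_coeff[OF assms] by simp
  then have "poly (pderiv F) z = poly (pderiv (\<Sum>i\<le>d. monom (coeff F i) i)) z" by simp
  also have "\<dots> = (\<Sum>i\<le>d. of_nat i * coeff F i * z ^ (i - 1))"
    using higher_pderiv_sum[of 1 "\<lambda>i. monom (coeff F i) i" "{..d}"]
    by (simp add: pderiv_monom poly_sum poly_monom)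
  finally show ?thesis .
qed

lemma euler_form:
  "x * dx_form d F x y + y * dy_form d F x y = of_nat d * (\<Sum>i\<le>d. coeff F i * x ^ i * y ^ (d - i))"
proof -
  have "x * (of_nat i * coeff F i * x ^ (i - 1) * y ^ (d - i)) +
      y * (of_nat (d - i) * coeff F i * x ^ i * y ^ (d - i - 1)) = of_nat d * (coeff F i * x ^ i * y ^ (d - i))"
    if i: "i \<le> d" for i
  proof -
    have "x * (of_nat i * coeff F i * x ^ (i - 1) * y ^ (d - i)) = of_nat i * (coeff F i * x ^ i * y ^ (d - i))"
      by (cases i) auto
    moreover have "y * (of_nat (d - i) * coeff F i * x ^ i * y ^ (d - i - 1)) =
        of_nat (d - i) * (coeff F i * x ^ i * y ^ (d - i))"
      by (cases "d - i") auto
    moreover have "of_nat d = of_nat i + (of_nat (d - i) :: complex)" using i by (simp flip: of_nat_add)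
    ultimately show ?thesis by (simp only: distrib_right)
  qed
  then show ?thesis unfolding dx_form_def dy_form_def sum_distrib_left sum.distrib[symmetric]
    by (intro sum.cong) auto
qed

lemma dx_form_1: "F \<in> Sym d \<Longrightarrow> dx_form d F z 1 = poly (pderiv F) z"
  by (simp add: dx_form_def poly_pderiv_Sym)

lemma dy_form_1: "F \<in> Sym d \<Longrightarrow> z * dx_form d F z 1 + dy_form d F z 1 = of_nat d * poly F z"
  using euler_form[of z d F 1] by (simp add: poly_Sym)

lemma dxy_form_infinity:
  assumes "d > 0"
  shows "dx_form d F x 0 = of_nat d * coeff F d * x ^ (d - 1)" "dy_form d F x 0 = coeff F (d - 1) * x ^ (d - 1)"
proof -
  have "dx_form d F x 0 = (\<Sum>i\<in>{d}. of_nat i * coeff F i * x ^ (i - 1) * 0 ^ (d - i))"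
    unfolding dx_form_def by (rule sum.mono_neutral_right) (auto simp: power_0_left)
  then show "dx_form d F x 0 = of_nat d * coeff F d * x ^ (d - 1)" by simp
  have "dy_form d F x 0 = (\<Sum>i\<in>{d - 1}. of_nat (d - i) * coeff F i * x ^ i * 0 ^ (d - i - 1))"
    unfolding dy_form_def by (rule sum.mono_neutral_right) (auto simp: power_0_left)
  then show "dy_form d F x 0 = coeff F (d - 1) * x ^ (d - 1)" using assms by simp
qed

lemma dxy_form_scale:
  assumes "y \<noteq> 0"
  shows "dx_form d F x y = y ^ (d - 1) * dx_form d F (x / y) 1"
    "dy_form d F x y = y ^ (d - 1) * dy_form d F (x / y) 1"
proof -
  have "of_nat i * coeff F i * x ^ (i - 1) * y ^ (d - i) = y ^ (d - 1) * (of_nat i * coeff F i * (x / y) ^ (i - 1))"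
    if "i \<le> d" for i
  proof (cases i)
    case (Suc j)
    then have "y ^ (d - 1) = y ^ j * y ^ (d - i)" using that by (simp flip: power_add)
    then show ?thesis using Suc assms by (simp add: power_divide)
  qed simp
  then show "dx_form d F x y = y ^ (d - 1) * dx_form d F (x / y) 1"
    unfolding dx_form_def sum_distrib_left by (intro sum.cong) auto
  have "of_nat (d - i) * coeff F i * x ^ i * y ^ (d - i - 1) = y ^ (d - 1) * (of_nat (d - i) * coeff F i * (x / y) ^ i)"
    if "i \<le> d" for i
  proof (cases "i = d")
    case False
    then have "y ^ (d - 1) = y ^ i * y ^ (d - i - 1)" using that by (simp flip: power_add)
    then show ?thesis using assms by (simp add: power_divide)
  qed simp
  then show "dy_form d F x y = y ^ (d - 1) * dy_form d F (x / y) 1"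
    unfolding dy_form_def sum_distrib_left by (intro sum.cong) auto
qed

text \<open>By Euler's identity a common zero of the partial derivatives is a zero of the form,
  hence a multiple one. In this homogeneous shape infinity is a point like any other, which prepares
  the compactness argument for openness.\<close>

lemma simple_form_iff:
  assumes d: "d > 0" and F: "F \<in> Sym d"
  shows "simple_form d F \<longleftrightarrow> (\<forall>x y. (x, y) \<noteq> (0, 0) \<longrightarrow> dx_form d F x y \<noteq> 0 \<or> dy_form d F x y \<noteq> 0)"
    (is "_ \<longleftrightarrow> ?R")
proof
  assume s: "simple_form d F"
  then have F0: "F \<noteq> 0" and ord: "\<And>p. form_order d F p \<le> 1" by (auto simp: simple_form_def)
  show ?R
  proof (intro allI impI, rule ccontr)
    fix x y assume xy: "(x, y) \<noteq> (0::complex, 0::complex)" and n: "\<not> (dx_form d F x y \<noteq> 0 \<or> dy_form d F x y \<noteq> 0)"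
    show False
    proof (cases "y = 0")
      case False
      then have z: "dx_form d F (x / y) 1 = 0" "dy_form d F (x / y) 1 = 0"
        using n dxy_form_scale[OF False, of d F x] by auto
      then have "poly (pderiv F) (x / y) = 0" "poly F (x / y) = 0"
        using dx_form_1[OF F] dy_form_1[OF F, of "x / y"] d by auto
      then show False using order_ge_2_iff[OF F0, of "x / y"] ord[of "Some (x / y)"] by auto
    next
      case True
      then have "coeff F d = 0" "coeff F (d - 1) = 0" using n dxy_form_infinity[OF d, of F x] xy d by auto
      moreover have "coeff F (degree F) \<noteq> 0" using F0 by simp
      ultimately have "degree F \<noteq> d" "degree F \<noteq> d - 1" by metis+
      moreover have "degree F \<le> d" using F by (simp add: Sym_def)
      ultimately have "degree F < d - 1" by linarith
      then show False using ord[of None] by auto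
    qed
  qed
next
  assume R: ?R
  have F0: "F \<noteq> 0"
  proof
    assume "F = 0"
    then show False using R[rule_format, of 1 1] by (simp add: dx_form_def dy_form_def)
  qed
  have "form_order d F p \<le> 1" for p
  proof (rule ccontr)
    assume p: "\<not> form_order d F p \<le> 1"
    show False
    proof (cases p)
      case None
      then have "degree F < d - 1" using p by auto
      then have "coeff F d = 0" "coeff F (d - 1) = 0" by (auto simp: coeff_eq_0)
      then show False using R[rule_format, of 1 0] dxy_form_infinity[OF d, of F 1] by auto
    next
      case (Some z)
      then have "poly F z = 0" "poly (pderiv F) z = 0" using p order_ge_2_iff[OF F0, of z] by auto
      then show False using R[rule_format, of z 1] dx_form_1[OF F] dy_form_1[OF F, of z] by auto
    qed
  qed
  then show "simple_form d F" using F F0 by (simp add: simple_form_def)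
qed

section \<open>Openness of simplicity in the classical topology of the parameter\<close>

lemma polyfun_continuous: "polyfun u \<Longrightarrow> continuous_on S u"
  unfolding polyfun_def by (auto intro: continuous_intros)

text \<open>The parameters with a multiple zero form the projection of a closed subset of the unit
  sphere times the parameter plane. The sphere is compact, so this projection is closed, and it
  misses 0.\<close>

lemma simple_form_open:
  assumes d: "d > 0" and P: "polycurve P" "\<And>s. P s \<in> Sym d" and "simple_form d (P 0)"
  shows "\<forall>\<^sub>F s in nhds 0. simple_form d (P s)"
proof -
  define K where "K = sphere (0 :: complex \<times> complex) 1"
  define U where "U = {p \<in> K \<times> UNIV. dx_form d (P (snd p)) (fst (fst p)) (snd (fst p)) = 0 \<and>
    dy_form d (P (snd p)) (fst (fst p)) (snd (fst p)) = 0}"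
  have cc: "continuous_on UNIV (\<lambda>p. coeff (P (snd p)) i)" for i and S :: "((complex \<times> complex) \<times> complex) set"
    by (rule continuous_on_compose2[OF polyfun_continuous[of _ UNIV]])
      (use P(1) in \<open>auto simp: polycurve_def intro: continuous_intros\<close>)
  have cx: "continuous_on UNIV (\<lambda>p. dx_form d (P (snd p)) (fst (fst p)) (snd (fst p)))"
    unfolding dx_form_def by (intro continuous_intros cc)
  have cy: "continuous_on UNIV (\<lambda>p. dy_form d (P (snd p)) (fst (fst p)) (snd (fst p)))"
    unfolding dy_form_def by (intro continuous_intros cc)
  have "U = (K \<times> UNIV) \<inter> ({p. dx_form d (P (snd p)) (fst (fst p)) (snd (fst p)) = 0} \<inter>
    {p. dy_form d (P (snd p)) (fst (fst p)) (snd (fst p)) = 0})" by (auto simp: U_def)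
  moreover have "closed ({p. dx_form d (P (snd p)) (fst (fst p)) (snd (fst p)) = 0} \<inter>
    {p. dy_form d (P (snd p)) (fst (fst p)) (snd (fst p)) = 0})"
    by (intro closed_Int closed_Collect_eq cx cy continuous_on_const)
  ultimately have "closedin (top_of_set (K \<times> UNIV)) U" by (simp add: closedin_closed_Int)
  moreover have "compact K" by (simp add: K_def)
  ultimately have "closedin (top_of_set UNIV) (snd ` U)" by (metis Starlike.closed_map_snd)
  then have cl: "closed (snd ` U)" by simp
  have nonsimple: "s \<in> snd ` U" if ns: "\<not> simple_form d (P s)" for s
  proof -
    obtain x y where xy: "(x, y) \<noteq> (0, 0)" "dx_form d (P s) x y = 0" "dy_form d (P s) x y = 0"
      using simple_form_iff[OF d P(2)] ns by blast
    define r where "r = norm (x, y)"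
    have r: "r > 0" using xy(1) by (simp add: r_def zero_prod_def)
    let ?x = "x / of_real r" and ?y = "y / of_real r"
    have "(?x, ?y) = (1 / r) *\<^sub>R (x, y)" by (simp add: scaleR_conv_of_real)
    then have "norm (?x, ?y) = \<bar>1 / r\<bar> * r" by (simp only: norm_scaleR r_def)
    then have "norm (?x, ?y) = 1" using r by simp
    then have K: "(?x, ?y) \<in> K" by (simp add: K_def)
    \<comment> \<open>Both derivatives are homogeneous of degree \<open>d - 1\<close>, so a common
      zero can be normalised to the unit sphere.\<close>
    have hom: "dx_form d F (c * x) (c * y) = c ^ (d - 1) * dx_form d F x y \<and>
        dy_form d F (c * x) (c * y) = c ^ (d - 1) * dy_form d F x y" if c: "c \<noteq> 0" for F c
    proof (cases "y = 0")
      case True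
      then show ?thesis using dxy_form_infinity[OF d, of F] by (simp add: power_mult_distrib)
    next
      case False
      then show ?thesis using c dxy_form_scale[of "c * y" d F "c * x"] dxy_form_scale[of y d F x]
        by (simp add: power_mult_distrib)
    qed
    have "dx_form d (P s) ?x ?y = 0 \<and> dy_form d (P s) ?x ?y = 0"
      using hom[of "1 / of_real r" "P s"] xy r by simp
    then have "((?x, ?y), s) \<in> U" using K by (simp add: U_def)
    then show ?thesis by (metis image_eqI snd_conv)
  qed
  have "0 \<notin> snd ` U"
  proof
    assume "0 \<in> snd ` U"
    then obtain v where v: "v \<in> K" "dx_form d (P 0) (fst v) (snd v) = 0" "dy_form d (P 0) (fst v) (snd v) = 0"
      by (auto simp: U_def)
    then have "(fst v, snd v) \<noteq> (0, 0)" by (auto simp: K_def zero_prod_def)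
    then show False using simple_form_iff[OF d P(2)] assms(4) v by blast
  qed
  then have "\<forall>\<^sub>F s in nhds 0. s \<in> - (snd ` U)"
    using cl by (intro eventually_nhds_in_open) auto
  then show ?thesis by (rule eventually_mono) (use nonsimple in blast)
qed

lemma eventually_nhds_infinite:
  assumes "\<forall>\<^sub>F s in nhds (0::complex). Q s" shows "infinite {s. Q s}"
proof -
  obtain S where S: "open S" "0 \<in> S" "\<forall>s\<in>S. Q s" using assms unfolding eventually_nhds by blast
  then have "infinite S" using finite_imp_not_open by blast
  moreover have "S \<subseteq> {s. Q s}" using S by blast
  ultimately show ?thesis by (rule infinite_super[rotated])
qed

subsection \<open>Linear substitutions and orbits\<close>

lemma subst_form_Sym: "subst_form d \<alpha> \<beta> \<gamma> \<delta> F \<in> Sym d"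
  unfolding subst_form_def Sym_def mem_Collect_eq
proof (rule degree_sum_le)
  fix i assume i: "i \<in> {..d}"
  have "degree ([:\<beta>, \<alpha>:] ^ i) \<le> 1 * i" "degree ([:\<delta>, \<gamma>:] ^ (d - i)) \<le> 1 * (d - i)"
    by (rule order_trans[OF degree_power_le], rule mult_le_mono1, simp)+
  then have "degree ([:\<beta>, \<alpha>:] ^ i * [:\<delta>, \<gamma>:] ^ (d - i)) \<le> d"
    using degree_mult_le[of "[:\<beta>, \<alpha>:] ^ i" "[:\<delta>, \<gamma>:] ^ (d - i)"] i by simp
  then show "degree (smult (coeff F i) ([:\<beta>, \<alpha>:] ^ i * [:\<delta>, \<gamma>:] ^ (d - i))) \<le> d"
    using degree_smult_le order_trans by blast
qed auto

text \<open>The value at the vector \<open>(x, y)\<close> rather than that of the dehomogenisation,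
  because a substitution may send a finite point to infinity.\<close>

definition hom_value :: "nat \<Rightarrow> complex poly \<Rightarrow> complex \<Rightarrow> complex \<Rightarrow> complex" where
  "hom_value d F x y = (\<Sum>i\<le>d. coeff F i * x ^ i * y ^ (d - i))"

lemma poly_subst_form: "poly (subst_form d \<alpha> \<beta> \<gamma> \<delta> F) z = hom_value d F (\<alpha> * z + \<beta>) (\<gamma> * z + \<delta>)"
  by (simp add: subst_form_def hom_value_def poly_sum algebra_simps)

lemma hom_value_scale: "hom_value d F (w * x) (w * y) = w ^ d * hom_value d F x y"
proof -
  have "w ^ i * w ^ (d - i) = w ^ d" if "i \<le> d" for i using that by (simp flip: power_add)
  then show ?thesis unfolding hom_value_def sum_distrib_left
    by (intro sum.cong) (auto simp: power_mult_distrib)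
qed

lemma hom_value_poly:
  assumes "F \<in> Sym d" "w \<noteq> 0" shows "hom_value d F u w = w ^ d * poly F (u / w)"
  using hom_value_scale[of d F w "u / w" 1] assms by (simp add: hom_value_def poly_Sym)

text \<open>Identities between substituted forms are checked where
  \<open>\<gamma> z + \<delta>\<close> is nonzero; there \<open>hom_value_poly\<close> turns them
  into identities between values of polynomials.\<close>

lemma poly_eqI_nonvanishing:
  fixes p q :: "complex poly"
  assumes "\<gamma> \<noteq> 0 \<or> \<delta> \<noteq> 0" "\<And>z. \<gamma> * z + \<delta> \<noteq> 0 \<Longrightarrow> poly p z = poly q z"
  shows "p = q"
proof -
  have "finite {z. poly [:\<delta>, \<gamma>:] z = 0}" by (rule poly_roots_finite) (use assms in auto)
  then have "infinite (UNIV - {z. poly [:\<delta>, \<gamma>:] z = 0})"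
    using infinite_UNIV_char_0[where 'a = complex] by simp
  moreover have "UNIV - {z. poly [:\<delta>, \<gamma>:] z = 0} \<subseteq> {z. poly (p - q) z = 0}"
    using assms(2) by (auto simp: algebra_simps)
  ultimately have "infinite {z. poly (p - q) z = 0}" using infinite_super by blast
  then show ?thesis using poly_roots_finite[of "p - q"] by auto
qed

lemma subst_form_mult:
  assumes "F \<in> Sym d" "G \<in> Sym e" and det: "\<alpha> * \<delta> - \<beta> * \<gamma> \<noteq> 0"
  shows "subst_form (d + e) \<alpha> \<beta> \<gamma> \<delta> (F * G) = subst_form d \<alpha> \<beta> \<gamma> \<delta> F * subst_form e \<alpha> \<beta> \<gamma> \<delta> G"
proof (rule poly_eqI_nonvanishing)
  show "\<gamma> \<noteq> 0 \<or> \<delta> \<noteq> 0" using det by auto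
  fix z assume z: "\<gamma> * z + \<delta> \<noteq> 0"
  have "F * G \<in> Sym (d + e)" using assms degree_mult_le[of F G] by (simp add: Sym_def)
  then show "poly (subst_form (d + e) \<alpha> \<beta> \<gamma> \<delta> (F * G)) z = poly (subst_form d \<alpha> \<beta> \<gamma> \<delta> F * subst_form e \<alpha> \<beta> \<gamma> \<delta> G) z"
    using z assms by (simp add: poly_subst_form hom_value_poly power_add)
qed

lemma subst_form_1: "subst_form 0 \<alpha> \<beta> \<gamma> \<delta> 1 = 1"
  by (simp add: subst_form_def)

lemma subst_form_power:
  assumes "F \<in> Sym d" and det: "\<alpha> * \<delta> - \<beta> * \<gamma> \<noteq> 0"
  shows "subst_form (n * d) \<alpha> \<beta> \<gamma> \<delta> (F ^ n) = subst_form d \<alpha> \<beta> \<gamma> \<delta> F ^ n"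
proof (induction n)
  case (Suc n)
  show ?case using subst_form_mult[OF assms(1) Sym_power[OF assms(1), of n] det] Suc by simp
qed (simp add: subst_form_1)

lemma subst_form_add:
  "subst_form d \<alpha> \<beta> \<gamma> \<delta> (F + G) = subst_form d \<alpha> \<beta> \<gamma> \<delta> F + subst_form d \<alpha> \<beta> \<gamma> \<delta> G"
  by (simp add: subst_form_def smult_add_left sum.distrib)

lemma subst_form_smult:
  "subst_form d \<alpha> \<beta> \<gamma> \<delta> (smult c F) = smult c (subst_form d \<alpha> \<beta> \<gamma> \<delta> F)"
  by (rule poly_eqI_nonvanishing[of 0 1])
    (simp_all add: poly_subst_form hom_value_def sum_distrib_left mult.assoc)

lemma subst_form_id: "F \<in> Sym d \<Longrightarrow> subst_form d 1 0 0 1 F = F"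
  by (rule poly_eqI_nonvanishing[of 0 1]) (auto simp: poly_subst_form hom_value_poly)

lemma subst_form_compose:
  assumes "F \<in> Sym d" and det: "\<alpha> * \<delta> - \<beta> * \<gamma> \<noteq> 0"
  shows "subst_form d \<alpha> \<beta> \<gamma> \<delta> (subst_form d \<alpha>' \<beta>' \<gamma>' \<delta>' F) =
    subst_form d (\<alpha>' * \<alpha> + \<beta>' * \<gamma>) (\<alpha>' * \<beta> + \<beta>' * \<delta>) (\<gamma>' * \<alpha> + \<delta>' * \<gamma>) (\<gamma>' * \<beta> + \<delta>' * \<delta>) F"
proof (rule poly_eqI_nonvanishing)
  show "\<gamma> \<noteq> 0 \<or> \<delta> \<noteq> 0" using det by auto
  fix z assume z: "\<gamma> * z + \<delta> \<noteq> 0"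
  define u where "u = \<alpha> * z + \<beta>"
  define w where "w = \<gamma> * z + \<delta>"
  have "poly (subst_form d \<alpha> \<beta> \<gamma> \<delta> (subst_form d \<alpha>' \<beta>' \<gamma>' \<delta>' F)) z =
      w ^ d * hom_value d F (\<alpha>' * (u / w) + \<beta>') (\<gamma>' * (u / w) + \<delta>')"
    unfolding poly_subst_form[of d \<alpha> \<beta> \<gamma> \<delta>] u_def[symmetric] w_def[symmetric]
    using z by (simp add: hom_value_poly[OF subst_form_Sym] poly_subst_form w_def)
  also have "\<dots> = hom_value d F (\<alpha>' * u + \<beta>' * w) (\<gamma>' * u + \<delta>' * w)"
  proof -
    have "w * (\<alpha>' * (u / w) + \<beta>') = \<alpha>' * u + \<beta>' * w" "w * (\<gamma>' * (u / w) + \<delta>') = \<gamma>' * u + \<delta>' * w"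
      using z unfolding w_def[symmetric] by (simp_all add: field_simps)
    then show ?thesis unfolding hom_value_scale[symmetric] by simp
  qed
  finally show "poly (subst_form d \<alpha> \<beta> \<gamma> \<delta> (subst_form d \<alpha>' \<beta>' \<gamma>' \<delta>' F)) z = poly
    (subst_form d (\<alpha>' * \<alpha> + \<beta>' * \<gamma>) (\<alpha>' * \<beta> + \<beta>' * \<delta>) (\<gamma>' * \<alpha> + \<delta>' * \<gamma>) (\<gamma>' * \<beta> + \<delta>' * \<delta>) F) z"
    by (simp add: poly_subst_form u_def w_def algebra_simps)
qed

lemma subst_form_inverse:
  assumes "F \<in> Sym d" and det: "\<alpha> * \<delta> - \<beta> * \<gamma> \<noteq> 0"
  shows "\<exists>\<alpha>' \<beta>' \<gamma>' \<delta>'. \<alpha>' * \<delta>' - \<beta>' * \<gamma>' \<noteq> 0 \<and>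
    subst_form d \<alpha>' \<beta>' \<gamma>' \<delta>' (subst_form d \<alpha> \<beta> \<gamma> \<delta> F) = F"
proof -
  define D where "D = \<alpha> * \<delta> - \<beta> * \<gamma>"
  have D: "D \<noteq> 0" using det by (simp add: D_def)
  have 1: "\<alpha> * (\<delta> / D) + \<beta> * (- \<gamma> / D) = 1"
  proof -
    have "\<alpha> * (\<delta> / D) + \<beta> * (- \<gamma> / D) = (\<alpha> * \<delta> - \<beta> * \<gamma>) / D" by (simp add: diff_divide_distrib)
    then show ?thesis using D by (simp flip: D_def)
  qed
  then have 2: "\<gamma> * (- \<beta> / D) + \<delta> * (\<alpha> / D) = 1" by (simp add: mult.commute)
  have "(\<delta> / D) * (\<alpha> / D) - (- \<beta> / D) * (- \<gamma> / D) = (\<alpha> * (\<delta> / D) + \<beta> * (- \<gamma> / D)) / D"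
    by (simp add: diff_divide_distrib mult.commute)
  then have det': "(\<delta> / D) * (\<alpha> / D) - (- \<beta> / D) * (- \<gamma> / D) \<noteq> 0" unfolding 1 using D by simp
  have "\<alpha> * (- \<beta> / D) + \<beta> * (\<alpha> / D) = 0" "\<gamma> * (\<delta> / D) + \<delta> * (- \<gamma> / D) = 0" by (simp_all add: mult.commute)
  then have "subst_form d (\<delta> / D) (- \<beta> / D) (- \<gamma> / D) (\<alpha> / D) (subst_form d \<alpha> \<beta> \<gamma> \<delta> F) = F"
    unfolding subst_form_compose[OF assms(1) det'] 1 2 using subst_form_id[OF assms(1)] by simp
  then show ?thesis using det' by blast
qed

lemma subst_form_nonzero:
  assumes "F \<in> Sym d - {0}" "\<alpha> * \<delta> - \<beta> * \<gamma> \<noteq> 0" shows "subst_form d \<alpha> \<beta> \<gamma> \<delta> F \<in> Sym d - {0}"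
proof -
  have "subst_form d \<alpha> \<beta> \<gamma> \<delta> F \<noteq> 0"
  proof
    assume z: "subst_form d \<alpha> \<beta> \<gamma> \<delta> F = 0"
    have "F \<in> Sym d" using assms by blast
    from subst_form_inverse[OF this assms(2)] obtain \<alpha>' \<beta>' \<gamma>' \<delta>' where
      "subst_form d \<alpha>' \<beta>' \<gamma>' \<delta>' (subst_form d \<alpha> \<beta> \<gamma> \<delta> F) = F" by blast
    moreover have "subst_form d \<alpha>' \<beta>' \<gamma>' \<delta>' 0 = 0" by (simp add: subst_form_def)
    ultimately show False using z assms by simp
  qed
  then show ?thesis using subst_form_Sym by blast
qed

lemma orbit_class:
  assumes F: "F \<in> Sym d - {0}"
  shows "orbit d (proj_rel d `` {F}) =
    {proj_rel d `` {subst_form d \<alpha> \<beta> \<gamma> \<delta> F} | \<alpha> \<beta> \<gamma> \<delta>. \<alpha> * \<delta> - \<beta> * \<gamma> \<noteq> 0}"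
proof (intro equalityI subsetI)
  fix y assume "y \<in> orbit d (proj_rel d `` {F})"
  then obtain \<alpha> \<beta> \<gamma> \<delta> G where G: "G \<in> proj_rel d `` {F}" "\<alpha> * \<delta> - \<beta> * \<gamma> \<noteq> 0"
    "y = proj_rel d `` {subst_form d \<alpha> \<beta> \<gamma> \<delta> G}" unfolding orbit_def by blast
  then obtain c where "c \<noteq> 0" "G = smult c F" using proj_class_eq[OF F] by auto
  then have "y = proj_rel d `` {subst_form d \<alpha> \<beta> \<gamma> \<delta> F}"
    using G(3) proj_class_eqI[OF subst_form_nonzero[OF F G(2)]] by (simp add: subst_form_smult)
  then show "y \<in> {proj_rel d `` {subst_form d \<alpha> \<beta> \<gamma> \<delta> F} | \<alpha> \<beta> \<gamma> \<delta>. \<alpha> * \<delta> - \<beta> * \<gamma> \<noteq> 0}"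
    using G(2) by blast
next
  fix y assume "y \<in> {proj_rel d `` {subst_form d \<alpha> \<beta> \<gamma> \<delta> F} | \<alpha> \<beta> \<gamma> \<delta>. \<alpha> * \<delta> - \<beta> * \<gamma> \<noteq> 0}"
  then show "y \<in> orbit d (proj_rel d `` {F})"
    unfolding orbit_def using proj_class_refl[OF F] by blast
qed

lemma orbit_subst_subset:
  assumes F: "F \<in> Sym d - {0}" and det: "\<alpha> * \<delta> - \<beta> * \<gamma> \<noteq> 0"
  shows "orbit d (proj_rel d `` {subst_form d \<alpha> \<beta> \<gamma> \<delta> F}) \<subseteq> orbit d (proj_rel d `` {F})"
proof
  fix y assume "y \<in> orbit d (proj_rel d `` {subst_form d \<alpha> \<beta> \<gamma> \<delta> F})"
  then obtain p q r s where y: "p * s - q * r \<noteq> 0" "y = proj_rel d `` {subst_form d p q r s (subst_form d \<alpha> \<beta> \<gamma> \<delta> F)}"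
    unfolding orbit_class[OF subst_form_nonzero[OF F det]] by blast
  have "(\<alpha> * p + \<beta> * r) * (\<gamma> * q + \<delta> * s) - (\<alpha> * q + \<beta> * s) * (\<gamma> * p + \<delta> * r) =
      (\<alpha> * \<delta> - \<beta> * \<gamma>) * (p * s - q * r)" by algebra
  then have "(\<alpha> * p + \<beta> * r) * (\<gamma> * q + \<delta> * s) - (\<alpha> * q + \<beta> * s) * (\<gamma> * p + \<delta> * r) \<noteq> 0"
    using det y(1) by simp
  moreover have "F \<in> Sym d" using F by blast
  ultimately show "y \<in> orbit d (proj_rel d `` {F})"
    unfolding orbit_class[OF F] y(2) subst_form_compose[OF \<open>F \<in> Sym d\<close> y(1)] by blast
qed

lemma orbit_subst:
  assumes F: "F \<in> Sym d - {0}" and det: "\<alpha> * \<delta> - \<beta> * \<gamma> \<noteq> 0"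
  shows "orbit d (proj_rel d `` {subst_form d \<alpha> \<beta> \<gamma> \<delta> F}) = orbit d (proj_rel d `` {F})"
proof -
  have "F \<in> Sym d" using F by blast
  from subst_form_inverse[OF this det] obtain \<alpha>' \<beta>' \<gamma>' \<delta>' where inv: "\<alpha>' * \<delta>' - \<beta>' * \<gamma>' \<noteq> 0"
    "subst_form d \<alpha>' \<beta>' \<gamma>' \<delta>' (subst_form d \<alpha> \<beta> \<gamma> \<delta> F) = F" by blast
  show ?thesis
    using orbit_subst_subset[OF F det] orbit_subst_subset[OF subst_form_nonzero[OF F det] inv(1)] inv(2) by simp
qed

section \<open>Invariance of stability under substitutions\<close>

lemma form_order_smult: "c \<noteq> 0 \<Longrightarrow> form_order d (smult c F) p = form_order d F p"
  by (cases p) (auto simp: order_smult)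

lemma stable_class_iff:
  assumes F: "F \<in> Sym d - {0}" and d: "d > 0"
  shows "proj_rel d `` {F} \<in> stable d \<longleftrightarrow> (\<forall>p. 2 * form_order d F p < d)"
proof -
  have r: "real n * (2 / real d) < 1 \<longleftrightarrow> 2 * n < d" for n
  proof -
    have "real n * (2 / real d) < 1 \<longleftrightarrow> 2 * real n < real d" using d by (simp add: field_simps)
    also have "\<dots> \<longleftrightarrow> real (2 * n) < real d" by simp
    also have "\<dots> \<longleftrightarrow> 2 * n < d" unfolding of_nat_less_iff ..
    finally show ?thesis .
  qed
  have "proj_rel d `` {F} \<in> proj_space d" using F proj_space_iff by blast
  then have "proj_rel d `` {F} \<in> stable d \<longleftrightarrow> (\<forall>G\<in>proj_rel d `` {F}. \<forall>p. 2 * form_order d G p < d)"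
    unfolding stable_def r by simp
  also have "\<dots> \<longleftrightarrow> (\<forall>p. 2 * form_order d F p < d)"
    unfolding proj_class_eq[OF F] using form_order_smult[of _ d F] zero_neq_one by (auto 4 4)
  finally show ?thesis .
qed

text \<open>A factor \<open>l ^ k\<close> with \<open>l\<close> a linear form is visibly preserved
  by substitutions, whereas \<open>form_order\<close> treats infinity separately.\<close>

lemma unstable_iff_factor:
  assumes F: "F \<in> Sym d - {0}"
  shows "(\<exists>p. d \<le> 2 * form_order d F p) \<longleftrightarrow>
    (\<exists>k l G. d \<le> 2 * k \<and> k \<le> d \<and> l \<in> Sym 1 \<and> G \<in> Sym (d - k) \<and> F = l ^ k * G)"
proof
  assume "\<exists>p. d \<le> 2 * form_order d F p"
  then obtain p where p: "d \<le> 2 * form_order d F p" by blast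
  show "\<exists>k l G. d \<le> 2 * k \<and> k \<le> d \<and> l \<in> Sym 1 \<and> G \<in> Sym (d - k) \<and> F = l ^ k * G"
  proof (cases p)
    case None
    \<comment> \<open>The constant 1, seen in \<open>Sym 1\<close>, is the form \<open>y\<close>,
      whose zero is infinity.\<close>
    then show ?thesis using p F
      by (intro exI[of _ "d - degree F"] exI[of _ 1] exI[of _ F]) (auto simp: Sym_def)
  next
    case (Some z)
    obtain G where G: "F = [:-z, 1:] ^ order z F * G" using order_1[of z F] by (rule dvdE)
    have "F \<noteq> 0" using F by simp
    then have "G \<noteq> 0" using G by (metis mult_zero_right)
    then have "degree ([:-z, 1:] ^ order z F * G) = order z F + degree G"
      by (subst degree_mult_eq) (auto simp: degree_linear_power)
    then have "degree F = order z F + degree G" by (simp flip: G)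
    moreover have "degree F \<le> d" using F by (simp add: Sym_def)
    ultimately show ?thesis using p Some G
      by (intro exI[of _ "order z F"] exI[of _ "[:-z, 1:]"] exI[of _ G]) (auto simp: Sym_def)
  qed
next
  assume "\<exists>k l G. d \<le> 2 * k \<and> k \<le> d \<and> l \<in> Sym 1 \<and> G \<in> Sym (d - k) \<and> F = l ^ k * G"
  then obtain k l G where k: "d \<le> 2 * k" "k \<le> d" "l \<in> Sym 1" "G \<in> Sym (d - k)" "F = l ^ k * G" by blast
  show "\<exists>p. d \<le> 2 * form_order d F p"
  proof (cases "degree l = 0")
    case True
    then obtain c where c: "l = [:c:]" using degree_eq_zeroE by blast
    then have "degree F \<le> degree G" using k(5) degree_mult_le[of "l ^ k" G] by (simp add: poly_const_pow)
    then have "d \<le> 2 * form_order d F None" using k by (simp add: Sym_def)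
    then show ?thesis by blast
  next
    case False
    then have "degree l > 0" by simp
    then have "\<not> constant (poly l)" by (simp add: constant_degree)
    then obtain z where "poly l z = 0" using fundamental_theorem_of_algebra by blast
    then have "[:-z, 1:] dvd l" by (simp add: poly_eq_0_iff_dvd)
    then have "[:-z, 1:] ^ k dvd F" unfolding k(5) by (intro dvd_mult2 dvd_power_same)
    then have "k \<le> order z F" using F order_divides by auto
    then have "d \<le> 2 * form_order d F (Some z)" using k by simp
    then show ?thesis by blast
  qed
qed

lemma stable_subst:
  assumes F: "F \<in> Sym d - {0}" and d: "d > 0" and det: "\<alpha> * \<delta> - \<beta> * \<gamma> \<noteq> 0"
    and st: "proj_rel d `` {F} \<in> stable d"
  shows "proj_rel d `` {subst_form d \<alpha> \<beta> \<gamma> \<delta> F} \<in> stable d"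
proof (rule ccontr)
  let ?F = "subst_form d \<alpha> \<beta> \<gamma> \<delta> F"
  have F': "?F \<in> Sym d - {0}" by (rule subst_form_nonzero[OF F det])
  assume "proj_rel d `` {?F} \<notin> stable d"
  then have "\<exists>p. d \<le> 2 * form_order d ?F p" using stable_class_iff[OF F' d] by (auto simp: not_less)
  then obtain k l G where k: "d \<le> 2 * k" "k \<le> d" "l \<in> Sym 1" "G \<in> Sym (d - k)" "?F = l ^ k * G"
    using unstable_iff_factor[OF F'] by blast
  have "F \<in> Sym d" using F by blast
  from subst_form_inverse[OF this det] obtain \<alpha>' \<beta>' \<gamma>' \<delta>' where inv: "\<alpha>' * \<delta>' - \<beta>' * \<gamma>' \<noteq> 0"
    "subst_form d \<alpha>' \<beta>' \<gamma>' \<delta>' ?F = F" by blast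
  have "l ^ k \<in> Sym k" using Sym_power[OF k(3), of k] by simp
  then have "F = subst_form k \<alpha>' \<beta>' \<gamma>' \<delta>' (l ^ k) * subst_form (d - k) \<alpha>' \<beta>' \<gamma>' \<delta>' G"
    using subst_form_mult[OF _ k(4) inv(1), of "l ^ k" k] inv(2) k(2,5) by simp
  also have "subst_form k \<alpha>' \<beta>' \<gamma>' \<delta>' (l ^ k) = subst_form 1 \<alpha>' \<beta>' \<gamma>' \<delta>' l ^ k"
    using subst_form_power[OF k(3) inv(1), of k] by simp
  finally have "\<exists>p. d \<le> 2 * form_order d F p"
    using unstable_iff_factor[OF F] k(1,2) subst_form_Sym by blast
  then show False using stable_class_iff[OF F d] st by (metis not_less)
qed

definition orbit_vecs :: "nat \<Rightarrow> complex poly \<Rightarrow> (nat \<Rightarrow> complex) set" where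
  "orbit_vecs d F = {coeff (subst_form d \<alpha> \<beta> \<gamma> \<delta> F) | \<alpha> \<beta> \<gamma> \<delta>. \<alpha> * \<delta> - \<beta> * \<gamma> \<noteq> 0}"

lemma polycurve_pCons2: "polyfun u \<Longrightarrow> polyfun v \<Longrightarrow> polycurve (\<lambda>s. [:u s, v s:])"
  unfolding polycurve_def
proof
  fix i assume "polyfun u" "polyfun v"
  then show "polyfun (\<lambda>s. coeff [:u s, v s:] i)"
  proof (cases i)
    case (Suc j)
    with \<open>polyfun v\<close> show ?thesis by (cases j) simp_all
  qed simp
qed

lemma polycurve_subst:
  assumes "polyfun p" "polyfun q" "polyfun r" "polyfun t"
  shows "polycurve (\<lambda>s. subst_form d (p s) (q s) (r s) (t s) F)"
  unfolding subst_form_def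
  by (intro polycurve_sum polycurve_smult polycurve_mult polycurve_power polycurve_pCons2 assms polyfun_const)

text \<open>All matrices form an affine space, connected by lines. The invertible ones are dense in
  it, because the determinant is not identically zero on a line that starts at the identity.\<close>

lemma prime_orbit_vecs: "prime_set n (orbit_vecs d F)"
proof -
  define S where "S = {coeff (subst_form d \<alpha> \<beta> \<gamma> \<delta> F) | \<alpha> \<beta> \<gamma> \<delta>. True}"
  have line: "polyfun (\<lambda>s. u + s * (v - u))" for u v
    by (intro polyfun_add polyfun_mult polyfun_const polyfun_id)
  have "curve_connected S" unfolding curve_connected_def
  proof (intro ballI)
    fix x y assume "x \<in> S" "y \<in> S"
    then obtain p q r t p' q' r' t' where xy: "x = coeff (subst_form d p q r t F)" "y = coeff (subst_form d p' q' r' t' F)"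
      unfolding S_def by blast
    let ?g = "\<lambda>s. coeff (subst_form d (p + s * (p' - p)) (q + s * (q' - q)) (r + s * (r' - r)) (t + s * (t' - t)) F)"
    show "\<exists>\<gamma>. curve \<gamma> \<and> \<gamma> 0 = x \<and> \<gamma> 1 = y \<and> (\<forall>s. \<gamma> s \<in> S)"
    proof (intro exI conjI allI)
      show "curve ?g" by (intro curve_polycurve polycurve_subst line)
      show "?g s \<in> S" for s unfolding S_def by blast
    qed (simp_all add: xy)
  qed
  then have "prime_set n S" by (rule prime_curve_connected)
  moreover have "curve_dense (orbit_vecs d F) S" unfolding curve_dense_def
  proof (intro conjI ballI)
    show "orbit_vecs d F \<subseteq> S" unfolding orbit_vecs_def S_def by blast
    fix x assume "x \<in> S"
    then obtain p q r t where x: "x = coeff (subst_form d p q r t F)" unfolding S_def by blast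
    let ?P = "\<lambda>s. 1 + s * (p - 1)" and ?Q = "\<lambda>s. 0 + s * (q - 0)" and ?R = "\<lambda>s. 0 + s * (r - 0)" and ?T = "\<lambda>s. 1 + s * (t - 1)"
    let ?g = "\<lambda>s. coeff (subst_form d (?P s) (?Q s) (?R s) (?T s) F)"
    let ?D = "\<lambda>s. ?P s * ?T s + (-1) * (?Q s * ?R s)"
    \<comment> \<open>The determinant is regarded as a curve with all coordinates equal, so that
      \<open>infinite_curve_nonzero\<close> applies.\<close>
    have "curve (\<lambda>s i. ?D s)" unfolding curve_def by (intro allI polyfun_add polyfun_mult polyfun_const line polyfun_id)
    then have "infinite {s. (\<lambda>i::nat. ?D s) \<noteq> (\<lambda>_. 0)}"
      by (rule infinite_curve_nonzero[of _ 0]) (auto simp: fun_eq_iff)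
    moreover have "{s. (\<lambda>i::nat. ?D s) \<noteq> (\<lambda>_. 0)} \<subseteq> {s. ?g s \<in> orbit_vecs d F}"
    proof
      fix s assume "s \<in> {s. (\<lambda>i::nat. ?D s) \<noteq> (\<lambda>_. 0)}"
      then have "?P s * ?T s - ?Q s * ?R s \<noteq> 0" by auto
      then show "s \<in> {s. ?g s \<in> orbit_vecs d F}" unfolding orbit_vecs_def by blast
    qed
    ultimately have "infinite {s. ?g s \<in> orbit_vecs d F}" by (rule infinite_super[rotated])
    moreover have "curve ?g" by (intro curve_polycurve polycurve_subst line)
    moreover have "?g 1 = x" by (simp add: x)
    ultimately show "\<exists>\<gamma>. curve \<gamma> \<and> \<gamma> 1 = x \<and> infinite {s. \<gamma> s \<in> orbit_vecs d F}" by blast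
  qed
  ultimately show ?thesis by (rule prime_dense[rotated])
qed

subsection \<open>The topology of the moduli space\<close>

definition orbit_preimage :: "nat \<Rightarrow> complex poly set set set \<Rightarrow> complex poly set set" where
  "orbit_preimage d U = {x \<in> stable d. orbit d x \<in> U}"

lemma stable_subset: "stable d \<subseteq> proj_space d"
  by (auto simp: stable_def)

lemma openin_DM:
  "openin (DM d) U \<longleftrightarrow> U \<subseteq> orbit d ` stable d \<and> openin (subtopology (zariski d) (stable d)) (orbit_preimage d U)"
  unfolding DM_def orbit_preimage_def using topology_inverse'[OF istopology_DM] by simp

lemma topspace_DM [simp]: "topspace (DM d) = orbit d ` stable d"
proof
  show "topspace (DM d) \<subseteq> orbit d ` stable d" using openin_DM[of d "topspace (DM d)"] by simp
  have "orbit_preimage d (orbit d ` stable d) = topspace (subtopology (zariski d) (stable d))"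
    using stable_subset by (auto simp: orbit_preimage_def)
  then have "openin (DM d) (orbit d ` stable d)" unfolding openin_DM by (metis openin_topspace order_refl)
  then show "orbit d ` stable d \<subseteq> topspace (DM d)" by (rule openin_subset)
qed

lemma closedin_DM:
  "closedin (DM d) C \<longleftrightarrow> C \<subseteq> orbit d ` stable d \<and> (\<exists>C'. closedin (zariski d) C' \<and> orbit_preimage d C = C' \<inter> stable d)"
proof -
  have "orbit_preimage d (orbit d ` stable d - C) = stable d - orbit_preimage d C" by (auto simp: orbit_preimage_def)
  moreover have "topspace (zariski d) \<inter> stable d = stable d" using stable_subset by auto
  ultimately have "closedin (DM d) C \<longleftrightarrow> C \<subseteq> orbit d ` stable d \<and> closedin (subtopology (zariski d) (stable d)) (orbit_preimage d C)"
    unfolding closedin_def openin_DM topspace_subtopology topspace_DM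
    by (auto simp: orbit_preimage_def)
  then show ?thesis by (simp add: closedin_subtopology)
qed

lemma closedin_DM_pre: "closedin (DM d) C \<Longrightarrow> \<exists>C'. closedin (zariski d) C' \<and> orbit_preimage d C = C' \<inter> stable d"
  and closedin_DM_subset: "closedin (DM d) C \<Longrightarrow> C \<subseteq> orbit d ` stable d"
  using closedin_DM[of d C] by simp_all

lemma orbit_preimage_subset: "orbit_preimage d C \<subseteq> stable d"
  by (auto simp: orbit_preimage_def)

text \<open>Vanishing is required on the whole orbit, so that an arbitrary form, invariant or not,
  yields a subset of the moduli space.\<close>

definition orbit_zeros :: "nat \<Rightarrow> ((nat \<Rightarrow> complex) \<Rightarrow> complex) \<Rightarrow> complex poly set set set" where
  "orbit_zeros d f = {u \<in> orbit d ` stable d. \<forall>y\<in>u. \<forall>F\<in>y. f (coeff F) = 0}"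

lemma homogeneous_subst:
  assumes "homogeneous_poly d k f"
  shows "homogeneous_poly d k (\<lambda>v. f (\<lambda>j. \<Sum>i\<le>d. v i * coeff ([:\<beta>, \<alpha>:] ^ i * [:\<delta>, \<gamma>:] ^ (d - i)) j))"
proof -
  have "wform {..d} (\<lambda>_. 1) 1 (\<lambda>v. \<Sum>i\<le>d. v i * coeff ([:\<beta>, \<alpha>:] ^ i * [:\<delta>, \<gamma>:] ^ (d - i)) j)" for j
  proof (rule wform_sum)
    fix i assume "i \<in> {..d}"
    then have "wform {..d} (\<lambda>_. 1) 1 (\<lambda>v. coeff ([:\<beta>, \<alpha>:] ^ i * [:\<delta>, \<gamma>:] ^ (d - i)) j * v i)"
      using wform_var[of "{..d}" "\<lambda>_. 1" i] by (intro wform_cmult) auto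
    then show "wform {..d} (\<lambda>_. 1) 1 (\<lambda>v. v i * coeff ([:\<beta>, \<alpha>:] ^ i * [:\<delta>, \<gamma>:] ^ (d - i)) j)"
      by (simp add: mult.commute)
  qed auto
  from wform_compose[OF _ _ _ assms[unfolded homogeneous_poly_iff_wform] this]
  show ?thesis by (simp add: homogeneous_poly_iff_wform)
qed

lemma coeff_subst_form:
  "coeff (subst_form d \<alpha> \<beta> \<gamma> \<delta> F) = (\<lambda>j. \<Sum>i\<le>d. coeff F i * coeff ([:\<beta>, \<alpha>:] ^ i * [:\<delta>, \<gamma>:] ^ (d - i)) j)"
  by (simp add: subst_form_def coeff_sum fun_eq_iff)

lemma vanish_orbit_iff:
  assumes "homogeneous_poly d k f" and F: "F \<in> Sym d - {0}"
  shows "(\<forall>y\<in>orbit d (proj_rel d `` {F}). \<forall>G\<in>y. f (coeff G) = 0) \<longleftrightarrow> (\<forall>v\<in>orbit_vecs d F. f v = 0)"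
proof -
  have "(\<forall>G\<in>proj_rel d `` {subst_form d \<alpha> \<beta> \<gamma> \<delta> F}. f (coeff G) = 0) \<longleftrightarrow>
      f (coeff (subst_form d \<alpha> \<beta> \<gamma> \<delta> F)) = 0" if "\<alpha> * \<delta> - \<beta> * \<gamma> \<noteq> 0" for \<alpha> \<beta> \<gamma> \<delta>
  proof -
    have F': "subst_form d \<alpha> \<beta> \<gamma> \<delta> F \<in> Sym d - {0}" by (rule subst_form_nonzero[OF F that])
    then have "proj_rel d `` {subst_form d \<alpha> \<beta> \<gamma> \<delta> F} \<in> proj_space d" using proj_space_iff by blast
    from vanish_class_iff(1)[OF this assms(1) proj_class_refl[OF F']] show ?thesis .
  qed
  note iff = this
  define P where "P y = (\<forall>G\<in>y. f (coeff G) = 0)" for y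
  define S where "S = subst_form d"
  define c where "c \<alpha> \<beta> \<gamma> \<delta> = proj_rel d `` {S \<alpha> \<beta> \<gamma> \<delta> F}" for \<alpha> \<beta> \<gamma> \<delta>
  have "P (c \<alpha> \<beta> \<gamma> \<delta>) \<longleftrightarrow> f (coeff (S \<alpha> \<beta> \<gamma> \<delta> F)) = 0" if "\<alpha> * \<delta> - \<beta> * \<gamma> \<noteq> 0" for \<alpha> \<beta> \<gamma> \<delta>
    using iff[OF that] unfolding P_def c_def S_def .
  then show ?thesis unfolding orbit_class[OF F] orbit_vecs_def P_def[symmetric] S_def[symmetric] c_def[symmetric]
    by blast
qed

lemma orbit_preimage_orbit_zeros:
  assumes "homogeneous_poly d k f" and F: "F \<in> Sym d - {0}" and st: "proj_rel d `` {F} \<in> stable d"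
  shows "proj_rel d `` {F} \<in> orbit_preimage d (orbit_zeros d f) \<longleftrightarrow> (\<forall>v\<in>orbit_vecs d F. f v = 0)"
  using st vanish_orbit_iff[OF assms(1,2)] by (auto simp: orbit_preimage_def orbit_zeros_def)

text \<open>The preimage in the stable locus is the intersection, over all invertible substitutions,
  of the zero sets of the transformed forms.\<close>

lemma closedin_orbit_zeros:
  assumes f: "homogeneous_poly d k f" shows "closedin (DM d) (orbit_zeros d f)"
proof -
  define h where "h = (\<lambda>(\<alpha>, \<beta>, \<gamma>, \<delta>) v. f (\<lambda>j. \<Sum>i\<le>d. v i * coeff ([:\<beta>, \<alpha>:] ^ i * [:\<delta>, \<gamma>:] ^ (d - i)) j))"
  define M where "M = {(\<alpha>, \<beta>, \<gamma>, \<delta>) | \<alpha> \<beta> \<gamma> \<delta> :: complex. \<alpha> * \<delta> - \<beta> * \<gamma> \<noteq> 0}"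
  have hom: "homogeneous_poly d k (h g)" for g
    using homogeneous_subst[OF f] by (cases g) (simp add: h_def)
  have hval: "h (\<alpha>, \<beta>, \<gamma>, \<delta>) (coeff F) = f (coeff (subst_form d \<alpha> \<beta> \<gamma> \<delta> F))" for \<alpha> \<beta> \<gamma> \<delta> F
    by (simp add: h_def coeff_subst_form)
  define C' where "C' = (\<Inter>g\<in>M. zeros d (h g))"
  have "(1, 0, 0, 1) \<in> M" by (auto simp: M_def)
  then have M: "M \<noteq> {}" by blast
  have "closedin (zariski d) C'" unfolding C'_def
    by (rule closedin_INT[OF M]) (rule closedin_zeros[OF hom])
  moreover have "orbit_preimage d (orbit_zeros d f) = C' \<inter> stable d"
  proof -
    have "x \<in> orbit_preimage d (orbit_zeros d f) \<longleftrightarrow> x \<in> C'" if x: "x \<in> stable d" for x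
    proof -
      have xp: "x \<in> proj_space d" using x stable_subset by blast
      then obtain F where F: "F \<in> Sym d - {0}" "x = proj_rel d `` {F}" using proj_space_iff by blast
      have "x \<in> C' \<longleftrightarrow> (\<forall>g\<in>M. h g (coeff F) = 0)"
        using vanish_class_iff(1)[OF xp hom, of F] proj_class_refl[OF F(1)] F(2) xp
        by (auto simp: C'_def zeros_def)
      also have "\<dots> \<longleftrightarrow> (\<forall>\<alpha> \<beta> \<gamma> \<delta>. \<alpha> * \<delta> - \<beta> * \<gamma> \<noteq> 0 \<longrightarrow> f (coeff (subst_form d \<alpha> \<beta> \<gamma> \<delta> F)) = 0)"
        by (auto simp: M_def hval)
      also have "\<dots> \<longleftrightarrow> (\<forall>v\<in>orbit_vecs d F. f v = 0)"
        unfolding orbit_vecs_def by blast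
      finally show ?thesis using orbit_preimage_orbit_zeros[OF f F(1)] x F(2) by blast
    qed
    then show ?thesis using orbit_preimage_subset by blast
  qed
  ultimately show ?thesis unfolding closedin_DM by (auto simp: orbit_zeros_def)
qed

lemma coeff_in_orbit_vecs: "F \<in> Sym d \<Longrightarrow> coeff F \<in> orbit_vecs d F"
  unfolding orbit_vecs_def mem_Collect_eq
  by (intro exI[of _ 1] exI[of _ 0]) (simp add: subst_form_id)

text \<open>If \<open>f g\<close> vanishes on the preimage, then on each orbit one factor vanishes,
  because orbits are prime. So the closed sets \<open>orbit_zeros d f\<close> and
  \<open>orbit_zeros d g\<close> cover \<open>W\<close>, and irreducibility picks one of
  them.\<close>

lemma prime_pre:
  assumes irr: "irreducible_in (DM d) W" and d: "d > 0"
  shows "prime_set d (affine_cone (orbit_preimage d W))"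
  unfolding prime_set_def
proof (intro allI impI)
  fix k l f g assume f: "homogeneous_poly d k f" and g: "homogeneous_poly d l g"
    and fg: "\<forall>x\<in>affine_cone (orbit_preimage d W). f x * g x = 0"
  have W: "W \<subseteq> orbit d ` stable d" using irr by (simp add: irreducible_in_def)
  have "W \<subseteq> orbit_zeros d f \<union> orbit_zeros d g"
  proof
    fix u assume u: "u \<in> W"
    then obtain x where x: "x \<in> stable d" "u = orbit d x" using W by blast
    then have "x \<in> proj_space d" using stable_subset by blast
    then obtain F where F: "F \<in> Sym d - {0}" "x = proj_rel d `` {F}" using proj_space_iff by blast
    have "orbit_vecs d F \<subseteq> affine_cone (orbit_preimage d W)"
    proof
      fix v assume "v \<in> orbit_vecs d F"
      then obtain \<alpha> \<beta> \<gamma> \<delta> where det: "\<alpha> * \<delta> - \<beta> * \<gamma> \<noteq> 0" and v: "v = coeff (subst_form d \<alpha> \<beta> \<gamma> \<delta> F)"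
        unfolding orbit_vecs_def by blast
      let ?y = "proj_rel d `` {subst_form d \<alpha> \<beta> \<gamma> \<delta> F}"
      have "?y \<in> stable d" using stable_subst[OF F(1) d det] x F(2) by blast
      moreover have "orbit d ?y = u" using orbit_subst[OF F(1) det] x F(2) by simp
      ultimately have "?y \<in> orbit_preimage d W" using u by (simp add: orbit_preimage_def)
      then show "v \<in> affine_cone (orbit_preimage d W)"
        using proj_class_refl[OF subst_form_nonzero[OF F(1) det]] v unfolding affine_cone_def by blast
    qed
    then have "\<forall>v\<in>orbit_vecs d F. f v * g v = 0" using fg by blast
    then have "(\<forall>v\<in>orbit_vecs d F. f v = 0) \<or> (\<forall>v\<in>orbit_vecs d F. g v = 0)"
      using prime_orbit_vecs[of d d F] f g unfolding prime_set_def by blast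
    then have "x \<in> orbit_preimage d (orbit_zeros d f) \<or> x \<in> orbit_preimage d (orbit_zeros d g)"
      using orbit_preimage_orbit_zeros[OF f F(1)] orbit_preimage_orbit_zeros[OF g F(1)] x F(2) by blast
    then show "u \<in> orbit_zeros d f \<union> orbit_zeros d g" using x(2) by (auto simp: orbit_preimage_def)
  qed
  then have or: "W \<subseteq> orbit_zeros d f \<or> W \<subseteq> orbit_zeros d g"
    using irr closedin_orbit_zeros[OF f] closedin_orbit_zeros[OF g] unfolding irreducible_in_def by blast
  have van: "\<forall>v\<in>affine_cone (orbit_preimage d W). h v = 0" if "W \<subseteq> orbit_zeros d h" "homogeneous_poly d m h" for h m
  proof
    fix v assume "v \<in> affine_cone (orbit_preimage d W)"
    then obtain x F where x: "x \<in> orbit_preimage d W" "F \<in> x" "v = coeff F" unfolding affine_cone_def by blast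
    then have xs: "x \<in> stable d" "orbit d x \<in> orbit_zeros d h" using that by (auto simp: orbit_preimage_def)
    then have F: "F \<in> Sym d - {0}" "x = proj_rel d `` {F}" using proj_space_mem[of x d F] stable_subset x(2) by blast+
    then have "\<forall>v\<in>orbit_vecs d F. h v = 0"
      using orbit_preimage_orbit_zeros[OF that(2) F(1)] xs by (auto simp: orbit_preimage_def)
    moreover have "coeff F \<in> orbit_vecs d F" using coeff_in_orbit_vecs F(1) by simp
    ultimately show "h v = 0" using x(3) by simp
  qed
  show "(\<forall>x\<in>affine_cone (orbit_preimage d W). f x = 0) \<or> (\<forall>x\<in>affine_cone (orbit_preimage d W). g x = 0)"
    using or van[OF _ f] van[OF _ g] by argo
qed

lemma irreducible_DM_I:
  assumes T: "T \<noteq> {}" "T \<subseteq> stable d" "prime_set d (affine_cone T)"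
  shows "irreducible_in (DM d) (orbit d ` T)"
  unfolding irreducible_in_def
proof (intro conjI allI impI)
  show "orbit d ` T \<noteq> {}" "orbit d ` T \<subseteq> topspace (DM d)" using T by auto
  fix C D assume CD: "closedin (DM d) C \<and> closedin (DM d) D \<and> orbit d ` T \<subseteq> C \<union> D"
  obtain C' where C': "closedin (zariski d) C'" "orbit_preimage d C = C' \<inter> stable d" using closedin_DM_pre CD by meson
  obtain D' where D': "closedin (zariski d) D'" "orbit_preimage d D = D' \<inter> stable d" using closedin_DM_pre CD by meson
  have TP: "T \<subseteq> orbit_preimage d C \<union> orbit_preimage d D" using CD T(2) by (auto simp: orbit_preimage_def)
  then have "T \<subseteq> C' \<union> D'" using C' D' by blast
  moreover have "irreducible_in (zariski d) T" using irreducible_zariskiI[OF T(1) _ T(3)] T(2) stable_subset by blast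
  ultimately have "T \<subseteq> C' \<or> T \<subseteq> D'" using C'(1) D'(1) unfolding irreducible_in_def by blast
  then have "T \<subseteq> orbit_preimage d C \<or> T \<subseteq> orbit_preimage d D" using C' D' T(2) by blast
  then show "orbit d ` T \<subseteq> C \<or> orbit d ` T \<subseteq> D" by (auto simp: orbit_preimage_def)
qed

lemma separate_pre:
  assumes "closedin (DM d) W" "W \<subset> V" "V \<subseteq> orbit d ` stable d"
  shows "\<exists>k f. homogeneous_poly d k f \<and> (\<forall>x\<in>affine_cone (orbit_preimage d W). f x = 0) \<and> (\<exists>x\<in>affine_cone (orbit_preimage d V). f x \<noteq> 0)"
proof -
  obtain C where C: "closedin (zariski d) C" "orbit_preimage d W = C \<inter> stable d" using closedin_DM_pre[OF assms(1)] by auto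
  obtain x where x: "x \<in> stable d" "orbit d x \<in> V" "orbit d x \<notin> W" using assms by blast
  then have "x \<notin> C" "x \<in> proj_space d" using C(2) stable_subset unfolding orbit_preimage_def by blast+
  from zariski_separate[OF C(1) this(2,1)] obtain k f where f: "homogeneous_poly d k f" "C \<subseteq> zeros d f" "\<forall>F\<in>x. f (coeff F) \<noteq> 0"
    by blast
  obtain F where "F \<in> x" using proj_space_nonempty[OF \<open>x \<in> proj_space d\<close>] by blast
  then have "\<exists>x\<in>affine_cone (orbit_preimage d V). f x \<noteq> 0" using f(3) x by (auto simp: affine_cone_def orbit_preimage_def)
  moreover have "\<forall>x\<in>affine_cone (orbit_preimage d W). f x = 0"
    using vanish_cone_iff[of "orbit_preimage d W" d f] f(2) C(2) orbit_preimage_subset stable_subset by blast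
  ultimately show ?thesis using f(1) by blast
qed

lemma closure_orbit_zeros:
  assumes "homogeneous_poly d k f" "T \<subseteq> stable d" "\<And>x F v. x \<in> T \<Longrightarrow> F \<in> x \<Longrightarrow> v \<in> orbit_vecs d F \<Longrightarrow> f v = 0"
  shows "DM d closure_of (orbit d ` T) \<subseteq> orbit_zeros d f"
proof (rule closure_of_minimal[OF _ closedin_orbit_zeros[OF assms(1)]])
  show "orbit d ` T \<subseteq> orbit_zeros d f"
  proof
    fix u assume "u \<in> orbit d ` T"
    then obtain x where x: "x \<in> T" "u = orbit d x" by blast
    then have xs: "x \<in> stable d" "x \<in> proj_space d" using assms(2) stable_subset by blast+
    then obtain F where F: "F \<in> x" using proj_space_nonempty by blast
    have F': "F \<in> Sym d - {0}" "x = proj_rel d `` {F}" using proj_space_mem[OF xs(2) F] by blast+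
    have "x \<in> orbit_preimage d (orbit_zeros d f)"
      using orbit_preimage_orbit_zeros[OF assms(1) F'(1)] assms(3)[OF x(1) F] F'(2) xs(1) by blast
    then show "u \<in> orbit_zeros d f" using x(2) by (auto simp: orbit_preimage_def)
  qed
qed

section \<open>Density of simple configurations and codimension in the moduli space\<close>

lemma simple_form_stable:
  assumes "simple_form d F" "d \<ge> 3" shows "proj_rel d `` {F} \<in> stable d"
proof -
  have "2 * form_order d F p < d" for p
  proof -
    have "form_order d F p \<le> 1" using assms(1) by (simp add: simple_form_def)
    then show ?thesis using assms(2) by linarith
  qed
  then show ?thesis using assms stable_class_iff[of F d] by (auto simp: simple_form_def)
qed

text \<open>On the line from a simple form \<open>F0\<close> to \<open>F\<close> the forms close to
  \<open>F0\<close> are simple, hence stable. Thus one simple form of degree \<open>d\<close> is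
  enough to make the moduli space irreducible.\<close>

lemma dense_stable_cone:
  assumes "simple_form d F0" "d \<ge> 3"
  shows "curve_dense (affine_cone (stable d)) (coeff ` Sym d)"
  unfolding curve_dense_def
proof (intro conjI ballI)
  show "affine_cone (stable d) \<subseteq> coeff ` Sym d"
    using stable_subset proj_space_mem(1) unfolding affine_cone_def by blast
  fix x assume "x \<in> coeff ` Sym d"
  then obtain F where F: "F \<in> Sym d" "x = coeff F" by blast
  have F0: "F0 \<in> Sym d" using assms by (simp add: simple_form_def)
  let ?P = "\<lambda>s. F0 + smult s (F - F0)"
  have "\<forall>\<^sub>F s in nhds 0. simple_form d (?P s)"
    by (rule simple_form_open) (use assms polycurve_line Sym_line[OF F0 F(1)] in auto)
  then have "infinite {s. simple_form d (?P s)}" by (rule eventually_nhds_infinite)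
  moreover have "{s. simple_form d (?P s)} \<subseteq> {s. coeff (?P s) \<in> affine_cone (stable d)}"
  proof
    fix s assume "s \<in> {s. simple_form d (?P s)}"
    then have s: "simple_form d (?P s)" by simp
    then have "?P s \<in> proj_rel d `` {?P s}" by (intro proj_class_refl) (simp add: simple_form_def)
    then show "s \<in> {s. coeff (?P s) \<in> affine_cone (stable d)}"
      using simple_form_stable[OF s assms(2)] unfolding affine_cone_def by blast
  qed
  ultimately have "infinite {s. coeff (?P s) \<in> affine_cone (stable d)}" by (rule infinite_super[rotated])
  moreover have "curve (\<lambda>s. coeff (?P s))" by (intro curve_polycurve polycurve_line)
  moreover have "coeff (?P 1) = x" using F by simp
  ultimately show "\<exists>\<gamma>. curve \<gamma> \<and> \<gamma> 1 = x \<and> infinite {s. \<gamma> s \<in> affine_cone (stable d)}" by blast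
qed

lemma curve_connected_Sym: "curve_connected (coeff ` Sym d)"
  unfolding curve_connected_def
proof (intro ballI)
  fix x y assume "x \<in> coeff ` Sym d" "y \<in> coeff ` Sym d"
  then obtain F G where FG: "F \<in> Sym d" "G \<in> Sym d" "x = coeff F" "y = coeff G" by blast
  show "\<exists>\<gamma>. curve \<gamma> \<and> \<gamma> 0 = x \<and> \<gamma> 1 = y \<and> (\<forall>s. \<gamma> s \<in> coeff ` Sym d)"
  proof (intro exI conjI allI)
    show "curve (\<lambda>s. coeff (F + smult s (G - F)))" by (intro curve_polycurve polycurve_line)
    show "coeff (F + smult s (G - F)) \<in> coeff ` Sym d" for s using Sym_line[OF FG(1,2)] by blast
  qed (simp_all add: FG)
qed

lemma irreducible_DM:
  assumes "simple_form d F0" "d \<ge> 3" shows "irreducible_in (DM d) (topspace (DM d))"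
proof -
  have "prime_set d (affine_cone (stable d))"
    by (rule prime_dense[OF dense_stable_cone[OF assms] prime_curve_connected[OF curve_connected_Sym]])
  moreover have "stable d \<noteq> {}" using simple_form_stable[OF assms] by blast
  ultimately show ?thesis using irreducible_DM_I[of "stable d" d] by simp
qed

lemma orbit_zeros_proper:
  assumes s: "simple_form d F0" "d \<ge> 3" and f: "homogeneous_poly d k f" and F: "F \<in> Sym d" "f (coeff F) \<noteq> 0"
  shows "\<not> topspace (DM d) \<subseteq> orbit_zeros d f"
proof
  assume sub: "topspace (DM d) \<subseteq> orbit_zeros d f"
  have "\<forall>v\<in>affine_cone (stable d). f v = 0"
  proof
    fix v assume "v \<in> affine_cone (stable d)"
    then obtain x G where x: "x \<in> stable d" "G \<in> x" "v = coeff G" unfolding affine_cone_def by blast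
    then have G: "G \<in> Sym d - {0}" "x = proj_rel d `` {G}" using proj_space_mem stable_subset by blast+
    have "x \<in> orbit_preimage d (orbit_zeros d f)" using sub x(1) by (auto simp: orbit_preimage_def)
    then have "\<forall>v\<in>orbit_vecs d G. f v = 0" using orbit_preimage_orbit_zeros[OF f G(1)] G(2) x(1) by blast
    moreover have "coeff G \<in> orbit_vecs d G" using coeff_in_orbit_vecs G(1) by simp
    ultimately show "f v = 0" using x(3) by simp
  qed
  then have "f (coeff F) = 0" using vanish_dense[OF dense_stable_cone[OF s] f] F(1) by blast
  then show False using F(2) by simp
qed

text \<open>Irreducible closed sets above the locus have preimages with prime cones, and proper
  inclusions stay proper among the preimages. The chain is therefore bounded by growth in the space
  of forms, where the codimension is the same.\<close>

lemma codim_DM_1: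
  assumes s: "simple_form d F0" "d \<ge> 3" and T: "T \<noteq> {}" "T \<subseteq> stable d" "prime_set d (affine_cone T)"
    and gr: "growth d (affine_cone T) (d - 1)"
    and f: "homogeneous_poly d k f" "\<And>x F v. x \<in> T \<Longrightarrow> F \<in> x \<Longrightarrow> v \<in> orbit_vecs d F \<Longrightarrow> f v = 0"
      "\<exists>F\<in>Sym d. f (coeff F) \<noteq> 0"
  shows "codim_in (DM d) (DM d closure_of (orbit d ` T)) = 1"
proof (rule codim_in_eq_1[OF irreducible_DM[OF s]])
  let ?Z = "DM d closure_of (orbit d ` T)"
  show "closedin (DM d) ?Z" by simp
  show "irreducible_in (DM d) ?Z" by (rule irreducible_closure[OF irreducible_DM_I[OF T]])
  show "?Z \<subseteq> ?Z" by simp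
  have "?Z \<subseteq> orbit_zeros d f" by (rule closure_orbit_zeros[OF f(1) T(2)]) (rule f(2))
  then show "\<not> topspace (DM d) \<subseteq> ?Z" using orbit_zeros_proper[OF s f(1)] f(3) by blast
  have "orbit d ` T \<subseteq> ?Z" by (rule closure_of_subset) (use T(2) in auto)
  then have TZ: "T \<subseteq> orbit_preimage d ?Z" using T(2) by (auto simp: orbit_preimage_def)
  fix W V assume W: "closedin (DM d) W" "irreducible_in (DM d) W"
    and V: "closedin (DM d) V" "irreducible_in (DM d) V" and sub: "?Z \<subset> W" "W \<subset> V"
  have top: "W \<subseteq> orbit d ` stable d" "V \<subseteq> orbit d ` stable d" using W V closedin_DM_subset by auto
  obtain k' f' where f': "homogeneous_poly d k' f'" "\<forall>x\<in>affine_cone (orbit_preimage d ?Z). f' x = 0" "\<exists>x\<in>affine_cone (orbit_preimage d W). f' x \<noteq> 0"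
    using separate_pre[of d ?Z W] sub top by auto
  obtain l g where g: "homogeneous_poly d l g" "\<forall>x\<in>affine_cone (orbit_preimage d W). g x = 0" "\<exists>x\<in>affine_cone (orbit_preimage d V). g x \<noteq> 0"
    using separate_pre[OF W(1) sub(2) top(2)] by blast
  have d: "d > 0" using s by simp
  have sub': "orbit_preimage d ?Z \<subseteq> orbit_preimage d W" "orbit_preimage d W \<subseteq> orbit_preimage d V" using sub by (auto simp: orbit_preimage_def)
  have TZ': "affine_cone T \<subseteq> affine_cone (orbit_preimage d ?Z)" by (rule affine_cone_mono[OF TZ])
  have 1: "affine_cone T \<subseteq> affine_cone (orbit_preimage d W)" using TZ' affine_cone_mono[OF sub'(1)] by blast
  have 2: "\<forall>x\<in>affine_cone T. f' x = 0" using f'(2) TZ' by blast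
  have 3: "affine_cone T \<noteq> {}" using affine_cone_nonempty[OF T(1)] T(2) stable_subset by blast
  show False
    by (rule no_long_chain[OF gr d 1 affine_cone_mono[OF sub'(2)] prime_pre[OF W(2) d] prime_pre[OF V(2) d] 3
          f'(1) 2 f'(3) g])
qed

text \<open>\<open>T'\<close> supplies the intermediate set: \<open>f\<close> shows that its closure
  is proper, and \<open>g\<close> separates it from the closure for \<open>T\<close>.\<close>

lemma codim_DM_ge_2:
  assumes s: "simple_form d F0" "d \<ge> 3" and T': "T' \<noteq> {}" "T' \<subseteq> stable d" "prime_set d (affine_cone T')"
    and TT: "T \<subseteq> T'"
    and f: "homogeneous_poly d k f" "\<And>x F v. x \<in> T' \<Longrightarrow> F \<in> x \<Longrightarrow> v \<in> orbit_vecs d F \<Longrightarrow> f v = 0"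
      "\<exists>F\<in>Sym d. f (coeff F) \<noteq> 0"
    and g: "homogeneous_poly d l g" "\<And>x F v. x \<in> T \<Longrightarrow> F \<in> x \<Longrightarrow> v \<in> orbit_vecs d F \<Longrightarrow> g v = 0"
      "\<exists>v\<in>affine_cone T'. g v \<noteq> 0"
  shows "codim_in (DM d) (DM d closure_of (orbit d ` T)) \<ge> 2"
proof (rule codim_in_ge_2[OF irreducible_DM[OF s]])
  let ?Z = "DM d closure_of (orbit d ` T)" and ?W = "DM d closure_of (orbit d ` T')"
  show "closedin (DM d) ?W" by simp
  show "irreducible_in (DM d) ?W" by (rule irreducible_closure[OF irreducible_DM_I[OF T']])
  have "?W \<subseteq> orbit_zeros d f" by (rule closure_orbit_zeros[OF f(1) T'(2)]) (rule f(2))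
  then show "?W \<noteq> topspace (DM d)" using orbit_zeros_proper[OF s f(1)] f(3) by blast
  have sub: "?Z \<subseteq> ?W" by (rule closure_of_mono) (use TT in blast)
  obtain v where v: "v \<in> affine_cone T'" "g v \<noteq> 0" using g(3) by blast
  then obtain x F where x: "x \<in> T'" "F \<in> x" "v = coeff F" unfolding affine_cone_def by blast
  have xs: "x \<in> stable d" "x \<in> proj_space d" using x(1) T'(2) stable_subset by blast+
  have F: "F \<in> Sym d - {0}" "x = proj_rel d `` {F}" using proj_space_mem[OF xs(2) x(2)] by blast+
  have "T \<subseteq> stable d" using TT T'(2) by blast
  then have Zg: "?Z \<subseteq> orbit_zeros d g" by (rule closure_orbit_zeros[OF g(1)]) (rule g(2))
  have "coeff F \<in> orbit_vecs d F" using coeff_in_orbit_vecs F(1) by simp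
  then have "\<not> (\<forall>v\<in>orbit_vecs d F. g v = 0)" using v(2) x(3) by blast
  then have "x \<notin> orbit_preimage d (orbit_zeros d g)" using orbit_preimage_orbit_zeros[OF g(1) F(1)] F(2) xs(1) by simp
  then have "orbit d x \<notin> ?Z" using Zg xs(1) by (auto simp: orbit_preimage_def)
  moreover have "orbit d ` T' \<subseteq> ?W" by (rule closure_of_subset) (use T'(2) in auto)
  ultimately show "?Z \<subset> ?W" using sub x(1) by blast
qed

subsection \<open>Loci of poles of maps with property G\<close>

lemma degree_map_forms:
  assumes "degree_map d P Q"
  shows "d > 0" "P \<in> Sym d - {0}" "Q \<in> Sym d - {0}" "P - Q \<in> Sym d - {0}"
    "\<not> (vanishes_at d P p \<and> vanishes_at d Q p)"
proof -
  have d: "d > 0" "coprime P Q" "max (degree P) (degree Q) = d" using assms by (auto simp: degree_map_def)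
  show "d > 0" by fact
  have S: "P \<in> Sym d" "Q \<in> Sym d" using d(3) by (auto simp: Sym_def)
  have unit: "degree c = 0" if "is_unit c" for c :: "complex poly"
  proof -
    have "c \<noteq> 0" using that by auto
    then show ?thesis using that is_unit_iff_degree by blast
  qed
  have "P \<noteq> 0"
  proof
    assume "P = 0"
    then have "is_unit Q" using d(2) by simp
    then show False using d(1,3) \<open>P = 0\<close> unit[of Q] by simp
  qed
  then show "P \<in> Sym d - {0}" using S by simp
  have "Q \<noteq> 0"
  proof
    assume "Q = 0"
    then have "is_unit P" using d(2) by simp
    then show False using d(1,3) \<open>Q = 0\<close> unit[of P] by simp
  qed
  then show "Q \<in> Sym d - {0}" using S by simp
  have "P \<noteq> Q"
  proof
    assume "P = Q"
    then have "is_unit P" using d(2) by simp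
    then show False using d(1,3) \<open>P = Q\<close> unit[of P] by simp
  qed
  then show "P - Q \<in> Sym d - {0}" using S by (simp add: Sym_def degree_diff_le)
  show "\<not> (vanishes_at d P p \<and> vanishes_at d Q p)"
  proof (cases p)
    case None
    have "degree P = d \<or> degree Q = d" using d(3) by linarith
    then have "coeff P d \<noteq> 0 \<or> coeff Q d \<noteq> 0" using \<open>P \<noteq> 0\<close> \<open>Q \<noteq> 0\<close> by auto
    then show ?thesis using None by simp
  next
    case (Some z)
    have "\<not> is_unit [:-z, 1:]" by (simp add: is_unit_pCons_iff)
    then have "\<not> ([:-z, 1:] dvd P \<and> [:-z, 1:] dvd Q)" using d(2) coprime_common_divisor by blast
    then show ?thesis using Some by (simp add: poly_eq_0_iff_dvd)
  qed
qed

lemma rat_map_None_iff: "rat_map d P Q p = None \<longleftrightarrow> vanishes_at d Q p"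
  by (cases p) auto

lemma rat_map_0_iff:
  assumes "degree_map d P Q" shows "rat_map d P Q p = Some 0 \<longleftrightarrow> vanishes_at d P p"
  using degree_map_forms(5)[OF assms, of p] by (cases p) auto

lemma rat_map_1_iff:
  assumes "degree_map d P Q" shows "rat_map d P Q p = Some 1 \<longleftrightarrow> vanishes_at d (P - Q) p"
  using degree_map_forms(5)[OF assms, of p] by (cases p) auto

text \<open>The fibres over 0, 1 and infinity are the divisors of \<open>P\<close>,
  \<open>P - Q\<close> and \<open>Q\<close>, so the property becomes a condition on the zeros of
  three forms.\<close>

lemma property_G_iff:
  "property_G d P Q r \<longleftrightarrow> degree_map d P Q \<and>
    (\<forall>p. (vanishes_at d P p \<longrightarrow> form_order d P p = r (Some 0)) \<and>
         (vanishes_at d (P - Q) p \<longrightarrow> form_order d (P - Q) p = r (Some 1)) \<and>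
         (vanishes_at d Q p \<longrightarrow> form_order d Q p = r None))"
proof (cases "degree_map d P Q")
  case True
  have "(rat_map d P Q p \<in> branch_pts \<longrightarrow> ram_index d P Q p = r (rat_map d P Q p)) \<longleftrightarrow>
    (rat_map d P Q p = Some 0 \<longrightarrow> form_order d P p = r (Some 0)) \<and>
    (rat_map d P Q p = Some 1 \<longrightarrow> form_order d (P - Q) p = r (Some 1)) \<and>
    (rat_map d P Q p = None \<longrightarrow> form_order d Q p = r None)" for p
    by (auto simp: branch_pts_def ram_index_def)
  then show ?thesis unfolding property_G_def rat_map_0_iff[OF True] rat_map_1_iff[OF True] rat_map_None_iff
    using True by simp
qed (simp add: property_G_def)

lemma exists_zero: "F \<in> Sym d - {0} \<Longrightarrow> d > 0 \<Longrightarrow> \<exists>p. vanishes_at d F p"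
  using sum_form_order(2)[of F d] by (metis (no_types, lifting) empty_Collect_eq neq0_conv sum.empty)

lemma minus_power_exists:
  assumes "b > 0" shows "\<exists>\<zeta>::complex. \<forall>B. (smult \<zeta> B) ^ b = - (B ^ b)"
proof -
  obtain \<zeta> :: complex where "\<zeta> ^ b = -1" using complex_nth_root_exists[OF assms] by blast
  then have "(smult \<zeta> B) ^ b = - (B ^ b)" for B by (simp add: smult_power)
  then show ?thesis by blast
qed

text \<open>All zeros of \<open>P\<close> have order \<open>a\<close> and all zeros of
  \<open>P - Q\<close> have order \<open>b\<close>, so both are pure powers; a \<open>b\<close>-th
  root of -1 absorbs the sign in \<open>Q = P - (P - Q)\<close>.\<close>

lemma property_G_powersum:
  assumes G: "property_G N P Q r" and r: "r (Some 0) = a" "r (Some 1) = b"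
    and ab: "a > 0" "b > 0" and N: "N = a * d1" "N = b * d2"
  shows "coeff Q \<in> powersum_vecs a b d1 d2"
proof -
  have dm: "degree_map N P Q" using G by (simp add: property_G_def)
  note forms = degree_map_forms[OF dm]
  obtain A where A: "A \<in> Sym d1" "P = A ^ a"
    using form_is_power[OF forms(2) ab(1) N(1)] G r unfolding property_G_iff by blast
  obtain B where B: "B \<in> Sym d2" "P - Q = B ^ b"
    using form_is_power[OF forms(4) ab(2) N(2)] G r unfolding property_G_iff by blast
  obtain \<zeta> where "(smult \<zeta> B) ^ b = - (B ^ b)" using minus_power_exists[OF ab(2)] by blast
  then have "Q = A ^ a + (smult \<zeta> B) ^ b" using A(2) B(2) by (simp add: algebra_simps)
  then show ?thesis using A(1) Sym_smult[OF B(1)] unfolding powersum_vecs_def by blast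
qed

text \<open>As \<open>a\<close> and \<open>b\<close> are at least 2, a common zero of
  \<open>A\<close> and \<open>B\<close> would be a multiple zero of \<open>A^a + B^b\<close>.
  Simplicity of the sum thus yields coprimality and, applied at infinity, the right degree.\<close>

lemma powersum_property_G:
  assumes A: "simple_form d1 A" and B: "simple_form d2 B" and Q: "simple_form N (A ^ a + B ^ b)"
    and ab: "a \<ge> 2" "b \<ge> 2" and N: "N = a * d1" "N = b * d2" "N > 0"
    and r: "r (Some 0) = a" "r (Some 1) = b" "r None = 1"
  shows "property_G N (A ^ a) (A ^ a + B ^ b) r"
proof -
  let ?P = "A ^ a" and ?Q = "A ^ a + B ^ b"
  have A0: "A \<in> Sym d1" "A \<noteq> 0" "\<And>p. form_order d1 A p \<le> 1" using A by (auto simp: simple_form_def)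
  have B0: "B \<in> Sym d2" "B \<noteq> 0" "\<And>p. form_order d2 B p \<le> 1" using B by (auto simp: simple_form_def)
  have Q0: "?Q \<in> Sym N" "?Q \<noteq> 0" "\<And>p. form_order N ?Q p \<le> 1" using Q by (auto simp: simple_form_def)
  have ord_pow: "form_order N (F ^ n) p = n" if F: "F \<in> Sym e" "F \<noteq> 0" "form_order e F p \<le> 1" "N = n * e" "vanishes_at N (F ^ n) p"
    for F :: "complex poly" and n e p
  proof -
    have "F ^ n \<in> Sym N - {0}" using Sym_power[OF F(1), of n] F(2,4) by simp
    then have "form_order N (F ^ n) p > 0" using form_order_pos_iff F(5) by blast
    moreover have "form_order N (F ^ n) p = n * form_order e F p" using form_order_power[OF F(2)] F(4) by simp
    ultimately show ?thesis using F(3) by (cases "form_order e F p") auto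
  qed
  have nocommon: "\<not> (poly A z = 0 \<and> poly B z = 0)" for z
  proof
    assume z: "poly A z = 0 \<and> poly B z = 0"
    have "poly ?Q z = 0" using z ab by (simp add: zero_power)
    moreover have "poly (pderiv ?Q) z = 0" using z ab by (simp add: pderiv_add pderiv_power zero_power)
    ultimately have "order z ?Q \<ge> 2" using order_ge_2_iff[OF Q0(2)] by blast
    then show False using Q0(3)[of "Some z"] by simp
  qed
  have "coprime ?P ?Q"
  proof (rule ccontr)
    assume "\<not> coprime ?P ?Q"
    then obtain c where c: "c dvd ?P" "c dvd ?Q" "\<not> is_unit c" by (rule not_coprimeE)
    then have "c \<noteq> 0" using Q0(2) by auto
    then have "degree c > 0" using c(3) by (simp add: is_unit_iff_degree)
    then have "\<not> constant (poly c)" by (simp add: constant_degree)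
    then obtain z where z: "poly c z = 0" using fundamental_theorem_of_algebra by blast
    have "poly ?P z = 0" "poly ?Q z = 0" using c(1,2) z by (auto elim!: dvdE simp del: poly_power poly_add)
    then show False using nocommon[of z] ab by (auto simp: power_eq_0_iff zero_power)
  qed
  moreover have "max (degree ?P) (degree ?Q) = N"
  proof -
    have "?P \<in> Sym N" using Sym_power[OF A0(1), of a] N(1) by simp
    then have le: "degree ?P \<le> N" "degree ?Q \<le> N" using Q0(1) by (auto simp: Sym_def)
    have "\<not> (degree ?P < N \<and> degree ?Q < N)"
    proof
      assume lt: "degree ?P < N \<and> degree ?Q < N"
      have "B ^ b = ?Q - ?P" by simp
      then have "degree (B ^ b) < N" using lt by (metis degree_diff_less)
      then have "degree B < d2" using N(2) B0(2) by (simp add: degree_power_eq)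
      then obtain e2 where e2: "d2 = Suc e2" "degree B \<le> e2" by (cases d2) auto
      have "degree A < d1" using lt N(1) A0(2) by (simp add: degree_power_eq)
      then obtain e1 where e1: "d1 = Suc e1" "degree A \<le> e1" by (cases d1) auto
      \<comment> \<open>Here \<open>A\<close> and \<open>B\<close> both vanish at infinity, so the
        sum vanishes there to order at least 2.\<close>
      have "degree ?P + a \<le> N" using e1 N(1) A0(2) by (simp add: degree_power_eq)
      moreover have "degree (B ^ b) + b \<le> N" using e2 N(2) B0(2) by (simp add: degree_power_eq)
      ultimately have "degree ?Q \<le> N - 2" using ab by (intro degree_add_le) linarith+
      moreover have "N \<ge> 2" using ab N by (cases d1) auto
      ultimately show False using Q0(3)[of None] by simp
    qed
    then show ?thesis using le by linarith
  qed
  ultimately have dm: "degree_map N ?P ?Q" using N(3) by (simp add: degree_map_def)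
  show ?thesis unfolding property_G_iff
  proof (intro conjI dm allI impI)
    fix p
    show "form_order N ?P p = r (Some 0)" if "vanishes_at N ?P p"
      using ord_pow[OF A0(1,2,3) N(1) that] r by simp
    show "form_order N (?P - ?Q) p = r (Some 1)" if "vanishes_at N (?P - ?Q) p"
      using ord_pow[OF B0(1,2,3) N(2)] that r vanishes_at_uminus[of N "B ^ b"] form_order_uminus[of N "B ^ b"] by simp
    show "form_order N ?Q p = r None" if "vanishes_at N ?Q p"
    proof -
      have "form_order N ?Q p > 0" using form_order_pos_iff[of ?Q N p] that Q0 by blast
      then show ?thesis using Q0(3)[of p] r by linarith
    qed
  qed
qed

definition pole_classes :: "nat \<Rightarrow> (P1 \<Rightarrow> nat) \<Rightarrow> complex poly set set" where
  "pole_classes d r = {proj_rel d `` {Q} | P Q. property_G d P Q r}"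

lemma property_G_simple:
  assumes "property_G d P Q r" "r None = 1" shows "simple_form d Q"
proof -
  have dm: "degree_map d P Q" using assms by (simp add: property_G_def)
  have Q: "Q \<in> Sym d - {0}" by (rule degree_map_forms(3)[OF dm])
  have "form_order d Q p \<le> 1" for p
    using assms form_order_pos_iff[OF Q, of p] unfolding property_G_iff by (cases "vanishes_at d Q p") auto
  then show ?thesis using Q by (simp add: simple_form_def)
qed

lemma pole_classes_stable:
  assumes "r None = 1" "d \<ge> 3" shows "pole_classes d r \<subseteq> stable d"
  using property_G_simple[where r = r, OF _ assms(1)] simple_form_stable[OF _ assms(2)] unfolding pole_classes_def by blast

lemma S_locus_eq:
  assumes "r None = 1" "d \<ge> 3" shows "S_locus d r = orbit d ` pole_classes d r"
proof -
  have "S_locus d r = orbit d ` pole_classes d r \<inter> topspace (DM d)"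
    unfolding S_locus_def pole_classes_def by blast
  then show ?thesis using pole_classes_stable[where r = r, OF assms] by auto
qed

text \<open>Substitution commutes with sums and powers, so a form that vanishes on all sums of
  powers vanishes on their whole orbits.\<close>

lemma orbit_vecs_powersum:
  assumes N: "N = a * d1" "N = b * d2" and F: "coeff F \<in> powersum_vecs a b d1 d2" and v: "v \<in> orbit_vecs N F"
  shows "v \<in> powersum_vecs a b d1 d2"
proof -
  obtain A B where AB: "A \<in> Sym d1" "B \<in> Sym d2" "F = A ^ a + B ^ b"
    using F unfolding powersum_vecs_def by (auto simp: coeff_inject)
  obtain \<alpha> \<beta> \<gamma> \<delta> where det: "\<alpha> * \<delta> - \<beta> * \<gamma> \<noteq> 0" and v': "v = coeff (subst_form N \<alpha> \<beta> \<gamma> \<delta> F)"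
    using v unfolding orbit_vecs_def by blast
  have "subst_form N \<alpha> \<beta> \<gamma> \<delta> F = subst_form d1 \<alpha> \<beta> \<gamma> \<delta> A ^ a + subst_form d2 \<alpha> \<beta> \<gamma> \<delta> B ^ b"
    using subst_form_power[OF AB(1) det, of a] subst_form_power[OF AB(2) det, of b]
    by (simp add: AB(3) subst_form_add flip: N)
  then show ?thesis unfolding v' powersum_vecs_def mem_Collect_eq
    by (intro exI[of _ "subst_form d1 \<alpha> \<beta> \<gamma> \<delta> A"] exI[of _ "subst_form d2 \<alpha> \<beta> \<gamma> \<delta> B"]) (simp add: subst_form_Sym)
qed

lemma class_in_powersum:
  assumes ab: "a > 0" "b > 0" and F: "F \<in> Sym N - {0}" "coeff F \<in> powersum_vecs a b d1 d2" and G: "G \<in> proj_rel N `` {F}"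
  shows "coeff G \<in> powersum_vecs a b d1 d2"
proof -
  obtain A B where AB: "A \<in> Sym d1" "B \<in> Sym d2" "F = A ^ a + B ^ b"
    using F unfolding powersum_vecs_def by (auto simp: coeff_inject)
  obtain c where "G = smult c F" using G proj_class_eq[OF F(1)] by auto
  then show ?thesis using powersum_scale[OF ab AB(1,2), of c] AB(3) by simp
qed

lemma pole_class_mem:
  assumes "x \<in> pole_classes N r" "G \<in> x" and r: "r (Some 0) = a" "r (Some 1) = b"
    and ab: "a > 0" "b > 0" and N: "N = a * d1" "N = b * d2"
  shows "coeff G \<in> powersum_vecs a b d1 d2"
proof -
  obtain P Q where PQ: "property_G N P Q r" "x = proj_rel N `` {Q}" using assms(1) unfolding pole_classes_def by blast
  then have "degree_map N P Q" by (simp add: property_G_def)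
  from degree_map_forms(3)[OF this] have Q: "Q \<in> Sym N - {0}" .
  show ?thesis by (rule class_in_powersum[OF ab Q property_G_powersum[OF PQ(1) r ab N]]) (use assms(2) PQ(2) in simp)
qed

text \<open>Simplicity is an open condition, so a generic point of a line through a simple
  configuration is again simple.\<close>

lemma curve_dense_powersumI:
  assumes S: "A \<in> Sym d1" "B \<in> Sym d2" and sub: "E \<subseteq> powersum_vecs a b d1 d2"
    and ev: "\<And>A' B'. A' \<in> Sym d1 \<Longrightarrow> B' \<in> Sym d2 \<Longrightarrow>
      \<forall>\<^sub>F s in nhds 0. coeff ((A + smult s (A' - A)) ^ a + (B + smult s (B' - B)) ^ b) \<in> E"
  shows "curve_dense E (powersum_vecs a b d1 d2)"
  unfolding curve_dense_def
proof (intro conjI ballI sub)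
  fix x assume "x \<in> powersum_vecs a b d1 d2"
  then obtain A' B' where AB: "A' \<in> Sym d1" "B' \<in> Sym d2" "x = coeff (A' ^ a + B' ^ b)"
    unfolding powersum_vecs_def by blast
  let ?g = "\<lambda>s. coeff ((A + smult s (A' - A)) ^ a + (B + smult s (B' - B)) ^ b)"
  have "infinite {s. ?g s \<in> E}" by (rule eventually_nhds_infinite[OF ev[OF AB(1,2)]])
  moreover have "curve ?g" by (rule curve_powersum_line)
  moreover have "?g 1 = x" using AB(3) by simp
  ultimately show "\<exists>\<gamma>. curve \<gamma> \<and> \<gamma> 1 = x \<and> infinite {s. \<gamma> s \<in> E}" by (intro exI[of _ ?g]) blast
qed

lemma eventually_simple_powersum:
  assumes "simple_form N (A ^ a + B ^ b)" and S: "A \<in> Sym d1" "B \<in> Sym d2" "A' \<in> Sym d1" "B' \<in> Sym d2"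
    and ab: "a > 0" "b > 0" and N: "N = a * d1" "N = b * d2" "N > 0"
  shows "\<forall>\<^sub>F s in nhds 0. simple_form N ((A + smult s (A' - A)) ^ a + (B + smult s (B' - B)) ^ b)"
proof (rule simple_form_open[OF N(3)])
  show "polycurve (\<lambda>s. (A + smult s (A' - A)) ^ a + (B + smult s (B' - B)) ^ b)"
    by (intro polycurve_add[OF polycurve_power polycurve_power] polycurve_line)
  show "(A + smult s (A' - A)) ^ a + (B + smult s (B' - B)) ^ b \<in> Sym N" for s
    by (rule powersum_Sym[OF ab N(1,2) Sym_line[OF S(1,3)] Sym_line[OF S(2,4)]])
qed (use assms(1) in simp)

lemma coeff_in_cone: "simple_form N F \<Longrightarrow> proj_rel N `` {F} \<in> T \<Longrightarrow> coeff F \<in> affine_cone T"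
  using proj_class_refl[of F N] unfolding affine_cone_def simple_form_def by blast

text \<open>The three simplicity conditions are open, so a single example \<open>A\<close>,
  \<open>B\<close> makes the forms of poles dense among all sums of powers. This is why one explicit
  example is constructed for each of the five triples.\<close>

lemma dense_pole_classes:
  assumes A: "simple_form d1 A" and B: "simple_form d2 B" and Q: "simple_form N (A ^ a + B ^ b)"
    and ab: "a \<ge> 2" "b \<ge> 2" and N: "N = a * d1" "N = b * d2" and d: "d1 > 0" "d2 > 0"
    and r: "r (Some 0) = a" "r (Some 1) = b" "r None = 1"
  shows "curve_dense (affine_cone (pole_classes N r)) (powersum_vecs a b d1 d2)"
proof (rule curve_dense_powersumI)
  have ab': "a > 0" "b > 0" using ab by auto
  have N0: "N > 0" using N(1) d ab' by simp
  show S: "A \<in> Sym d1" "B \<in> Sym d2" using A B by (auto simp: simple_form_def)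
  show "affine_cone (pole_classes N r) \<subseteq> powersum_vecs a b d1 d2"
    using pole_class_mem[OF _ _ r(1,2) ab' N] unfolding affine_cone_def by blast
  fix A' B' assume AB: "A' \<in> Sym d1" "B' \<in> Sym d2"
  let ?A = "\<lambda>s. A + smult s (A' - A)" and ?B = "\<lambda>s. B + smult s (B' - B)"
  have "\<forall>\<^sub>F s in nhds 0. simple_form d1 (?A s)"
    by (rule simple_form_open[OF d(1) polycurve_line]) (use A Sym_line[OF S(1) AB(1)] in auto)
  moreover have "\<forall>\<^sub>F s in nhds 0. simple_form d2 (?B s)"
    by (rule simple_form_open[OF d(2) polycurve_line]) (use B Sym_line[OF S(2) AB(2)] in auto)
  moreover have "\<forall>\<^sub>F s in nhds 0. simple_form N (?A s ^ a + ?B s ^ b)"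
    by (rule eventually_simple_powersum[OF Q S AB ab' N N0])
  ultimately show "\<forall>\<^sub>F s in nhds 0. coeff (?A s ^ a + ?B s ^ b) \<in> affine_cone (pole_classes N r)"
  proof eventually_elim
    case (elim s)
    then have "proj_rel N `` {?A s ^ a + ?B s ^ b} \<in> pole_classes N r"
      using powersum_property_G[OF elim ab N N0 r] unfolding pole_classes_def by blast
    then show ?case by (rule coeff_in_cone[OF elim(3)])
  qed
qed

lemma codim_S_locus_1:
  assumes A: "simple_form d1 A" and B: "simple_form d2 B" and Q: "simple_form N (A ^ a + B ^ b)"
    and ab: "a \<ge> 2" "b \<ge> 2" and N: "N = a * d1" "N = b * d2" and d: "d1 > 0" "d2 > 0"
    and r: "r (Some 0) = a" "r (Some 1) = b" "r None = 1" and e: "d1 + d2 + 2 = N"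
  shows "codim_in (DM N) (DM N closure_of S_locus N r) = 1"
proof -
  have ab': "a > 0" "b > 0" using ab by auto
  have N3: "N \<ge> 3" using e d by linarith
  note dense = dense_pole_classes[OF A B Q ab N d r]
  have "growth N (affine_cone (pole_classes N r)) (d1 + d2 + 1)"
    by (rule growth_powersum[OF ab d N _ dense]) (use e in simp)
  then have gr: "growth N (affine_cone (pole_classes N r)) (N - 1)" using e by (simp flip: e)
  obtain k f where f: "homogeneous_poly N k f" "\<forall>x\<in>powersum_vecs a b d1 d2. f x = 0" "\<exists>F\<in>Sym N - {0}. f (coeff F) \<noteq> 0"
    using exists_vanishing_form[OF ab' d N] e by auto
  have "proj_rel N `` {A ^ a + B ^ b} \<in> pole_classes N r"
    using powersum_property_G[OF A B Q ab N _ r] N3 unfolding pole_classes_def by auto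
  then have T: "pole_classes N r \<noteq> {}" by blast
  have prime: "prime_set N (affine_cone (pole_classes N r))"
    by (rule prime_dense[OF dense prime_curve_connected[OF curve_connected_powersum]])
  show ?thesis unfolding S_locus_eq[where r = r, OF r(3) N3]
  proof (rule codim_DM_1[OF Q N3 T pole_classes_stable[where r = r, OF r(3) N3] prime gr f(1)])
    fix x F v assume "x \<in> pole_classes N r" "F \<in> x" "v \<in> orbit_vecs N F"
    then have "v \<in> powersum_vecs a b d1 d2"
      using orbit_vecs_powersum[OF N pole_class_mem[OF _ _ r(1,2) ab' N]] by blast
    then show "f v = 0" using f(2) by blast
  qed (use f(3) in blast)
qed

lemma dense_simple_classes:
  assumes Q: "simple_form N Q" "coeff Q \<in> powersum_vecs a b d1 d2"
    and ab: "a > 0" "b > 0" and N: "N = a * d1" "N = b * d2" "N > 0"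
    and T: "T = {proj_rel N `` {F} | F. simple_form N F \<and> coeff F \<in> powersum_vecs a b d1 d2}"
  shows "curve_dense (affine_cone T) (powersum_vecs a b d1 d2)"
proof -
  obtain A B where S: "A \<in> Sym d1" "B \<in> Sym d2" "Q = A ^ a + B ^ b"
    using Q(2) unfolding powersum_vecs_def by (auto simp: coeff_inject)
  show ?thesis
  proof (rule curve_dense_powersumI[OF S(1,2)])
    show "affine_cone T \<subseteq> powersum_vecs a b d1 d2"
    proof
      fix v assume "v \<in> affine_cone T"
      then obtain F G where "simple_form N F" "coeff F \<in> powersum_vecs a b d1 d2" "G \<in> proj_rel N `` {F}" "v = coeff G"
        unfolding affine_cone_def T by blast
      then show "v \<in> powersum_vecs a b d1 d2" using class_in_powersum[OF ab, of F N] by (auto simp: simple_form_def)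
    qed
    fix A' B' assume AB: "A' \<in> Sym d1" "B' \<in> Sym d2"
    let ?F = "\<lambda>s. (A + smult s (A' - A)) ^ a + (B + smult s (B' - B)) ^ b"
    have "\<forall>\<^sub>F s in nhds 0. simple_form N (?F s)"
      by (rule eventually_simple_powersum[OF Q(1)[unfolded S(3)] S(1,2) AB ab N])
    then show "\<forall>\<^sub>F s in nhds 0. coeff (?F s) \<in> affine_cone T"
    proof eventually_elim
      case (elim s)
      have "coeff (?F s) \<in> powersum_vecs a b d1 d2"
        unfolding powersum_vecs_def using Sym_line[OF S(1) AB(1)] Sym_line[OF S(2) AB(2)] by blast
      then show ?case using elim by (intro coeff_in_cone) (auto simp: T)
    qed
  qed
qed

lemma codim_S_locus_ge_2:
  assumes G: "property_G N P Q r" and r: "r (Some 0) = a" "r (Some 1) = b" "r None = 1"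
    and ab: "a > 0" "b > 0" and N: "N = a * d1" "N = b * d2" and d: "d1 > 0" "d2 > 0"
    and ab0: "a0 \<ge> 2" "b0 \<ge> 2" and N0: "N = a0 * e1" "N = b0 * e2" and e: "e1 > 0" "e2 > 0"
    and dim: "e1 + e2 + 2 = N" "d1 + d2 + 2 < N"
    and sub: "powersum_vecs a b d1 d2 \<subseteq> powersum_vecs a0 b0 e1 e2"
  shows "codim_in (DM N) (DM N closure_of S_locus N r) \<ge> 2"
proof -
  have ab0': "a0 > 0" "b0 > 0" using ab0 by auto
  have N3: "N \<ge> 3" using dim e by linarith
  have Q: "simple_form N Q" by (rule property_G_simple[where r = r, OF G r(3)])
  have Qp: "coeff Q \<in> powersum_vecs a0 b0 e1 e2" using property_G_powersum[OF G r(1,2) ab N] sub by blast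
  \<comment> \<open>All simple forms in the larger set are taken, not just poles of maps with
    exponents \<open>a0\<close>, \<open>b0\<close>; then \<open>Q\<close> itself belongs to
    \<open>T\<close> and serves as the starting point for density.\<close>
  define T where "T = {proj_rel N `` {F} | F. simple_form N F \<and> coeff F \<in> powersum_vecs a0 b0 e1 e2}"
  have dense: "curve_dense (affine_cone T) (powersum_vecs a0 b0 e1 e2)"
    by (rule dense_simple_classes[OF Q Qp ab0' N0 _ T_def]) (use N3 in simp)
  have prime: "prime_set N (affine_cone T)"
    by (rule prime_dense[OF dense prime_curve_connected[OF curve_connected_powersum]])
  have Tst: "T \<subseteq> stable N" unfolding T_def using simple_form_stable[OF _ N3] by blast
  have T0: "T \<noteq> {}" unfolding T_def using Q Qp by blast
  have PT: "pole_classes N r \<subseteq> T"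
  proof
    fix x assume "x \<in> pole_classes N r"
    then obtain P' Q' where PQ: "property_G N P' Q' r" "x = proj_rel N `` {Q'}" unfolding pole_classes_def by blast
    have "coeff Q' \<in> powersum_vecs a0 b0 e1 e2" using property_G_powersum[OF PQ(1) r(1,2) ab N] sub by blast
    then show "x \<in> T" unfolding T_def using property_G_simple[where r = r, OF PQ(1) r(3)] PQ(2) by blast
  qed
  obtain k f where f: "homogeneous_poly N k f" "\<forall>x\<in>powersum_vecs a0 b0 e1 e2. f x = 0" "\<exists>F\<in>Sym N - {0}. f (coeff F) \<noteq> 0"
    using exists_vanishing_form[OF ab0' e N0] dim by auto
  \<comment> \<open>These \<open>N\<close> coordinates are algebraically independent on the larger
    set, while the smaller one has only \<open>d1 + d2 + 2 < N\<close> parameters. So some relation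
    between them holds on the smaller set and fails on the larger.\<close>
  define I where "I = {..e2} \<union> {N - e1..N}"
  have I: "I \<subseteq> {..N}" using dim by (auto simp: I_def)
  have "card I = N" unfolding I_def using dim by (subst card_Un_disjoint) auto
  then obtain l c where c: "\<exists>m\<in>mons I (\<lambda>_. 1) l. c m \<noteq> 0" "\<forall>A\<in>Sym d1. \<forall>B\<in>Sym d2.
    (\<Sum>m\<in>mons I (\<lambda>_. 1) l. c m * mon I m (coeff (A ^ a + B ^ b))) = 0"
    using powersum_vanishing[OF ab d N, of I] dim finite_subset[OF I] by auto
  define g where "g = (\<lambda>x. \<Sum>m\<in>mons I (\<lambda>_. 1) l. c m * mon I m x)"
  have g: "homogeneous_poly N l g" unfolding g_def by (rule homogeneous_mon_sum[OF I])
  have gvan: "\<forall>x\<in>powersum_vecs a b d1 d2. g x = 0" using c(2) unfolding g_def powersum_vecs_def by blast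
  have gT: "\<exists>v\<in>affine_cone T. g v \<noteq> 0"
  proof (rule ccontr)
    assume "\<not> ?thesis"
    then have z: "g v = 0" if "v \<in> powersum_vecs a0 b0 e1 e2" for v using vanish_dense[OF dense g _ that] by blast
    have "c m = 0" if "m \<in> mons I (\<lambda>_. 1) l" for m
    proof (rule powersum_coords_independent[OF ab0 e N0 _ I_def _ that])
      fix A B assume "A \<in> Sym e1" "B \<in> Sym e2"
      then have "coeff (A ^ a0 + B ^ b0) \<in> powersum_vecs a0 b0 e1 e2" unfolding powersum_vecs_def by blast
      from z[OF this] show "(\<Sum>m\<in>mons I (\<lambda>_. 1) l. c m * mon I m (coeff (A ^ a0 + B ^ b0))) = 0" unfolding g_def .
    qed (use dim in simp)
    then show False using c(1) by blast
  qed
  show ?thesis unfolding S_locus_eq[where r = r, OF r(3) N3]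
  proof (rule codim_DM_ge_2[OF Q N3 T0 Tst prime PT f(1) _ _ g _ gT])
    fix x F v assume x: "x \<in> T" "F \<in> x" "v \<in> orbit_vecs N F"
    then obtain F' where F': "simple_form N F'" "coeff F' \<in> powersum_vecs a0 b0 e1 e2" "x = proj_rel N `` {F'}" unfolding T_def by blast
    then have "F' \<in> Sym N - {0}" by (simp add: simple_form_def)
    from class_in_powersum[OF ab0' this F'(2)] have "coeff F \<in> powersum_vecs a0 b0 e1 e2" using x(2) F'(3) by simp
    from orbit_vecs_powersum[OF N0 this x(3)] show "f v = 0" using f(2) by blast
  next
    fix x F v assume x: "x \<in> pole_classes N r" "F \<in> x" "v \<in> orbit_vecs N F"
    from orbit_vecs_powersum[OF N pole_class_mem[OF x(1,2) r(1,2) ab N] x(3)] show "g v = 0" using gvan by blast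
  qed (use f(3) in blast)
qed

subsection \<open>Exponents of the local system\<close>

lemma subring_generated_closed:
  "1 \<in> subring_generated Z" "x \<in> subring_generated Z \<Longrightarrow> y \<in> subring_generated Z \<Longrightarrow> x - y \<in> subring_generated Z"
  "x \<in> subring_generated Z \<Longrightarrow> y \<in> subring_generated Z \<Longrightarrow> x * y \<in> subring_generated Z"
  "z \<in> Z \<Longrightarrow> z \<in> subring_generated Z"
  unfolding subring_generated_def hull_def by auto

lemma subring_generated_uminus:
  assumes "x \<in> subring_generated Z" shows "- x \<in> subring_generated Z"
proof -
  have "0 \<in> subring_generated Z"
    using subring_generated_closed(2)[OF subring_generated_closed(1) subring_generated_closed(1)] by simp
  from subring_generated_closed(2)[OF this assms] show ?thesis by simp
qed

lemma subring_generated_subset: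
  assumes "Z \<subseteq> subring_generated Z'" shows "subring_generated Z \<subseteq> subring_generated Z'"
  unfolding subring_generated_def[of Z]
  by (rule hull_minimal[OF assms]) (use subring_generated_closed in auto)

text \<open>The integer combinations of 1 and \<open>w\<close> are closed under products because
  \<open>w\<close> satisfies a monic quadratic equation over the integers.\<close>

lemma subring_quadratic:
  assumes w: "w * w = of_int p + of_int q * w"
  shows "subring_generated {w} \<subseteq> {of_int m + of_int n * w | m n. True}"
  unfolding subring_generated_def
proof (rule hull_minimal)
  let ?R = "{of_int m + of_int n * w | m n. True}"
  have "w = of_int 0 + of_int 1 * w" by simp
  then show "{w} \<subseteq> ?R" by blast
  have "x - y \<in> ?R \<and> x * y \<in> ?R" if xy: "x \<in> ?R" "y \<in> ?R" for x y
  proof -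
    obtain m n where x: "x = of_int m + of_int n * w" using xy(1) by blast
    obtain m' n' where y: "y = of_int m' + of_int n' * w" using xy(2) by blast
    have "x - y = of_int (m - m') + of_int (n - n') * w" by (simp add: x y algebra_simps)
    moreover have "x * y = of_int m * of_int m' + (of_int m * of_int n' + of_int n * of_int m') * w + of_int n * of_int n' * (w * w)"
      by (simp add: x y algebra_simps)
    then have "x * y = of_int (m * m' + n * n' * p) + of_int (m * n' + n * m' + n * n' * q) * w"
      unfolding w by (simp add: algebra_simps)
    ultimately show ?thesis by blast
  qed
  moreover have "1 = of_int 1 + of_int 0 * w" by simp
  then have "1 \<in> ?R" by blast
  ultimately show "1 \<in> ?R \<and> (\<forall>x\<in>?R. \<forall>y\<in>?R. x - y \<in> ?R \<and> x * y \<in> ?R)" by blast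
qed

lemma cis_120_square: "cis (2 * pi / 3) * cis (2 * pi / 3) = of_int (- 1) + of_int (- 1) * cis (2 * pi / 3)"
  by (simp add: complex_eq_iff cos_120 sin_120)

text \<open>The generators have real parts 0 and -1/2, so twice the real part is an integer on both
  rings. This is the consequence of the ring condition that rules out \<open>d = 5\<close>.\<close>

lemma half_integer_Re:
  assumes "subring_generated Z \<in> {subring_generated {\<i>}, subring_generated {cis (2 * pi / 3)}}" "z \<in> Z"
  shows "\<exists>k::int. 2 * Re z = of_int k"
proof -
  have z: "z \<in> subring_generated Z" by (rule subring_generated_closed(4)[OF assms(2)])
  consider "z \<in> subring_generated {\<i>}" | "z \<in> subring_generated {cis (2 * pi / 3)}" using assms(1) z by auto
  then show ?thesis
  proof cases
    case 1
    have "\<i> * \<i> = of_int (- 1) + of_int 0 * \<i>" by simp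
    from subring_quadratic[OF this] 1 obtain m n :: int where "z = of_int m + of_int n * \<i>" by blast
    then have "2 * Re z = of_int (2 * m)" by simp
    then show ?thesis by blast
  next
    case 2
    from subring_quadratic[OF cis_120_square] 2 obtain m n :: int where "z = of_int m + of_int n * cis (2 * pi / 3)" by blast
    then have "2 * Re z = of_int (2 * m - n)" by (simp add: cos_120)
    then show ?thesis by blast
  qed
qed

lemma cos_four_pi_fifth: "\<not> (\<exists>k::int. 2 * cos (2 * pi * (2 / 5)) = of_int k)"
proof
  assume "\<exists>k::int. 2 * cos (2 * pi * (2 / 5)) = of_int k"
  then obtain k :: int where k: "2 * cos (2 * pi * (2 / 5)) = of_int k" by blast
  have "cos (2 * pi * (2 / 5)) < cos (2 * pi / 3)" by (rule cos_monotone_0_pi) auto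
  moreover have "cos pi < cos (2 * pi * (2 / 5))" by (rule cos_monotone_0_pi) auto
  ultimately have "- 2 < real_of_int k" "real_of_int k < - 1" using k by (auto simp: cos_120)
  then have "real_of_int (- 2) < real_of_int k" "real_of_int k < real_of_int (- 1)" by simp_all
  then show False unfolding of_int_less_iff by linarith
qed

lemma exponent_integral:
  assumes "cis (2 * pi * \<nu>) ^ n = 1" "\<nu> > 0" "n > 0"
  shows "\<exists>m::nat. m > 0 \<and> \<nu> * real n = real m"
proof -
  have "cis (real n * (2 * pi * \<nu>)) = 1" using assms(1) unfolding Complex.DeMoivre .
  then obtain m :: int where "real n * (2 * pi * \<nu>) = of_int m * (2 * pi)" unfolding cis_eq_1_iff by blast
  then have "(\<nu> * real n) * (2 * pi) = of_int m * (2 * pi)" by (simp add: algebra_simps)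
  then have m: "\<nu> * real n = of_int m" by (simp only: mult_cancel_right) simp
  moreover have "\<nu> * real n > 0" using assms by simp
  ultimately have "m > 0" by simp
  then show ?thesis using m by (intro exI[of _ "nat m"]) auto
qed

text \<open>Weights \<open>2 / d\<close> adding up to 2 force \<open>d\<close> poles, which are then
  all simple. Trivial monodromy over 0 and 1 makes the exponents there multiples of the reciprocal
  ramification indices. For \<open>d >= 5\<close> two poles have total weight below 1, and
  integrality bounds \<open>d\<close>.\<close>

lemma G_data_exponents:
  assumes "G_data d P Q r \<nu>"
  shows "property_G d P Q r" "r None = 1" "d \<ge> 3" "\<nu> None = 2 / real d"
    "r (Some 0) > 0 \<Longrightarrow> \<exists>m::nat. m > 0 \<and> \<nu> (Some 0) * real (r (Some 0)) = real m"
    "r (Some 1) > 0 \<Longrightarrow> \<exists>m::nat. m > 0 \<and> \<nu> (Some 1) * real (r (Some 1)) = real m"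
    "\<nu> (Some 0) + \<nu> (Some 1) + \<nu> None = 1" "d \<ge> 5 \<Longrightarrow> (d - 4) dvd 8" "d \<noteq> 5"
proof -
  define S where "S = {p. vanishes_at d Q p}"
  define \<mu> where "\<mu> p = frac (real (ram_index d P Q p) * \<nu> (rat_map d P Q p))" for p
  have S': "{p. rat_map d P Q p = None} = S" by (simp add: S_def rat_map_None_iff)
  have G: "property_G d P Q r"
    and nu: "\<And>t. t \<in> branch_pts \<Longrightarrow> 0 < \<nu> t \<and> \<nu> t < 1" and sum1: "(\<Sum>t\<in>branch_pts. \<nu> t) = 1"
    and mono: "{p. rat_map d P Q p \<in> branch_pts \<and> cis (2 * pi * \<nu> (rat_map d P Q p)) ^ ram_index d P Q p \<noteq> 1} = S"
    and mu: "\<And>p. p \<in> S \<Longrightarrow> \<mu> p = 2 / real d" and summu: "(\<Sum>p\<in>S. \<mu> p) = 2" and int: "SigmaINT S \<mu>"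
    and ring: "subring_generated ((\<lambda>t. cis (2 * pi * \<nu> t)) ` branch_pts) \<in>
           {subring_generated {\<i>}, subring_generated {cis (2 * pi / 3)}}"
    using assms unfolding G_data_def Let_def S' \<mu>_def[symmetric] by blast+
  show "property_G d P Q r" by fact
  have dm: "degree_map d P Q" using G by (simp add: property_G_def)
  note forms = degree_map_forms[OF dm]
  have d0: "d > 0" by (rule forms(1))
  have "real (card S) * (2 / real d) = 2" using summu mu by simp
  then have card: "card S = d" using d0 by (simp add: field_simps)
  have "(\<Sum>p\<in>S. form_order d Q p) = d" using sum_form_order(2)[OF forms(3)] by (simp add: S_def)
  moreover have "form_order d Q p = r None" if "p \<in> S" for p using G that unfolding property_G_iff S_def by blast
  ultimately have "d * r None = d" using card by simp
  then show r1: "r None = 1" using d0 by simp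
  have "S \<noteq> {}" using card d0 by auto
  then obtain p where p: "p \<in> S" by blast
  then have rp: "rat_map d P Q p = None" by (simp add: S_def rat_map_None_iff)
  then have "ram_index d P Q p = 1" using G r1 unfolding property_G_def branch_pts_def by simp
  then have "\<mu> p = frac (\<nu> None)" using rp by (simp add: \<mu>_def)
  also have "\<dots> = \<nu> None" using nu[of None] by (intro iffD2[OF frac_eq]) (auto simp: branch_pts_def)
  finally show nuN: "\<nu> None = 2 / real d" using mu[OF p] by simp
  have "2 / real d < 1" using nu[of None] nuN by (simp add: branch_pts_def)
  then show d3: "d \<ge> 3" using d0 by (simp add: field_simps)
  show "\<nu> (Some 0) + \<nu> (Some 1) + \<nu> None = 1" using sum1 by (simp add: branch_pts_def)
  have ex: "\<exists>m::nat. m > 0 \<and> \<nu> (Some t) * real (r (Some t)) = real m"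
    if t: "Some t \<in> branch_pts" "rat_map d P Q p = Some t" "r (Some t) > 0" for t p
  proof -
    have "p \<notin> S" using t(2) rat_map_None_iff[of d P Q p] by (auto simp: S_def)
    then have "cis (2 * pi * \<nu> (rat_map d P Q p)) ^ ram_index d P Q p = 1" using mono t by auto
    moreover have "ram_index d P Q p = r (Some t)" using G t unfolding property_G_def by metis
    ultimately have "cis (2 * pi * \<nu> (Some t)) ^ r (Some t) = 1" using t(2) by simp
    then show ?thesis using exponent_integral nu[OF t(1)] t(3) by blast
  qed
  obtain p0 where "vanishes_at d P p0" using exists_zero[OF forms(2) d0] by blast
  then have "rat_map d P Q p0 = Some 0" using rat_map_0_iff[OF dm] by blast
  then show "\<exists>m::nat. m > 0 \<and> \<nu> (Some 0) * real (r (Some 0)) = real m" if "r (Some 0) > 0"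
    using ex[of 0 p0] that by (simp add: branch_pts_def)
  obtain p1 where "vanishes_at d (P - Q) p1" using exists_zero[OF forms(4) d0] by blast
  then have "rat_map d P Q p1 = Some 1" using rat_map_1_iff[OF dm] by blast
  then show "\<exists>m::nat. m > 0 \<and> \<nu> (Some 1) * real (r (Some 1)) = real m" if "r (Some 1) > 0"
    using ex[of 1 p1] that by (simp add: branch_pts_def)
  show "(d - 4) dvd 8" if d5: "d \<ge> 5"
  proof -
    have "\<exists>q\<in>S. q \<noteq> p"
    proof (rule ccontr)
      assume "\<not> (\<exists>q\<in>S. q \<noteq> p)"
      then have "S = {p}" using p by blast
      then show False using card d5 by simp
    qed
    then obtain q where q: "q \<in> S" "q \<noteq> p" by blast
    have lt: "\<mu> p + \<mu> q < 1" unfolding mu[OF p] mu[OF q(1)] using d5 by (simp add: field_simps)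
    \<comment> \<open>Whether or not both poles lie in the distinguished subset, the doubled value
      is an integer; it equals \<open>2 d / (d - 4) = 2 + 8 / (d - 4)\<close>.\<close>
    have "2 * inverse (1 - \<mu> p - \<mu> q) \<in> \<int>"
    proof -
      obtain S1 where "\<forall>s\<in>S. \<forall>t\<in>S. s \<noteq> t \<and> \<mu> s + \<mu> t < 1 \<longrightarrow>
        (if s \<in> S1 \<and> t \<in> S1 then 2 * inverse (1 - \<mu> s - \<mu> t) \<in> \<int> else inverse (1 - \<mu> s - \<mu> t) \<in> \<int>)"
        using int unfolding SigmaINT_def by blast
      then have "2 * inverse (1 - \<mu> p - \<mu> q) \<in> \<int> \<or> inverse (1 - \<mu> p - \<mu> q) \<in> \<int>"
        using p q lt by (metis (full_types))
      then show ?thesis using Ints_mult[of 2 "inverse (1 - \<mu> p - \<mu> q)"] by auto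
    qed
    then obtain k :: int where k: "2 * inverse (1 - \<mu> p - \<mu> q) = of_int k" by (auto elim: Ints_cases)
    obtain e where e: "d = e + 4" "e > 0"
    proof
      show "d = (d - 4) + 4" "d - 4 > 0" using d5 by auto
    qed
    have ek: "1 - \<mu> p - \<mu> q = real e / real d" 
    proof -
      have "1 - 2 / real d - 2 / real d = (real d - 4) / real d" using d0 by (simp add: diff_divide_distrib)
      then show ?thesis unfolding mu[OF p] mu[OF q(1)] using e(1) by simp
    qed
    have "2 * real d = of_int k * real e" using k e unfolding ek by (simp add: field_simps)
    then have "of_int (2 * int d) = (of_int (k * int e) :: real)" by simp
    then have "2 * int d = k * int e" by (simp only: of_int_eq_iff)
    then have "8 = int e * (k - 2)" using e by (simp add: algebra_simps)
    then have "int e dvd int 8" by (metis dvd_triv_left of_nat_numeral)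
    then show ?thesis using e(1) by (simp only: int_dvd_int_iff) simp
  qed
  \<comment> \<open>Integrality allows this case. The monodromy at infinity would be a primitive
    fifth root of unity, which is in neither ring.\<close>
  show "d \<noteq> 5"
  proof
    assume "d = 5"
    then have "\<nu> None = 2 / 5" using nuN by simp
    then have "cis (2 * pi * (2 / 5)) \<in> (\<lambda>t. cis (2 * pi * \<nu> t)) ` branch_pts"
      by (intro image_eqI[of _ _ None]) (simp_all only: branch_pts_def insert_iff simp_thms)
    from half_integer_Re[OF ring this] show False using cos_four_pi_fifth by simp
  qed
qed

text \<open>The equation is \<open>m / a + n / b + 2 / N = 1\<close> with denominators cleared.
  Among the divisors of \<open>N\<close> it leaves only pairs that are multiples of a listed pair,
  possibly in the other order, as for \<open>(4, 3, 12)\<close>. For \<open>N = 3\<close> it would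
  give \<open>m + n = 1\<close>.\<close>

lemma triple_arith:
  fixes a b N m n :: nat
  assumes N: "N \<in> {3, 4, 6, 8, 12}" and dvd: "a dvd N" "b dvd N" and mn: "m > 0" "n > 0"
    and eq: "N * (m * b + n * a) + 2 * a * b = N * a * b" and ab: "a \<ge> 2" "b \<ge> 2" "b \<le> a"
  shows "\<exists>a0 b0. (a0, b0, N) \<in> {(3, 2, 12), (4, 2, 8), (6, 2, 6), (3, 3, 6), (4, 4, 4)} \<and>
    (a0 dvd a \<and> b0 dvd b \<or> a0 dvd b \<and> b0 dvd a)"
proof -
  have pos: "N > 0" using N by auto
  have le: "a \<le> N" "b \<le> N" using dvd pos by (auto intro: dvd_imp_le)
  consider "N = 3" | "N = 4" | "N = 6" | "N = 8" | "N = 12" using N by auto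
  then show ?thesis
  proof cases
    case 1
    then have "a = 2 \<or> a = 3" "b = 2 \<or> b = 3" using le ab by linarith+
    then have "a = 3" "b = 3" using dvd 1 by auto
    then show ?thesis using eq 1 mn by simp
  next
    case 2
    then have "a = 2 \<or> a = 3 \<or> a = 4" "b = 2 \<or> b = 3 \<or> b = 4" using le ab by linarith+
    then have "a = 2 \<or> a = 4" "b = 2 \<or> b = 4" using dvd 2 by auto
    moreover have "\<not> (a = 2 \<and> b = 2)" "\<not> (a = 4 \<and> b = 2)" using eq 2 mn by auto
    ultimately have "4 dvd a \<and> 4 dvd b" using ab by auto
    then show ?thesis using 2 by (intro exI[of _ 4]) auto
  next
    case 3
    then have "a \<in> {2, 3, 4, 5, 6}" "b \<in> {2, 3, 4, 5, 6}" using le ab by (auto; linarith)+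
    then have "a \<in> {2, 3, 6}" "b \<in> {2, 3, 6}" using dvd 3 by auto
    moreover have "\<not> (a = 2 \<and> b = 2)" "\<not> (a = 3 \<and> b = 2)" using eq 3 mn by auto
    ultimately have "6 dvd a \<and> 2 dvd b \<or> 3 dvd a \<and> 3 dvd b" using ab by auto
    then show ?thesis
    proof
      assume "6 dvd a \<and> 2 dvd b"
      then show ?thesis using 3 by (intro exI[of _ 6] exI[of _ 2]) auto
    next
      assume "3 dvd a \<and> 3 dvd b"
      then show ?thesis using 3 by (intro exI[of _ 3]) auto
    qed
  next
    case 4
    then have "a \<in> {2, 3, 4, 5, 6, 7, 8}" "b \<in> {2, 3, 4, 5, 6, 7, 8}" using le ab by (auto; linarith)+
    then have "a \<in> {2, 4, 8}" "b \<in> {2, 4, 8}" using dvd 4 by auto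
    moreover have "\<not> (a = 2 \<and> b = 2)" using eq 4 mn by auto
    ultimately have "4 dvd a \<and> 2 dvd b \<or> 4 dvd b \<and> 2 dvd a" using ab by auto
    then show ?thesis using 4 by (intro exI[of _ 4] exI[of _ 2]) auto
  next
    case 5
    have "k = 2 \<or> k = 3 \<or> k = 4 \<or> k = 5 \<or> k = 6 \<or> k = 7 \<or> k = 8 \<or> k = 9 \<or> k = 10 \<or> k = 11 \<or> k = 12"
      if "2 \<le> k" "k \<le> 12" for k :: nat using that by presburger
    then have "k \<in> {2, 3, 4, 6, 12}" if "2 \<le> k" "k \<le> 12" "k dvd 12" for k :: nat
      using that by fastforce
    then have "a \<in> {2, 3, 4, 6, 12}" "b \<in> {2, 3, 4, 6, 12}" using le ab dvd 5 by auto
    moreover have "\<not> (a = 2 \<and> b = 2)" "\<not> (a = 3 \<and> b = 3)" "\<not> (a = 4 \<and> b = 2)" "\<not> (a = 4 \<and> b = 4)"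
      using eq 5 mn by (auto; presburger)+
    ultimately have "3 dvd a \<and> 2 dvd b \<or> 3 dvd b \<and> 2 dvd a" using ab by auto
    then show ?thesis using 5 by (intro exI[of _ 3] exI[of _ 2]) auto
  qed
qed

text \<open>\<open>A^a\<close> is the \<open>a0\<close>-th power of \<open>A^(a div a0)\<close>,
  which has exactly the degree bound \<open>e1\<close>.\<close>

lemma powersum_vecs_subset:
  assumes "a0 dvd a" "b0 dvd b" "a0 > 0" "b0 > 0" and N: "a * d1 = a0 * e1" "b * d2 = b0 * e2"
  shows "powersum_vecs a b d1 d2 \<subseteq> powersum_vecs a0 b0 e1 e2"
proof
  fix v assume "v \<in> powersum_vecs a b d1 d2"
  then obtain A B where AB: "A \<in> Sym d1" "B \<in> Sym d2" "v = coeff (A ^ a + B ^ b)" unfolding powersum_vecs_def by blast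
  obtain u where u: "a = a0 * u" using assms(1) by (rule dvdE)
  obtain w where w: "b = b0 * w" using assms(2) by (rule dvdE)
  have "e1 = u * d1" "e2 = w * d2" using N u w assms(3,4) by (auto simp: mult.assoc)
  then have "A ^ u \<in> Sym e1" "B ^ w \<in> Sym e2" using Sym_power AB by auto
  moreover have "A ^ a + B ^ b = (A ^ u) ^ a0 + (B ^ w) ^ b0" by (simp add: u w mult.commute flip: power_mult)
  ultimately show "v \<in> powersum_vecs a0 b0 e1 e2" unfolding AB(3) powersum_vecs_def mem_Collect_eq
    by (intro exI[of _ "A ^ u"] exI[of _ "B ^ w"]) simp
qed

lemma powersum_vecs_commute: "powersum_vecs a b d1 d2 = powersum_vecs b a d2 d1"
  unfolding powersum_vecs_def by (metis (no_types, lifting) add.commute)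

lemma G_triple_imp_list:
  fixes a b N :: nat
  assumes ab: "a \<ge> b" "b > 0" and dvd: "a dvd N" "b dvd N" and G: "G_triple a b N"
  shows "(a, b, N) \<in> {(3, 2, 12), (4, 2, 8), (6, 2, 6), (3, 3, 6), (4, 4, 4)}"
proof (rule ccontr)
  let ?L = "{(3, 2, 12), (4, 2, 8), (6, 2, 6), (3, 3, 6), (4, 4, 4)} :: (nat \<times> nat \<times> nat) set"
  assume notin: "(a, b, N) \<notin> ?L"
  obtain P Q r \<nu> where data: "G_data N P Q r \<nu>" and r: "r (Some 0) = a" "r (Some 1) = b"
    and codim: "codim_in (DM N) (DM N closure_of S_locus N r) = 1" using G unfolding G_triple_def by blast
  note D = G_data_exponents[OF data]
  have a0: "a > 0" using ab by simp
  obtain m :: nat where m: "m > 0" "\<nu> (Some 0) * real a = real m" using D(5) r a0 by auto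
  obtain n :: nat where n: "n > 0" "\<nu> (Some 1) * real b = real n" using D(6) r ab by auto
  have N0: "N > 0" using D(3) by simp
  have nu: "\<nu> (Some 0) = real m / real a" "\<nu> (Some 1) = real n / real b" using m n a0 ab by (auto simp: field_simps)
  have "real m / real a + real n / real b + 2 / real N = 1" using D(7) nu D(4) by simp
  then have "real N * (real m * real b + real n * real a) + 2 * real a * real b = real N * real a * real b"
    using a0 ab N0 by (simp add: field_simps)
  then have "real (N * (m * b + n * a) + 2 * a * b) = real (N * a * b)" by simp
  then have eq: "N * (m * b + n * a) + 2 * a * b = N * a * b" by (simp only: of_nat_eq_iff)
  obtain d1 where d1: "N = a * d1" using dvd(1) by (rule dvdE)
  obtain d2 where d2: "N = b * d2" using dvd(2) by (rule dvdE)
  have d: "d1 > 0" "d2 > 0" using d1 d2 N0 by (auto intro: gr0I)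
  have "a * b * (m * d1 + n * d2 + 2) = a * b * N"
  proof -
    have "N * (m * b + n * a) = m * b * (a * d1) + n * a * (b * d2)"
      by (simp add: algebra_simps flip: d1 d2)
    then show ?thesis using eq by (simp add: algebra_simps)
  qed
  then have "m * d1 + n * d2 + 2 = N \<or> a * b = 0" unfolding mult_cancel1 by blast
  \<comment> \<open>The equation for the exponents, read as a count of parameters. Since
    \<open>m\<close> and \<open>n\<close> are at least 1, it gives \<open>d1 + d2 + 2 <= N\<close>,
    with equality only for the listed triples.\<close>
  then have dims: "m * d1 + n * d2 + 2 = N" using a0 ab by simp
  have "d1 \<le> m * d1" "d2 \<le> n * d2" using m(1) n(1) by auto
  then have le: "d1 + d2 + 2 \<le> N" using dims by linarith
  have b2: "b \<ge> 2"
  proof (rule ccontr)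
    assume "\<not> b \<ge> 2"
    then have "b = 1" using ab by simp
    then show False using d2 le by simp
  qed
  then have a2: "a \<ge> 2" using ab by simp
  have lt: "d1 + d2 + 2 < N"
    using hypersurface_arith[OF ab(1) b2 d d1 d2] notin le by linarith
  \<comment> \<open>For \<open>N\<close> at most 4 two weights \<open>2 / N\<close> already add up
    to at least 1, so \<open>SigmaINT\<close> imposes no condition there.\<close>
  have "N \<in> {3, 4, 6, 8, 12}"
  proof (cases "N \<ge> 5")
    case True
    then have "(N - 4) dvd 8" by (rule D(8))
    then have "N - 4 \<le> 8" by (rule dvd_imp_le) simp
    then have "N - 4 \<in> {1, 2, 3, 4, 5, 6, 7, 8}" using True by (auto; linarith)
    then have "N - 4 \<in> {1, 2, 4, 8}" using \<open>(N - 4) dvd 8\<close> by auto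
    then have "N \<in> {5, 6, 8, 12}" using True by auto
    then show ?thesis using D(9) by simp
  next
    case False
    then show ?thesis using D(3) by auto
  qed
  from triple_arith[OF this dvd m(1) n(1) eq a2 b2 ab(1)] obtain a' b' where
    L: "(a', b', N) \<in> ?L" and dv: "a' dvd a \<and> b' dvd b \<or> a' dvd b \<and> b' dvd a" by blast
  have ab': "b' \<le> a'" "b' \<ge> 2" "a' \<ge> 2" "a' dvd N" "b' dvd N" using L by auto
  obtain e1 where e1: "N = a' * e1" using ab'(4) by (rule dvdE)
  obtain e2 where e2: "N = b' * e2" using ab'(5) by (rule dvdE)
  have e: "e1 > 0" "e2 > 0" using e1 e2 N0 by (auto intro: gr0I)
  have dim: "e1 + e2 + 2 = N" using hypersurface_arith[OF ab'(1,2) e e1 e2] L by blast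
  have "powersum_vecs a b d1 d2 \<subseteq> powersum_vecs a' b' e1 e2"
    using dv
  proof
    assume "a' dvd a \<and> b' dvd b"
    then show ?thesis using ab' d1 d2 e1 e2 by (intro powersum_vecs_subset) auto
  next
    assume "a' dvd b \<and> b' dvd a"
    then show ?thesis unfolding powersum_vecs_commute[of a b] using ab' d1 d2 e1 e2 by (intro powersum_vecs_subset) auto
  qed
  from codim_S_locus_ge_2[OF D(1) r D(2) a0 ab(2) d1 d2 d ab'(3,2) e1 e2 e dim lt this]
  show False unfolding codim by (simp add: numeral_eq_enat one_enat_def)
qed

lemma G_triple_intro:
  assumes A: "simple_form d1 A" and B: "simple_form d2 B" and Q: "simple_form N (A ^ a + B ^ b)"
    and ab: "a \<ge> 2" "b \<ge> 2" and N: "N = a * d1" "N = b * d2" and d: "d1 > 0" "d2 > 0" and e: "d1 + d2 + 2 = N"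
    and N': "N \<in> {4, 6, 8, 12}" and sum: "1 / real a + 1 / real b + 2 / real N = 1"
    and ring: "subring_generated {cis (2 * pi * (1 / real a)), cis (2 * pi * (1 / real b)), cis (2 * pi * (2 / real N))} \<in>
      {subring_generated {\<i>}, subring_generated {cis (2 * pi / 3)}}"
  shows "G_triple a b N"
proof -
  define r where "r = (\<lambda>p::P1. if p = Some 0 then a else if p = Some 1 then b else 1)"
  define \<nu> where "\<nu> = (\<lambda>p::P1. if p = Some 0 then 1 / real a else if p = Some 1 then 1 / real b else 2 / real N)"
  have r: "r (Some 0) = a" "r (Some 1) = b" "r None = 1" by (auto simp: r_def)
  have nu: "\<nu> (Some 0) = 1 / real a" "\<nu> (Some 1) = 1 / real b" "\<nu> None = 2 / real N" by (auto simp: \<nu>_def)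
  have N4: "N \<ge> 4" using N' by auto
  let ?P = "A ^ a" and ?Q = "A ^ a + B ^ b"
  have G: "property_G N ?P ?Q r" by (rule powersum_property_G[OF A B Q ab N _ r]) (use N4 in simp)
  have dm: "degree_map N ?P ?Q" using G by (simp add: property_G_def)
  let ?pi = "rat_map N ?P ?Q"
  define S where "S = {p. ?pi p = None}"
  define \<mu> where "\<mu> p = frac (real (ram_index N ?P ?Q p) * \<nu> (?pi p))" for p
  have ramS: "ram_index N ?P ?Q p = 1" if "p \<in> S" for p
    using G that r unfolding property_G_def S_def branch_pts_def by auto
  have ram: "ram_index N ?P ?Q p = r (?pi p)" if "?pi p \<in> branch_pts" for p
    using G that unfolding property_G_def by auto
  have mu: "\<mu> p = 2 / real N" if "p \<in> S" for p
  proof -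
    have "\<mu> p = frac (2 / real N)" using ramS[OF that] that nu(3) unfolding \<mu>_def S_def by simp
    also have "\<dots> = 2 / real N" using N4 by (intro iffD2[OF frac_eq]) (auto simp: field_simps)
    finally show ?thesis .
  qed
  have card: "card S = N"
  proof -
    have S': "S = {p. vanishes_at N ?Q p}" by (simp only: S_def rat_map_None_iff)
    have "form_order N ?Q p = 1" if "p \<in> S" for p using G that r unfolding property_G_iff S' by auto
    then have "(\<Sum>p\<in>S. form_order N ?Q p) = card S" by simp
    then show ?thesis using sum_form_order(2)[OF degree_map_forms(3)[OF dm]] unfolding S' by simp
  qed
  have finS: "finite S" using card N4 by (metis card.infinite not_numeral_le_zero)
  have bp: "branch_pts = {Some 0, Some 1, None}" by (rule branch_pts_def)
  have root1: "cis (2 * pi * (1 / real k)) ^ k = 1" if "k > 0" for k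
    using that by (simp add: Complex.DeMoivre)
  have mono: "{p. ?pi p \<in> branch_pts \<and> cis (2 * pi * \<nu> (?pi p)) ^ ram_index N ?P ?Q p \<noteq> 1} = S"
  proof (intro equalityI subsetI)
    fix p assume p: "p \<in> {p. ?pi p \<in> branch_pts \<and> cis (2 * pi * \<nu> (?pi p)) ^ ram_index N ?P ?Q p \<noteq> 1}"
    then have "?pi p = Some 0 \<or> ?pi p = Some 1 \<or> ?pi p = None" by (auto simp: bp)
    moreover have "?pi p \<noteq> Some 0" using p ram[of p] root1[of a] ab r nu by auto
    moreover have "?pi p \<noteq> Some 1" using p ram[of p] root1[of b] ab r nu by auto
    ultimately show "p \<in> S" by (simp add: S_def)
  next
    fix p assume p: "p \<in> S"
    have "cis (2 * pi * (2 / real N)) \<noteq> 1"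
    proof
      assume "cis (2 * pi * (2 / real N)) = 1"
      then obtain k :: int where "2 * pi * (2 / real N) = of_int k * (2 * pi)" unfolding cis_eq_1_iff by blast
      then have "(2 / real N) * (2 * pi) = of_int k * (2 * pi)" by (simp add: mult.commute)
      then have k: "2 / real N = of_int k" by (simp only: mult_cancel_right) simp
      have "0 < 2 / real N" "2 / real N < 1" using N4 by (auto simp: field_simps)
      then show False unfolding k by simp
    qed
    then show "p \<in> {p. ?pi p \<in> branch_pts \<and> cis (2 * pi * \<nu> (?pi p)) ^ ram_index N ?P ?Q p \<noteq> 1}"
      using p ramS[OF p] nu(3) unfolding S_def bp by auto
  qed
  \<comment> \<open>All poles are put into the distinguished subset: for \<open>N = 12\<close> the
    value is 3/2, which is only half-integral.\<close>
  have int: "SigmaINT S \<mu>" unfolding SigmaINT_def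
  proof (intro exI[of _ S] conjI ballI impI)
    show "S \<subseteq> S" by simp
    show "\<mu> s = \<mu> t" if "s \<in> S" "t \<in> S" for s t using mu that by simp
    fix s t assume st: "s \<in> S" "t \<in> S" "s \<noteq> t \<and> \<mu> s + \<mu> t < 1"
    have mst: "\<mu> s = 2 / real N" "\<mu> t = 2 / real N" using mu st by auto
    then have "N \<noteq> 4" using st(3) by auto
    then have "N = 6 \<or> N = 8 \<or> N = 12" using N' by auto
    then have "2 * inverse (1 - \<mu> s - \<mu> t) = 6 \<or> 2 * inverse (1 - \<mu> s - \<mu> t) = 4 \<or>
        2 * inverse (1 - \<mu> s - \<mu> t) = 3" unfolding mst by auto
    then have "2 * inverse (1 - \<mu> s - \<mu> t) \<in> \<int>" by (elim disjE) (simp_all only: Ints_numeral)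
    then show "if s \<in> S \<and> t \<in> S then 2 * inverse (1 - \<mu> s - \<mu> t) \<in> \<int> else inverse (1 - \<mu> s - \<mu> t) \<in> \<int>"
      using st by simp
  qed
  have "G_data N ?P ?Q r \<nu>" unfolding G_data_def Let_def S_def[symmetric] \<mu>_def[symmetric]
  proof (intro conjI G mono int)
    show "\<forall>t\<in>branch_pts. \<nu> t \<in> \<rat> \<and> 0 < \<nu> t \<and> \<nu> t < 1"
      using ab N4 unfolding bp by (auto simp: nu field_simps)
    show "sum \<nu> branch_pts = 1" using sum unfolding bp by (simp add: nu)
    show "\<forall>p\<in>S. \<mu> p = 2 / real N" using mu by blast
    show "sum \<mu> S = 2" using mu card N4 by simp
    have "(\<lambda>t. cis (2 * pi * \<nu> t)) ` branch_pts = {cis (2 * pi * (1 / real a)), cis (2 * pi * (1 / real b)), cis (2 * pi * (2 / real N))}"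
      unfolding bp by (simp add: nu)
    then show "subring_generated ((\<lambda>t. cis (2 * pi * \<nu> t)) ` branch_pts) \<in>
           {subring_generated {\<i>}, subring_generated {cis (2 * pi / 3)}}" using ring by simp
  qed
  moreover have "codim_in (DM N) (DM N closure_of S_locus N r) = 1"
    by (rule codim_S_locus_1[OF A B Q ab N d r e])
  ultimately show ?thesis unfolding G_triple_def using r by blast
qed

lemma simple_formI:
  assumes "F \<in> Sym d" "coeff F d \<noteq> 0 \<or> d > 0 \<and> coeff F (d - 1) \<noteq> 0"
    and "\<And>z. poly F z = 0 \<Longrightarrow> poly (pderiv F) z \<noteq> 0"
  shows "simple_form d F"
proof -
  have F0: "F \<noteq> 0" using assms(2) by auto
  have deg: "degree F \<ge> d - 1" using assms(2) le_degree[of F d] le_degree[of F "d - 1"] by auto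
  have "form_order d F p \<le> 1" for p
  proof (cases p)
    case None
    then show ?thesis using deg by simp
  next
    case (Some z)
    then show ?thesis using order_ge_2_iff[OF F0, of z] assms(3)[of z] by auto
  qed
  then show ?thesis using assms(1) F0 by (simp add: simple_form_def)
qed

subsection \<open>The five triples\<close>

lemma subring_generated_singleton_eq:
  assumes "w \<in> Z" "Z \<subseteq> subring_generated {w}" shows "subring_generated Z = subring_generated {w}"
  using assms subring_generated_subset[of Z "{w}"] subring_generated_subset[of "{w}" Z] subring_generated_closed(4)[of w Z]
  by blast

text \<open>The monodromies of the five triples. The primitive sixth roots of unity are written as
  \<open>- (w * w)\<close>, with \<open>w\<close> the cube root of unity, to fit
  \<open>ring_omega\<close>.\<close>

lemma cis_special:
  "cis (2 * pi * (1 / 2)) = - 1" "cis (2 * pi * (1 / 4)) = \<i>" "cis (2 * pi * (2 / 4)) = - 1"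
  "cis (2 * pi * (2 / 8)) = \<i>" "cis (2 * pi * (1 / 3)) = cis (2 * pi / 3)" "cis (2 * pi * (2 / 6)) = cis (2 * pi / 3)"
  "cis (2 * pi * (1 / 6)) = - (cis (2 * pi / 3) * cis (2 * pi / 3))"
  "cis (2 * pi * (2 / 12)) = - (cis (2 * pi / 3) * cis (2 * pi / 3))"
  by (simp_all add: complex_eq_iff cos_120 sin_120 cos_60 sin_60)

lemma ring_i:
  assumes "Z \<subseteq> {\<i>, - 1}" "\<i> \<in> Z" shows "subring_generated Z = subring_generated {\<i>}"
proof (rule subring_generated_singleton_eq[OF assms(2)])
  have "\<i> \<in> subring_generated {\<i>}" by (rule subring_generated_closed(4)) simp
  then have "{\<i>, - 1} \<subseteq> subring_generated {\<i>}"
    using subring_generated_uminus[OF subring_generated_closed(1)] by simp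
  then show "Z \<subseteq> subring_generated {\<i>}" using assms(1) by blast
qed

lemma ring_omega:
  assumes "Z \<subseteq> {w, - 1, - (w * w)}" "w \<in> Z" shows "subring_generated Z = subring_generated {w}"
proof (rule subring_generated_singleton_eq[OF assms(2)])
  have w: "w \<in> subring_generated {w}" by (rule subring_generated_closed(4)) simp
  have "{w, - 1, - (w * w)} \<subseteq> subring_generated {w}"
    using w subring_generated_uminus[OF subring_generated_closed(1)] subring_generated_uminus[OF subring_generated_closed(3)[OF w w]]
    by simp
  then show "Z \<subseteq> subring_generated {w}" using assms(1) by blast
qed

lemma simple_form_X4: "simple_form 4 ([:0, 1:] ^ 4 + 1 ^ 4)"
proof -
  have e: "[:0, 1:] ^ 4 + 1 ^ 4 = [:1, 0, 0, 0, 1 :: complex:]" by (simp add: eval_nat_numeral one_pCons)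
  show ?thesis unfolding e
  proof (rule simple_formI)
    fix z assume "poly [:1, 0, 0, 0, 1 :: complex:] z = 0"
    then have "z \<noteq> 0" by auto
    then show "poly (pderiv [:1, 0, 0, 0, 1 :: complex:]) z \<noteq> 0" by (simp add: pderiv_pCons)
  qed (simp_all add: Sym_def numeral_eq_Suc)
qed

lemma G_triple_4_4_4: "G_triple 4 4 4"
proof (rule G_triple_intro[of 1 "[:0, 1:]" 1 1])
  show "simple_form 1 [:0, 1:]" by (rule simple_formI) (auto simp: Sym_def pderiv_pCons)
  \<comment> \<open>In \<open>Sym 1\<close> the constant 1 is \<open>y\<close>, with its simple zero
    at infinity; the sum is thus \<open>x^4 + y^4\<close>.\<close>
  show "simple_form 1 1" by (rule simple_formI) (auto simp: Sym_def)
  show "simple_form 4 ([:0, 1:] ^ 4 + 1 ^ 4)" by (rule simple_form_X4)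
  have "subring_generated {cis (2 * pi * (1 / 4)), cis (2 * pi * (1 / 4)), cis (2 * pi * (2 / 4))} = subring_generated {\<i>}"
    unfolding cis_special by (rule ring_i) auto
  then show "subring_generated {cis (2 * pi * (1 / real 4)), cis (2 * pi * (1 / real 4)), cis (2 * pi * (2 / real 4))} \<in>
      {subring_generated {\<i>}, subring_generated {cis (2 * pi / 3)}}" by simp
qed auto

lemma G_triple_6_2_6: "G_triple 6 2 6"
proof (rule G_triple_intro[of 1 "[:0, 1:]" 3 "[:1, 0, 0, 2:]"])
  show "simple_form 1 [:0, 1:]" by (rule simple_formI) (auto simp: Sym_def pderiv_pCons)
  show "simple_form 3 [:1, 0, 0, 2:]"
  proof (rule simple_formI)
    fix z assume "poly [:1, 0, 0, 2 :: complex:] z = 0"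
    then have "z \<noteq> 0" by auto
    then show "poly (pderiv [:1, 0, 0, 2 :: complex:]) z \<noteq> 0" by (simp add: pderiv_pCons)
  qed (simp_all add: Sym_def numeral_eq_Suc)
  have e: "[:0, 1:] ^ 6 + [:1, 0, 0, 2:] ^ 2 = [:1, 0, 0, 4, 0, 0, 5 :: complex:]" by (simp add: eval_nat_numeral)
  show "simple_form 6 ([:0, 1:] ^ 6 + [:1, 0, 0, 2:] ^ 2)" unfolding e
  proof (rule simple_formI)
    fix z :: complex assume "poly [:1, 0, 0, 4, 0, 0, 5:] z = 0"
    then have 1: "5 * (z ^ 3)\<^sup>2 + 4 * z ^ 3 + 1 = 0" by (simp add: algebra_simps eval_nat_numeral)
    then have z: "z \<noteq> 0" by auto
    \<comment> \<open>In terms of \<open>w = z^3\<close> a double zero would lie at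
      \<open>w = - 2 / 5\<close>, where \<open>5 w^2 + 4 w + 1\<close> equals 1/5.\<close>
    have "5 * z ^ 3 + 2 \<noteq> 0"
    proof
      assume "5 * z ^ 3 + 2 = 0"
      then have "z ^ 3 = - 2 / 5" by (simp add: field_simps eq_neg_iff_add_eq_0)
      with 1 show False by (simp add: power2_eq_square)
    qed
    then have "6 * z\<^sup>2 * (5 * z ^ 3 + 2) \<noteq> 0" using z by simp
    then show "poly (pderiv [:1, 0, 0, 4, 0, 0, 5:]) z \<noteq> 0" by (simp add: pderiv_pCons algebra_simps eval_nat_numeral)
  qed (simp_all add: Sym_def numeral_eq_Suc)
  have "subring_generated {cis (2 * pi * (1 / 6)), cis (2 * pi * (1 / 2)), cis (2 * pi * (2 / 6))} = subring_generated {cis (2 * pi / 3)}"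
    unfolding cis_special by (rule ring_omega) auto
  then show "subring_generated {cis (2 * pi * (1 / real 6)), cis (2 * pi * (1 / real 2)), cis (2 * pi * (2 / real 6))} \<in>
      {subring_generated {\<i>}, subring_generated {cis (2 * pi / 3)}}" by simp
qed auto

lemma G_triple_4_2_8: "G_triple 4 2 8"
proof (rule G_triple_intro[of 2 "[:0, 1:]" 4 "[:1, 0, 0, 0, 1:]"])
  \<comment> \<open>As a form of degree 2 this is \<open>x y\<close>, with simple zeros at 0 and
    infinity.\<close>
  show "simple_form 2 [:0, 1:]" by (rule simple_formI) (auto simp: Sym_def pderiv_pCons)
  show "simple_form 4 [:1, 0, 0, 0, 1:]"
  proof (rule simple_formI)
    fix z assume "poly [:1, 0, 0, 0, 1 :: complex:] z = 0"
    then have "z \<noteq> 0" by auto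
    then show "poly (pderiv [:1, 0, 0, 0, 1 :: complex:]) z \<noteq> 0" by (simp add: pderiv_pCons)
  qed (simp_all add: Sym_def numeral_eq_Suc)
  have e: "[:0, 1:] ^ 4 + [:1, 0, 0, 0, 1:] ^ 2 = [:1, 0, 0, 0, 3, 0, 0, 0, 1 :: complex:]" by (simp add: eval_nat_numeral)
  show "simple_form 8 ([:0, 1:] ^ 4 + [:1, 0, 0, 0, 1:] ^ 2)" unfolding e
  proof (rule simple_formI)
    fix z :: complex assume "poly [:1, 0, 0, 0, 3, 0, 0, 0, 1:] z = 0"
    then have 1: "(z ^ 4)\<^sup>2 + 3 * z ^ 4 + 1 = 0" by (simp add: algebra_simps eval_nat_numeral)
    then have z: "z \<noteq> 0" by auto
    \<comment> \<open>A double zero would have \<open>w = z^4 = - 3 / 2\<close>, where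
      \<open>w^2 + 3 w + 1\<close> equals -5/4.\<close>
    have "2 * z ^ 4 + 3 \<noteq> 0"
    proof
      assume "2 * z ^ 4 + 3 = 0"
      then have "z ^ 4 = - 3 / 2" by (simp add: field_simps eq_neg_iff_add_eq_0)
      with 1 show False by (simp add: power2_eq_square)
    qed
    then have "4 * z ^ 3 * (2 * z ^ 4 + 3) \<noteq> 0" using z by simp
    then show "poly (pderiv [:1, 0, 0, 0, 3, 0, 0, 0, 1:]) z \<noteq> 0" by (simp add: pderiv_pCons algebra_simps eval_nat_numeral)
  qed (simp_all add: Sym_def numeral_eq_Suc)
  have "subring_generated {cis (2 * pi * (1 / 4)), cis (2 * pi * (1 / 2)), cis (2 * pi * (2 / 8))} = subring_generated {\<i>}"
    unfolding cis_special by (rule ring_i) auto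
  then show "subring_generated {cis (2 * pi * (1 / real 4)), cis (2 * pi * (1 / real 2)), cis (2 * pi * (2 / real 8))} \<in>
      {subring_generated {\<i>}, subring_generated {cis (2 * pi / 3)}}" by simp
qed auto

lemma G_triple_3_3_6: "G_triple 3 3 6"
proof (rule G_triple_intro[of 2 "[:1, 0, 1:]" 2 "[:0, 1:]"])
  show "simple_form 2 [:1, 0, 1:]"
  proof (rule simple_formI)
    fix z assume "poly [:1, 0, 1 :: complex:] z = 0"
    then have "z \<noteq> 0" by auto
    then show "poly (pderiv [:1, 0, 1 :: complex:]) z \<noteq> 0" by (simp add: pderiv_pCons)
  qed (simp_all add: Sym_def numeral_eq_Suc)
  show "simple_form 2 [:0, 1:]" by (rule simple_formI) (auto simp: Sym_def pderiv_pCons)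
  have e: "[:1, 0, 1:] ^ 3 + [:0, 1:] ^ 3 = [:1, 0, 3, 1, 3, 0, 1 :: complex:]" by (simp add: eval_nat_numeral)
  show "simple_form 6 ([:1, 0, 1:] ^ 3 + [:0, 1:] ^ 3)" unfolding e
  proof (rule simple_formI)
    fix z :: complex assume "poly [:1, 0, 3, 1, 3, 0, 1:] z = 0"
    then have 1: "(z\<^sup>2 + 1) ^ 3 + z ^ 3 = 0" by (simp add: algebra_simps eval_nat_numeral)
    then have z: "z \<noteq> 0" by auto
    \<comment> \<open>The derivative is \<open>3 z\<close> times this expression. If it vanished,
      then \<open>z = - 2 A^2\<close> with \<open>A = z^2 + 1\<close>, and the equation would give
      \<open>8 A^3 = 1\<close>; but then \<open>A = 4 A^4 + 1 = A / 2 + 1\<close>, so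
      \<open>A = 2\<close>.\<close>
    have "2 * (z\<^sup>2 + 1)\<^sup>2 + z \<noteq> 0"
    proof
      define A where "A = z\<^sup>2 + 1"
      assume "2 * (z\<^sup>2 + 1)\<^sup>2 + z = 0"
      then have zA: "z = - 2 * A\<^sup>2" by (simp add: A_def eq_neg_iff_add_eq_0 add.commute)
      then have "A \<noteq> 0" using z by auto
      have "A ^ 3 * (1 - 8 * A ^ 3) = A ^ 3 + z ^ 3" unfolding zA by (simp add: algebra_simps eval_nat_numeral)
      also have "\<dots> = 0" using 1 by (simp add: A_def)
      finally have "A ^ 3 * (1 - 8 * A ^ 3) = 0" .
      then have A3: "8 * A ^ 3 = 1" using \<open>A \<noteq> 0\<close> by simp
      have "A = z\<^sup>2 + 1" by (rule A_def)
      also have "\<dots> = 4 * A * A ^ 3 + 1" unfolding zA by (simp add: algebra_simps eval_nat_numeral)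
      also have "\<dots> = A * (8 * A ^ 3) / 2 + 1" by simp
      finally have "A = 2" unfolding A3 by (simp add: field_simps)
      then show False using A3 by simp
    qed
    then have "3 * z * (2 * (z\<^sup>2 + 1)\<^sup>2 + z) \<noteq> 0" using z by simp
    then show "poly (pderiv [:1, 0, 3, 1, 3, 0, 1:]) z \<noteq> 0" by (simp add: pderiv_pCons algebra_simps eval_nat_numeral)
  qed (simp_all add: Sym_def numeral_eq_Suc)
  have "subring_generated {cis (2 * pi * (1 / 3)), cis (2 * pi * (1 / 3)), cis (2 * pi * (2 / 6))} = subring_generated {cis (2 * pi / 3)}"
    unfolding cis_special by (rule ring_omega) auto
  then show "subring_generated {cis (2 * pi * (1 / real 3)), cis (2 * pi * (1 / real 3)), cis (2 * pi * (2 / real 6))} \<in>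
      {subring_generated {\<i>}, subring_generated {cis (2 * pi / 3)}}" by simp
qed auto

lemma G_triple_3_2_12: "G_triple 3 2 12"
proof (rule G_triple_intro[of 4 "[:1, 0, 0, 1:]" 6 "[:1, 0, 0, 0, 0, 0, 1:]"])
  \<comment> \<open>As a form of degree 4 this is \<open>y (x^3 + y^3)\<close>, with a simple zero
    at infinity.\<close>
  show "simple_form 4 [:1, 0, 0, 1:]"
  proof (rule simple_formI)
    fix z assume "poly [:1, 0, 0, 1 :: complex:] z = 0"
    then have "z \<noteq> 0" by auto
    then show "poly (pderiv [:1, 0, 0, 1 :: complex:]) z \<noteq> 0" by (simp add: pderiv_pCons)
  qed (simp_all add: Sym_def numeral_eq_Suc)
  show "simple_form 6 [:1, 0, 0, 0, 0, 0, 1:]"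
  proof (rule simple_formI)
    fix z assume "poly [:1, 0, 0, 0, 0, 0, 1 :: complex:] z = 0"
    then have "z \<noteq> 0" by auto
    then show "poly (pderiv [:1, 0, 0, 0, 0, 0, 1 :: complex:]) z \<noteq> 0" by (simp add: pderiv_pCons)
  qed (simp_all add: Sym_def numeral_eq_Suc)
  have e: "[:1, 0, 0, 1:] ^ 3 + [:1, 0, 0, 0, 0, 0, 1:] ^ 2 = [:2, 0, 0, 3, 0, 0, 5, 0, 0, 1, 0, 0, 1 :: complex:]"
    by (simp add: eval_nat_numeral)
  show "simple_form 12 ([:1, 0, 0, 1:] ^ 3 + [:1, 0, 0, 0, 0, 0, 1:] ^ 2)" unfolding e
  proof (rule simple_formI)
    fix z :: complex assume "poly [:2, 0, 0, 3, 0, 0, 5, 0, 0, 1, 0, 0, 1:] z = 0"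
    then have 1: "(z ^ 3) ^ 4 + (z ^ 3) ^ 3 + 5 * (z ^ 3) ^ 2 + 3 * z ^ 3 + 2 = 0" by (simp add: algebra_simps eval_nat_numeral)
    then have z: "z \<noteq> 0" by auto
    \<comment> \<open>A Bezout identity between the sum, as a quartic in \<open>w = z^3\<close>, and
      its derivative with respect to \<open>w\<close>; the constant 1492 excludes a common
      zero.\<close>
    have bezout: "(977 + 188 * w + 576 * w\<^sup>2) * (w ^ 4 + w ^ 3 + 5 * w\<^sup>2 + 3 * w + 2) -
        (154 + 589 * w + 83 * w\<^sup>2 + 144 * w ^ 3) * (4 * w ^ 3 + 3 * w\<^sup>2 + 10 * w + 3) = 1492" for w :: complex
      by (simp add: algebra_simps eval_nat_numeral)
    have "4 * (z ^ 3) ^ 3 + 3 * (z ^ 3)\<^sup>2 + 10 * z ^ 3 + 3 \<noteq> 0" using bezout[of "z ^ 3"] 1 by auto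
    then have "3 * z\<^sup>2 * (4 * (z ^ 3) ^ 3 + 3 * (z ^ 3)\<^sup>2 + 10 * z ^ 3 + 3) \<noteq> 0" using z by simp
    then show "poly (pderiv [:2, 0, 0, 3, 0, 0, 5, 0, 0, 1, 0, 0, 1:]) z \<noteq> 0"
      by (simp add: pderiv_pCons algebra_simps eval_nat_numeral)
  qed (simp_all add: Sym_def numeral_eq_Suc)
  have "subring_generated {cis (2 * pi * (1 / 3)), cis (2 * pi * (1 / 2)), cis (2 * pi * (2 / 12))} = subring_generated {cis (2 * pi / 3)}"
    unfolding cis_special by (rule ring_omega) auto
  then show "subring_generated {cis (2 * pi * (1 / real 3)), cis (2 * pi * (1 / real 2)), cis (2 * pi * (2 / real 12))} \<in>
      {subring_generated {\<i>}, subring_generated {cis (2 * pi / 3)}}" by simp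
qed auto

theorem theorem7:
  fixes a b N :: nat
  assumes "a > 0" "b > 0" "N > 0" and "a \<ge> b" and "a dvd N" and "b dvd N"
  shows "(pseudo_disc_hypersurface a b N \<longleftrightarrow> G_triple a b N) \<and>
         (G_triple a b N \<longleftrightarrow>
            (a, b, N) \<in> {(3, 2, 12), (4, 2, 8), (6, 2, 6), (3, 3, 6), (4, 4, 4)})"
proof -
  have "G_triple a b N \<longleftrightarrow> (a, b, N) \<in> {(3, 2, 12), (4, 2, 8), (6, 2, 6), (3, 3, 6), (4, 4, 4)}"
  proof
    show "G_triple a b N \<Longrightarrow> (a, b, N) \<in> {(3, 2, 12), (4, 2, 8), (6, 2, 6), (3, 3, 6), (4, 4, 4)}"
      by (rule G_triple_imp_list[OF assms(4,2,5,6)])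
    show "(a, b, N) \<in> {(3, 2, 12), (4, 2, 8), (6, 2, 6), (3, 3, 6), (4, 4, 4)} \<Longrightarrow> G_triple a b N"
      using G_triple_3_2_12 G_triple_4_2_8 G_triple_6_2_6 G_triple_3_3_6 G_triple_4_4_4 by blast
  qed
  then show ?thesis using pseudo_disc_classification[OF assms] by blast
qed

end
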